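(* Let $C\subset\mathbb{P}^3$ be a smooth irreducible non-degenerate complex projective curve of degree $d$. Then the differential of the cone map $\rho_d\colon U\to G(n_d,S_d)$ is injective at every point of $U$.
   Context: The ground field is $\mathbb{C}$. For $q\in\mathbb{P}^3$, $\pi_q\colon C\to\mathbb{P}^2$ is the restriction to $C$ of the linear projection from $q$ (extended to a morphism if $q\in C$). $S\subset\mathbb{P}^3$ is the (finite) set of points $q$ such that $\pi_q$ is not birational onto its image, and $U=\mathbb{P}^3\setminus(C\cup S)$. Put $V_d=H^0(\mathbb{P}^3,\mathcal{O}_{\mathbb{P}^3}(d))$, $S_d=H^0(C,\mathcal{O}_C(d))$, and let $\phi_d\colon V_d\to S_d$ be restriction. For $q\in U$, $W(q)$ is the 3-dimensional space of linear forms on $\mathbb{P}^3$ vanishing at $q$, $W(q)_d=\mathrm{Sym}^d W(q)\subset V_d$ (cones of degree $d$ with vertex $q$), and $R_d(q)=\phi_d(W(q)_d)\subset S_d$, which has dimension $n_d=\binom{d+2}{2}-1$. The map $\rho_d$ sends $q\in U$ to $R_d(q)$ in the Grassmannian $G(n_d,S_d)$ of $n_d$-dimensional subspaces of $S_d$. *)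

theory Defs
  imports "HOL-Analysis.Analysis" "HOL-Library.Function_Algebras"
begin

section \<open>Complex-valued functions as a complex vector space\<close>

definition cfun_scale :: "complex \<Rightarrow> ('a \<Rightarrow> complex) \<Rightarrow> 'a \<Rightarrow> complex" where
  "cfun_scale c f = (\<lambda>x. c * f x)"

global_interpretation cfun: vector_space "cfun_scale :: complex \<Rightarrow> ('a \<Rightarrow> complex) \<Rightarrow> _"
  by unfold_locales (auto simp: cfun_scale_def fun_eq_iff algebra_simps)


section \<open>Projective space and the Zariski topology\<close>

text \<open>
  A point of the projective space of \<open>complex^'n\<close> is a line through the origin, so a subset of
  projective 3-space has type \<open>(complex^4) set set\<close>.
\<close>

definition pspace :: "(complex^'n) set set" where
  "pspace = {vec.span {v} | v. v \<noteq> 0}"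

text \<open>
  Homogeneous polynomials are identified with the functions they define, which is harmless over
  an infinite field. The zero function is a form of every degree.
\<close>

definition forms :: "nat \<Rightarrow> (complex^'n \<Rightarrow> complex) set" where
  "forms d = cfun.span {(\<lambda>x. \<Prod>i\<in>UNIV. (x $ i) ^ a i) | a :: 'n \<Rightarrow> nat. sum a UNIV = d}"

definition vanishes_on :: "(complex^'n \<Rightarrow> complex) \<Rightarrow> (complex^'n) set set \<Rightarrow> bool" where
  "vanishes_on F X \<longleftrightarrow> (\<forall>p\<in>X. \<forall>v\<in>p - {0}. F v = 0)"

definition zclosed :: "(complex^'n) set set \<Rightarrow> bool" where
  "zclosed X \<longleftrightarrow>
     (\<exists>E \<subseteq> (\<Union>k. forms k). X = {p \<in> pspace. \<forall>F\<in>E. vanishes_on F {p}})"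

definition zclosure :: "(complex^'n) set set \<Rightarrow> (complex^'n) set set" where
  "zclosure X = \<Inter>{Z. zclosed Z \<and> X \<subseteq> Z}"

definition zopen_in :: "(complex^'n) set set \<Rightarrow> (complex^'n) set set \<Rightarrow> bool" where
  "zopen_in X N \<longleftrightarrow> (\<exists>Z. zclosed Z \<and> N = X - Z)"

definition zirreducible :: "(complex^'n) set set \<Rightarrow> bool" where
  "zirreducible X \<longleftrightarrow> X \<noteq> {} \<and>
     (\<forall>A B. zclosed A \<and> zclosed B \<and> X \<subseteq> A \<union> B \<longrightarrow> X \<subseteq> A \<or> X \<subseteq> B)"

definition irreducible_chain :: "(complex^'n) set set \<Rightarrow> nat \<Rightarrow> (nat \<Rightarrow> (complex^'n) set set) \<Rightarrow> bool"
  where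
  "irreducible_chain X r Z \<longleftrightarrow>
     (\<forall>i\<le>r. zclosed (Z i) \<and> zirreducible (Z i) \<and> Z i \<subseteq> X) \<and> (\<forall>i<r. Z i \<subset> Z (Suc i))"

text \<open>Krull dimension of a Zariski closed set.\<close>

definition has_zdim :: "(complex^'n) set set \<Rightarrow> nat \<Rightarrow> bool" where
  "has_zdim X r \<longleftrightarrow>
     (\<exists>Z. irreducible_chain X r Z) \<and> \<not> (\<exists>Z. irreducible_chain X (Suc r) Z)"


section \<open>Curves\<close>

definition irreducible_projective_curve :: "(complex^'n) set set \<Rightarrow> bool" where
  "irreducible_projective_curve X \<longleftrightarrow> zclosed X \<and> zirreducible X \<and> has_zdim X 1"

text \<open>
  The linear subspace whose projectivisation is the embedded projective tangent space of \<open>X\<close>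
  at \<open>p\<close>, that is, the kernel at a representative of \<open>p\<close> of the Jacobian matrix of all forms in
  the homogeneous ideal of \<open>X\<close>.
\<close>

definition affine_tangent_space :: "(complex^'n) set set \<Rightarrow> (complex^'n) set \<Rightarrow> (complex^'n) set" where
  "affine_tangent_space X p =
     {w. \<forall>k. \<forall>F\<in>forms k. vanishes_on F X \<longrightarrow>
           (\<forall>v\<in>p - {0}. deriv (\<lambda>t. F (v + t *s w)) 0 = 0)}"

text \<open>Jacobian criterion; the dimension is that of the affine cone over the curve.\<close>

definition smooth_curve :: "(complex^'n) set set \<Rightarrow> bool" where
  "smooth_curve X \<longleftrightarrow> (\<forall>p\<in>X. vec.dim (affine_tangent_space X p) = 2)"

definition nondegenerate :: "(complex^'n) set set \<Rightarrow> bool" where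
  "nondegenerate X \<longleftrightarrow> (\<forall>L\<in>forms 1. vanishes_on L X \<longrightarrow> L = 0)"

text \<open>
  Restriction of a form to the punctured affine cone over \<open>X\<close>. Functions on that cone are
  extended by zero, so that they can be compared as functions on the whole vector space.
\<close>

definition restrict_to :: "(complex^'n) set set \<Rightarrow> (complex^'n \<Rightarrow> complex) \<Rightarrow> complex^'n \<Rightarrow> complex"
  where
  "restrict_to X F = (\<lambda>v. if v \<in> \<Union>X - {0} then F v else 0)"

text \<open>
  The image of the forms of degree \<open>m\<close> is the degree \<open>m\<close> part of the homogeneous coordinate
  ring. For a curve the Hilbert polynomial is linear and its leading coefficient is the degree.
\<close>

definition curve_has_degree :: "(complex^'n) set set \<Rightarrow> nat \<Rightarrow> bool" where
  "curve_has_degree X d \<longleftrightarrow>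
     (\<exists>c::int. \<forall>\<^sub>F m in sequentially. int (cfun.dim (restrict_to X ` forms m)) = int d * int m + c)"

text \<open>
  Global sections of \<open>O_X(d)\<close>: functions on the punctured cone over \<open>X\<close> which Zariski-locally
  on \<open>X\<close> are quotients of forms with difference of degrees \<open>d\<close>.
\<close>

definition sections :: "(complex^'n) set set \<Rightarrow> nat \<Rightarrow> (complex^'n \<Rightarrow> complex) set" where
  "sections X d =
     {s. (\<forall>v. v \<notin> \<Union>X - {0} \<longrightarrow> s v = 0) \<and>
         (\<forall>p\<in>X. \<exists>N e. \<exists>A\<in>forms (d + e). \<exists>B\<in>forms e. zopen_in X N \<and> p \<in> N \<and>
            (\<forall>z\<in>N. \<forall>v\<in>z - {0}. B v \<noteq> 0 \<and> s v = A v / B v))}"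


section \<open>Birationality of linear projections\<close>

text \<open>
  Morphisms from a locally closed set \<open>Y\<close>: locally given by tuples of forms of equal degree
  without common zeros.
\<close>

definition regular_map ::
  "(complex^'m) set set \<Rightarrow> ((complex^'m) set \<Rightarrow> (complex^'n) set) \<Rightarrow> bool" where
  "regular_map Y g \<longleftrightarrow>
     (\<forall>y\<in>Y. \<exists>N k (G :: complex^'m \<Rightarrow> complex^'n).
        zopen_in Y N \<and> y \<in> N \<and> (\<forall>i. (\<lambda>v. G v $ i) \<in> forms k) \<and>
        (\<forall>z\<in>N. \<forall>v\<in>z - {0}. G v \<noteq> 0 \<and> g z = vec.span {G v}))"

text \<open>
  \<open>f\<close> restricts to an isomorphism from a nonempty open subset of \<open>X\<close> onto an open subset of the
  closure of its image.
\<close>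

definition birational_onto_image ::
  "(complex^'m) set set \<Rightarrow> ((complex^'m) set \<Rightarrow> (complex^'n) set) \<Rightarrow> bool" where
  "birational_onto_image X f \<longleftrightarrow>
     (\<exists>X0 Y0 g. zopen_in X X0 \<and> X0 \<noteq> {} \<and> zopen_in (zclosure (f ` X)) Y0 \<and>
        f ` X0 = Y0 \<and> regular_map X0 f \<and> regular_map Y0 g \<and> (\<forall>x\<in>X0. g (f x) = x))"

text \<open>
  The linear projection from \<open>q\<close> is induced by a linear map with kernel \<open>q\<close>, unique up to a
  projective transformation of the plane. If \<open>q\<close> lies on \<open>C\<close>, the extension of the projection
  across \<open>q\<close> affects neither the closure of the image nor birationality, hence \<open>C - {q}\<close>.
\<close>

definition birational_projection :: "(complex^4) set set \<Rightarrow> (complex^4) set \<Rightarrow> bool" where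
  "birational_projection C q \<longleftrightarrow>
     (\<exists>A :: complex^4^3. {v. A *v v = 0} = q \<and>
        birational_onto_image (C - {q}) (\<lambda>p. (\<lambda>v. A *v v) ` p))"

definition nonbirational_points :: "(complex^4) set set \<Rightarrow> (complex^4) set set" where
  "nonbirational_points C = {q \<in> pspace. \<not> birational_projection C q}"

definition cone_map_domain :: "(complex^4) set set \<Rightarrow> (complex^4) set set" where
  "cone_map_domain C = pspace - (C \<union> nonbirational_points C)"


section \<open>The cone map\<close>

definition linear_forms_vanishing_at :: "(complex^4) set \<Rightarrow> (complex^4 \<Rightarrow> complex) set" where
  "linear_forms_vanishing_at q = {L \<in> forms 1. vanishes_on L {q}}"

text \<open>The image in the forms of degree \<open>d\<close> of the \<open>d\<close>-th symmetric power of the above space.\<close>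

definition cone_forms :: "(complex^4) set \<Rightarrow> nat \<Rightarrow> (complex^4 \<Rightarrow> complex) set" where
  "cone_forms q d = cfun.span {(\<lambda>x. \<Prod>i<d. L i x) | L. \<forall>i<d. L i \<in> linear_forms_vanishing_at q}"

definition cone_map :: "(complex^4) set set \<Rightarrow> nat \<Rightarrow> (complex^4) set \<Rightarrow> (complex^4 \<Rightarrow> complex) set"
  where
  "cone_map C d q = restrict_to C ` cone_forms q d"


section \<open>Differentials of maps from projective space to a Grassmannian\<close>

definition grassmannian :: "nat \<Rightarrow> ('a \<Rightarrow> complex) set \<Rightarrow> ('a \<Rightarrow> complex) set set" where
  "grassmannian n S =
     {cfun.span B | B. finite B \<and> card B = n \<and> cfun.independent B \<and> cfun.span B \<subseteq> S}"

text \<open>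
  Affine charts of projective 3-space centred at \<open>q\<close>: the columns of \<open>A\<close> and the representative
  \<open>u\<close> of \<open>q\<close> form a basis.
\<close>

definition affine_chart :: "complex^4 \<Rightarrow> complex^3^4 \<Rightarrow> complex^3 \<Rightarrow> (complex^4) set" where
  "affine_chart u A x = vec.span {u + A *v x}"

definition chart_centre :: "complex^4 \<Rightarrow> complex^3^4 \<Rightarrow> (complex^4) set \<Rightarrow> bool" where
  "chart_centre u A q \<longleftrightarrow>
     q = vec.span {u} \<and> inj (\<lambda>x. A *v x) \<and> u \<notin> range (\<lambda>x. A *v x)"

text \<open>
  Charts of a Grassmannian at \<open>K\<close>: for a complement \<open>M\<close> of \<open>K\<close> in \<open>S\<close>, the subspaces meeting \<open>M\<close>
  trivially are the graphs of the linear maps from \<open>K\<close> to \<open>M\<close>. Such a linear map is represented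
  by a linear extension to all functions, of which only the restriction to \<open>K\<close> matters.
\<close>

definition complement_in ::
  "('a \<Rightarrow> complex) set \<Rightarrow> ('a \<Rightarrow> complex) set \<Rightarrow> ('a \<Rightarrow> complex) set \<Rightarrow> bool" where
  "complement_in S K M \<longleftrightarrow> cfun.subspace M \<and> K \<inter> M = {0} \<and> {k + m | k m. k \<in> K \<and> m \<in> M} = S"

definition hom_between ::
  "('a \<Rightarrow> complex) set \<Rightarrow> ('a \<Rightarrow> complex) set \<Rightarrow> (('a \<Rightarrow> complex) \<Rightarrow> 'a \<Rightarrow> complex) set" where
  "hom_between K M = {T. Vector_Spaces.linear cfun_scale cfun_scale T \<and> T ` K \<subseteq> M}"

definition graph_over ::
  "('a \<Rightarrow> complex) set \<Rightarrow> (('a \<Rightarrow> complex) \<Rightarrow> 'a \<Rightarrow> complex) \<Rightarrow> ('a \<Rightarrow> complex) set" where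
  "graph_over K T = {s + T s | s. s \<in> K}"

text \<open>
  \<open>D\<close> is the complex differential at \<open>q\<close> of the map \<open>f\<close> to the Grassmannian of \<open>n\<close>-dimensional
  subspaces of \<open>S\<close>, expressed in the chart given by \<open>u\<close> and \<open>A\<close> on the source and the chart
  given by \<open>M\<close> on the target. The vector space \<open>S\<close> is meant to be finite-dimensional. Its
  standard topology is then that of pointwise convergence, so that the derivative of a function
  with values in linear maps into \<open>S\<close> can be taken after evaluation at \<open>s\<close> and \<open>y\<close>.
\<close>

definition has_differential_in_charts ::
  "nat \<Rightarrow> ('a \<Rightarrow> complex) set \<Rightarrow> ((complex^4) set \<Rightarrow> ('a \<Rightarrow> complex) set) \<Rightarrow> (complex^4) set \<Rightarrow>
   complex^4 \<Rightarrow> complex^3^4 \<Rightarrow> ('a \<Rightarrow> complex) set \<Rightarrow>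
   (complex^3 \<Rightarrow> ('a \<Rightarrow> complex) \<Rightarrow> 'a \<Rightarrow> complex) \<Rightarrow> bool" where
  "has_differential_in_charts n S f q u A M D \<longleftrightarrow>
     f q \<in> grassmannian n S \<and> chart_centre u A q \<and> complement_in S (f q) M \<and>
     (\<forall>x. D x \<in> hom_between (f q) M) \<and>
     (\<forall>s\<in>f q. Vector_Spaces.linear (*s) cfun_scale (\<lambda>x. D x s)) \<and>
     (\<exists>T. (\<forall>\<^sub>F x in nhds 0. T x \<in> hom_between (f q) M \<and>
                             f (affine_chart u A x) = graph_over (f q) (T x)) \<and>
          (\<forall>s\<in>f q. \<forall>y. ((\<lambda>x. T x s y) has_derivative (\<lambda>x. D x s y)) (at 0)))"

text \<open>Neither differentiability nor injectivity depends on the choice of charts.\<close>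

definition injective_differential_at ::
  "nat \<Rightarrow> ('a \<Rightarrow> complex) set \<Rightarrow> ((complex^4) set \<Rightarrow> ('a \<Rightarrow> complex) set) \<Rightarrow> (complex^4) set \<Rightarrow> bool"
  where
  "injective_differential_at n S f q \<longleftrightarrow>
     (\<exists>u A M D. has_differential_in_charts n S f q u A M D \<and>
        (\<forall>x. (\<forall>s\<in>f q. D x s = 0) \<longrightarrow> x = 0))"

end

theory Submission
  imports Defs "HOL-Computational_Algebra.Fundamental_Theorem_Algebra"
begin

text \<open>
  Let \<open>R\<close> and \<open>S\<close> be the homogeneous coordinate rings of the plane image of \<open>C\<close> under the projection from
  \<open>q\<close> and of \<open>C\<close> itself, and let \<open>f\<close> be the equation of the image. Since \<open>q\<close> does not lie on \<open>C\<close> and the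
  projection is birational, some nonzero form multiplies \<open>S\<close> into \<open>R\<close>, so that the Hilbert polynomials
  of \<open>R\<close> and \<open>S\<close> have the same leading coefficient and \<open>f\<close> has degree \<open>d\<close>. For any vertex the
  inclusion of \<open>R\<close> in \<open>S\<close> bounds the degree of the image by \<open>d\<close>; hence the dimension
  of the image of the cones of degree \<open>d\<close>, which cannot drop near \<open>q\<close>, is constant there.

  Let \<open>W\<close> be a linear form with \<open>W q \<noteq> 0\<close>. In suitable coordinates the cone map sends the vertex \<open>q + t\<close>
  to the space of the \<open>F (X - W t)\<close> with \<open>F\<close> a ternary form of degree \<open>d\<close>, so that its differential in
  direction \<open>\<tau>\<close> sends \<open>F\<close> to the class of \<open>- W \<partial>\<^sub>\<tau> F\<close> modulo \<open>R\<^sub>d\<close>. If it vanishes for some \<open>\<tau> \<noteq> 0\<close>, then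
  \<open>W R\<^sub>m\<close> is contained in \<open>R\<^bsub>m+1\<^esub>\<close> for \<open>m = d - 1\<close>. As a plane curve is Cohen-Macaulay, this descends
  to \<open>m = 0\<close>: on \<open>C\<close> the form \<open>W\<close> agrees with a linear form that vanishes at \<open>q\<close>, which contradicts the
  nondegeneracy of \<open>C\<close>.
\<close>

subsection \<open>Forms\<close>

text \<open>The obstacle is that a vertex near \<open>q\<close> is not known to give a birational
  projection: its plane image may have degree \<open>e < d\<close>. Its equation times a power of a
  coordinate is still a relation of degree \<open>d\<close>, and one relation is all that the upper
  bound on the dimension requires. The lower bound is the persistence of an invertible matrix.
  Without this constancy the derivative of a moving cone would not determine a class modulo
  \<open>K\<close> that depends on the restriction of the cone to \<open>C\<close> alone.

  The multiplier in the degree comparison has to work in all degrees at once, since a shift growing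
  with the degree would change the slope of the Hilbert function. This is where \<open>q\<close>
  lying off \<open>C\<close> enters: a form vanishing on \<open>C\<close> but not at
  \<open>q\<close> is an integral equation for \<open>W\<close>.

  A vanishing differential speaks about all \<open>h\<close> of degree \<open>d - 1\<close> because
  each such \<open>h\<close> is a derivative of a form of degree \<open>d\<close> in the given
  direction. Cohen-Macaulayness takes a concrete shape: the plane coordinates are chosen with
  (0:0:1) off the image curve, so that the first two coordinates form a regular sequence on its
  ring.\<close>

lemma forms_subspace: "cfun.subspace (forms m)"
  unfolding forms_def by (rule cfun.subspace_span)

lemma forms_zero [simp, intro]: "(\<lambda>_. 0) \<in> forms m"
  using cfun.subspace_0[OF forms_subspace] by (simp add: zero_fun_def)

lemma forms_add [intro]: "F \<in> forms m \<Longrightarrow> G \<in> forms m \<Longrightarrow> (\<lambda>v. F v + G v) \<in> forms m"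
  using cfun.subspace_add[OF forms_subspace] by (auto simp: plus_fun_def)

lemma forms_scale [intro]: "F \<in> forms m \<Longrightarrow> (\<lambda>v. c * F v) \<in> forms m"
  using cfun.subspace_scale[OF forms_subspace] by (auto simp: cfun_scale_def)

lemma forms_uminus [intro]: "F \<in> forms m \<Longrightarrow> (\<lambda>v. - F v) \<in> forms m"
  using forms_scale[of F m "-1"] by simp

lemma forms_diff [intro]: "F \<in> forms m \<Longrightarrow> G \<in> forms m \<Longrightarrow> (\<lambda>v. F v - G v) \<in> forms m"
  using forms_add[of F m "\<lambda>v. - G v"] by auto

lemma forms_sum: "(\<And>i. i \<in> I \<Longrightarrow> F i \<in> forms m) \<Longrightarrow> (\<lambda>v. \<Sum>i\<in>I. F i v) \<in> forms m"
  by (induction I rule: infinite_finite_induct) auto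

lemma forms_const [simp, intro]: "(\<lambda>_. c) \<in> forms 0"
proof -
  have "(\<lambda>x::complex^'a. \<Prod>i\<in>UNIV. (x $ i) ^ (\<lambda>_. 0::nat) i) \<in> forms 0"
    unfolding forms_def by (rule cfun.span_base) force
  from forms_scale[OF this, of c] show ?thesis by simp
qed

lemma monomial_mult_coord:
  fixes a :: "'n::finite \<Rightarrow> nat"
  shows "(\<Prod>i\<in>UNIV. (x $ i) ^ (a(j := Suc (a j))) i) = (x $ j :: complex) * (\<Prod>i\<in>UNIV. (x $ i) ^ a i)"
proof -
  have "(\<Prod>i\<in>UNIV. (x $ i) ^ (a(j := Suc (a j))) i)
      = (\<Prod>i\<in>UNIV. (if i = j then x $ j else 1) * (x $ i) ^ a i)"
    by (intro prod.cong) auto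
  then show ?thesis by (simp add: prod.distrib)
qed

lemma forms_mult_coord [intro]:
  assumes "F \<in> forms m"
  shows "(\<lambda>v. v $ j * F v) \<in> forms (Suc m)"
proof -
  have "forms m \<subseteq> {F. (\<lambda>v. v $ j * F v) \<in> forms (Suc m)}"
    unfolding forms_def[of m]
  proof (rule cfun.span_minimal, rule subsetI)
    show "cfun.subspace {F. (\<lambda>v. v $ j * F v) \<in> forms (Suc m)}"
      unfolding cfun.subspace_def
      by (auto simp: zero_fun_def plus_fun_def cfun_scale_def distrib_left mult.left_commute)
    fix F :: "complex^'a \<Rightarrow> complex"
    assume "F \<in> {\<lambda>x. \<Prod>i\<in>UNIV. (x $ i) ^ a i | a. sum a UNIV = m}"
    then obtain a where F: "F = (\<lambda>x. \<Prod>i\<in>UNIV. (x $ i) ^ a i)" and a: "sum a UNIV = m" by auto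
    have "sum (a(j := Suc (a j))) UNIV = (\<Sum>i\<in>UNIV. (if i = j then 1 else 0) + a i)"
      by (intro sum.cong) auto
    also have "\<dots> = Suc m" by (simp add: sum.distrib a)
    finally have "(\<lambda>x::complex^'a. \<Prod>i\<in>UNIV. (x $ i) ^ (a(j := Suc (a j))) i) \<in> forms (Suc m)"
      unfolding forms_def by (intro cfun.span_base) blast
    then show "F \<in> {F. (\<lambda>v. v $ j * F v) \<in> forms (Suc m)}"
      unfolding F mem_Collect_eq monomial_mult_coord .
  qed
  then show ?thesis using assms by blast
qed

text \<open>Monomials are built one coordinate at a time, so a property only has to survive
  multiplication by a coordinate and linear combinations. Membership in \<open>forms\<close> is
  carried along because the inductive steps often need it.\<close>

lemma forms_induct [consumes 1, case_names const mult_coord add scale]: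
  fixes F :: "complex^'n \<Rightarrow> complex"
  assumes F: "F \<in> forms m"
    and const: "\<And>c. P 0 (\<lambda>_. c)"
    and mult_coord: "\<And>m F i. F \<in> forms m \<Longrightarrow> P m F \<Longrightarrow> P (Suc m) (\<lambda>v. v $ i * F v)"
    and add: "\<And>m F G. F \<in> forms m \<Longrightarrow> G \<in> forms m \<Longrightarrow> P m F \<Longrightarrow> P m G \<Longrightarrow> P m (\<lambda>v. F v + G v)"
    and scale: "\<And>m F c. F \<in> forms m \<Longrightarrow> P m F \<Longrightarrow> P m (\<lambda>v. c * F v)"
  shows "P m F"
proof -
  \<comment> \<open>A span contains zero, so zero must be reached in every degree: from the constant
    0 by multiplying with coordinates.\<close>
  have zero: "P m (\<lambda>_. 0)" for m
  proof (induction m)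
    case (Suc m)
    from mult_coord[OF _ this] show ?case by simp
  qed (rule const)
  have mono: "P m (\<lambda>x. \<Prod>i\<in>UNIV. (x $ i) ^ a i) \<and> (\<lambda>x. \<Prod>i\<in>UNIV. (x $ i) ^ a i) \<in> forms m"
    if "sum a UNIV = m" for a :: "'n \<Rightarrow> nat" and m
    using that
  proof (induction m arbitrary: a)
    case 0
    then have "a = (\<lambda>_. 0)" by auto
    then show ?case using const[of 1] by simp
  next
    case (Suc m)
    then obtain j where j: "a j \<noteq> 0" by (metis Zero_not_Suc sum.neutral)
    define b where "b = a(j := a j - 1)"
    have a: "a = b(j := Suc (b j))" using j by (auto simp: b_def fun_eq_iff)
    have "sum a UNIV = (\<Sum>i\<in>UNIV. (if i = j then 1 else 0) + b i)"
      unfolding a by (intro sum.cong) auto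
    then have "sum b UNIV = m" using Suc.prems by (simp add: sum.distrib)
    from Suc.IH[OF this] have IH: "P m (\<lambda>x. \<Prod>i\<in>UNIV. (x $ i) ^ b i)"
      "(\<lambda>x. \<Prod>i\<in>UNIV. (x $ i) ^ b i) \<in> forms m" by auto
    show ?case unfolding a monomial_mult_coord
      using mult_coord[OF IH(2,1)] forms_mult_coord[OF IH(2)] by simp
  qed
  have "forms m \<subseteq> {F \<in> forms m. P m F}"
    unfolding forms_def[of m]
  proof (rule cfun.span_minimal, rule subsetI)
    show "cfun.subspace {F \<in> cfun.span {\<lambda>x. \<Prod>i\<in>UNIV. (x $ i) ^ a i |a. sum a UNIV = m}. P m F}"
      unfolding cfun.subspace_def forms_def[symmetric]
      by (simp add: zero_fun_def plus_fun_def cfun_scale_def zero add scale forms_add forms_scale)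
    fix G :: "complex^'n \<Rightarrow> complex"
    assume "G \<in> {\<lambda>x. \<Prod>i\<in>UNIV. (x $ i) ^ a i |a. sum a UNIV = m}"
    then show "G \<in> {F \<in> cfun.span {\<lambda>x. \<Prod>i\<in>UNIV. (x $ i) ^ a i |a. sum a UNIV = m}. P m F}"
      unfolding forms_def[symmetric] using mono by blast
  qed
  then show ?thesis using F by blast
qed

lemma forms_mult [intro]:
  assumes "F \<in> forms a" "G \<in> forms b"
  shows "(\<lambda>v. F v * G v) \<in> forms (a + b)"
  using assms(1)
proof (induction rule: forms_induct)
  case (mult_coord m F i)
  then show ?case by (auto simp: mult.assoc)
qed (use assms(2) in \<open>auto simp: distrib_right mult.assoc\<close>)

lemma forms_power [intro]: "F \<in> forms a \<Longrightarrow> (\<lambda>v. F v ^ k) \<in> forms (k * a)"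
  by (induction k) auto

lemma forms_coord [simp, intro]: "(\<lambda>v. v $ i) \<in> forms (Suc 0)"
  using forms_mult_coord[of "\<lambda>_. 1" 0 i] by simp

lemma forms_matrix_coord [simp, intro]: "(\<lambda>v. (A *v v) $ i) \<in> forms (Suc 0)"
  unfolding matrix_vector_mult_def by (auto intro!: forms_sum)

lemma forms_compose:
  assumes "F \<in> forms m" "\<And>i. (\<lambda>v. L v $ i) \<in> forms k"
  shows "(\<lambda>v. F (L v)) \<in> forms (m * k)"
  using assms(1)
proof (induction rule: forms_induct)
  case (mult_coord m F i)
  from forms_mult[OF assms(2)[of i] this(2)] show ?case by simp
qed auto

lemma forms_compose_linear:
  assumes "F \<in> forms m" "\<And>i. (\<lambda>v. L v $ i) \<in> forms 1"
  shows "(\<lambda>v. F (L v)) \<in> forms m"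
  using forms_compose[OF assms] by simp

lemma forms_homogeneous:
  "F \<in> forms m \<Longrightarrow> F (c *s v) = c ^ m * F v"
  by (induction rule: forms_induct) (auto simp: algebra_simps)

lemma forms_0_const: "F \<in> forms 0 \<Longrightarrow> F v = F 0"
  using forms_homogeneous[of F 0 0 v] by simp

lemma forms_at_0: "F \<in> forms m \<Longrightarrow> 0 < m \<Longrightarrow> F 0 = 0"
  using forms_homogeneous[of F m 0 0] by (simp add: power_0_left)

lemma forms_1_sum:
  assumes "F \<in> forms 1"
  obtains a where "\<And>v. F v = (\<Sum>i\<in>UNIV. a i * v $ i)"
proof -
  have *: "(m = 0 \<longrightarrow> (\<exists>c. F = (\<lambda>_. c))) \<and> (m = 1 \<longrightarrow> (\<exists>a. F = (\<lambda>v. \<Sum>i\<in>UNIV. a i * v $ i)))"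
    if "F \<in> forms m" for m and F :: "complex^'a \<Rightarrow> complex"
    using that
  proof (induction rule: forms_induct)
    case (mult_coord m F i)
    show ?case
    proof (intro conjI impI)
      assume "Suc m = 1"
      then obtain c where F: "F = (\<lambda>_. c)" using mult_coord by auto
      have "(\<lambda>v. v $ i * F v) = (\<lambda>v. \<Sum>j\<in>UNIV. (if j = i then c else 0) * v $ j)"
        by (auto simp: F if_distrib[of "\<lambda>x. x * _"] cong: if_cong)
      then show "\<exists>a. (\<lambda>v. v $ i * F v) = (\<lambda>v. \<Sum>i\<in>UNIV. a i * v $ i)"
        by (intro exI[of _ "\<lambda>j. if j = i then c else 0"])
    qed simp
  next
    case (add m F G)
    show ?case
    proof (intro conjI impI)
      assume "m = 1"
      then obtain a b where "F = (\<lambda>v. \<Sum>i\<in>UNIV. a i * v $ i)" "G = (\<lambda>v. \<Sum>i\<in>UNIV. b i * v $ i)"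
        using add by auto
      then have "(\<lambda>v. F v + G v) = (\<lambda>v. \<Sum>j\<in>UNIV. (a j + b j) * v $ j)"
        by (simp add: sum.distrib distrib_right)
      then show "\<exists>a. (\<lambda>v. F v + G v) = (\<lambda>v. \<Sum>i\<in>UNIV. a i * v $ i)"
        by (intro exI[of _ "\<lambda>j. a j + b j"])
    qed (use add in auto)
  next
    case (scale m F c)
    show ?case
    proof (intro conjI impI)
      assume "m = 1"
      then obtain a where "F = (\<lambda>v. \<Sum>i\<in>UNIV. a i * v $ i)"
        using scale by auto
      then have "(\<lambda>v. c * F v) = (\<lambda>v. \<Sum>j\<in>UNIV. (c * a j) * v $ j)"
        by (simp add: sum_distrib_left mult.assoc)
      then show "\<exists>a. (\<lambda>v. c * F v) = (\<lambda>v. \<Sum>i\<in>UNIV. a i * v $ i)"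
        by (intro exI[of _ "\<lambda>j. c * a j"])
    qed (use scale in auto)
  qed auto
  obtain a where "F = (\<lambda>v. \<Sum>i\<in>UNIV. a i * v $ i)" using *[OF assms] by auto
  then show thesis by (intro that[of a]) simp
qed

lemma forms_1_add:
  assumes "F \<in> forms 1" shows "F (v + w) = F v + F w"
proof -
  obtain a where "\<And>v. F v = (\<Sum>i\<in>UNIV. a i * v $ i)" using forms_1_sum[OF assms] by blast
  then show ?thesis by (simp add: distrib_left sum.distrib)
qed

lemma forms_1_scale: "F \<in> forms 1 \<Longrightarrow> F (c *s v) = c * F v"
  using forms_homogeneous[of F 1] by simp

lemma forms_1_diff:
  assumes "F \<in> forms 1" shows "F (v - w) = F v - F w"
  using forms_1_add[OF assms, of "v - w" w] by simp

lemma forms_on_line: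
  "F \<in> forms m \<Longrightarrow> \<exists>p. \<forall>t. F (u + t *s w) = poly p t"
proof (induction rule: forms_induct)
  case (const c)
  show ?case by (rule exI[of _ "[:c:]"]) simp
next
  case (mult_coord m F i)
  then obtain p where "\<forall>t. F (u + t *s w) = poly p t" by blast
  then show ?case by (intro exI[of _ "[:u $ i, w $ i:] * p"]) (simp add: algebra_simps)
next
  case (add m F G)
  then obtain p q where "\<forall>t. F (u + t *s w) = poly p t" "\<forall>t. G (u + t *s w) = poly q t" by blast
  then show ?case by (intro exI[of _ "p + q"]) simp
next
  case (scale m F c)
  then obtain p where "\<forall>t. F (u + t *s w) = poly p t" by blast
  then show ?case by (intro exI[of _ "smult c p"]) simp
qed

text \<open>Join a point where \<open>F\<close> is nonzero to one where \<open>G\<close> is nonzero.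
  On this line both become nonzero univariate polynomials whose product vanishes everywhere.\<close>

lemma forms_no_zero_divisors:
  assumes F: "F \<in> forms a" and G: "G \<in> forms b" and FG: "\<And>v. F v * G v = 0"
  shows "(\<forall>v. F v = 0) \<or> (\<forall>v. G v = 0)"
proof (rule ccontr)
  assume "\<not> ?thesis"
  then obtain u w where uw: "F u \<noteq> 0" "G w \<noteq> 0" by blast
  obtain p q where p: "\<And>t. F (u + t *s (w - u)) = poly p t" and q: "\<And>t. G (u + t *s (w - u)) = poly q t"
    using forms_on_line[OF F] forms_on_line[OF G] by metis
  have "poly (p * q) t = 0" for t
    using FG by (simp flip: p q)
  then have "p * q = 0" using poly_all_0_iff_0 by blast
  moreover have "poly p 0 \<noteq> 0" "poly q 1 \<noteq> 0" using uw by (simp_all flip: p q)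
  ultimately show False by auto
qed

text \<open>The map \<open>v \<mapsto> v - \<ell> v *s w\<close> is a projection onto the hyperplane \<open>\<ell> = 0\<close>; hence a form that
  vanishes on this hyperplane is divisible by \<open>\<ell>\<close>.\<close>

lemma forms_hyperplane_decomp:
  assumes "F \<in> forms m" "l \<in> forms 1"
  shows "\<exists>G\<in>forms (m - 1). \<forall>v. F v = F (v - l v *s w) + l v * G v"
  using assms(1)
proof (induction rule: forms_induct)
  case (const c)
  show ?case by (rule bexI[of _ "\<lambda>_. 0"]) auto
next
  case (mult_coord m F i)
  then obtain G where G: "G \<in> forms (m - 1)" "\<And>v. F v = F (v - l v *s w) + l v * G v" by blast
  \<comment> \<open>Write \<open>v $ i\<close> as the \<open>i\<close>-th coordinate of the
    projected vector plus \<open>l v * w $ i\<close>. The second summand multiplies all of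
    \<open>F v\<close>, the first one the decomposition of \<open>F v\<close>.\<close>
  let ?H = "\<lambda>v. w $ i * F v + (v $ i - l v * w $ i) * G v"
  show ?case
  proof (cases m)
    \<comment> \<open>Here \<open>m - 1\<close> truncates: \<open>G\<close> lies in
      \<open>forms 0\<close> instead of being zero, and \<open>?H\<close> would not be homogeneous.
      Constants are therefore treated by hand.\<close>
    case 0
    have "F = (\<lambda>_. F 0)"
      using mult_coord(1) unfolding 0 by (intro ext) (rule forms_0_const)
    then obtain c where "F = (\<lambda>_. c)" by blast
    then show ?thesis
      by (intro bexI[of _ "\<lambda>_. w $ i * c"]) (auto simp: 0 algebra_simps)
  next
    case (Suc k)
    have "(\<lambda>v. (v $ i - w $ i * l v)) \<in> forms 1"
      using assms(2) by auto
    from forms_mult[OF this G(1)] have "(\<lambda>v. (v $ i - l v * w $ i) * G v) \<in> forms m"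
      by (simp add: Suc mult.commute)
    then have H: "?H \<in> forms m" using mult_coord(1) by auto
    have "v $ i * F v = (v - l v *s w) $ i * F (v - l v *s w) + l v * ?H v" for v
      using G(2)[of v] by (simp add: algebra_simps)
    then show ?thesis using H by (intro bexI[of _ ?H]) auto
  qed
next
  case (add m F1 F2)
  then obtain G1 G2 where "G1 \<in> forms (m - 1)" "\<And>v. F1 v = F1 (v - l v *s w) + l v * G1 v"
    "G2 \<in> forms (m - 1)" "\<And>v. F2 v = F2 (v - l v *s w) + l v * G2 v" by metis
  then show ?case
    by (intro bexI[of _ "\<lambda>v. G1 v + G2 v"] allI) (metis (no_types) add.assoc add.left_commute distrib_left, blast)
next
  case (scale m F c)
  then obtain G where "G \<in> forms (m - 1)" "\<And>v. F v = F (v - l v *s w) + l v * G v" by metis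
  then show ?case
    by (intro bexI[of _ "\<lambda>v. c * G v"] allI) (metis (no_types) mult.left_commute distrib_left, blast)
qed

subsection \<open>Finite-dimensional spaces of functions\<close>

global_interpretation cfun_pair: vector_space_pair
  "cfun_scale :: complex \<Rightarrow> ('a \<Rightarrow> complex) \<Rightarrow> _" "cfun_scale :: complex \<Rightarrow> ('b \<Rightarrow> complex) \<Rightarrow> _"
  by unfold_locales

lemma sum_fun_apply: "(\<Sum>i\<in>I. f i) x = (\<Sum>i\<in>I. f i x)"
  for f :: "'i \<Rightarrow> 'a \<Rightarrow> 'b :: comm_monoid_add"
  by (induction I rule: infinite_finite_induct) (simp_all add: zero_fun_def plus_fun_def)

abbreviation cfun_linear :: "(('a \<Rightarrow> complex) \<Rightarrow> 'b \<Rightarrow> complex) \<Rightarrow> bool" where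
  "cfun_linear \<equiv> Vector_Spaces.linear cfun_scale cfun_scale"

lemma cfun_linearI:
  assumes "\<And>f g. L (f + g) = L f + L g" "\<And>c f. L (cfun_scale c f) = cfun_scale c (L f)"
  shows "cfun_linear L"
  using assms by (simp add: Vector_Spaces.linear_iff cfun.vector_space_axioms)

lemma cfun_dim_mono:
  assumes "U \<subseteq> V" "V \<subseteq> cfun.span A" "finite A"
  shows "cfun.dim U \<le> cfun.dim V"
proof -
  obtain B where B: "B \<subseteq> V" "cfun.independent B" "V \<subseteq> cfun.span B" "card B = cfun.dim V"
    using cfun.basis_exists by blast
  have "finite B" using cfun.independent_span_bound[OF assms(3) B(2)] B(1) assms(2) by blast
  with B assms(1) show ?thesis using cfun.dim_le_card[of U B] by auto
qed

text \<open>Working with indexed families makes distinctness of the vectors a consequence: two equal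
  members would satisfy the relation with coefficients 1 and -1.\<close>

lemma cfun_independent_family:
  assumes "finite I" and ind: "\<And>c. (\<Sum>i\<in>I. cfun_scale (c i) (f i)) = 0 \<Longrightarrow> \<forall>i\<in>I. c i = 0"
  shows "inj_on f I" "cfun.independent (f ` I)"
proof -
  show inj: "inj_on f I"
  proof (rule inj_onI, rule ccontr)
    fix i j assume ij: "i \<in> I" "j \<in> I" "f i = f j" "i \<noteq> j"
    let ?c = "\<lambda>k. if k = i then 1 else if k = j then - 1 else (0 :: complex)"
    have "(\<Sum>k\<in>I. cfun_scale (?c k) (f k)) = (\<Sum>k\<in>{i, j}. cfun_scale (?c k) (f k))"
      using ij assms(1) by (intro sum.mono_neutral_right) auto
    also have "\<dots> = 0" using ij by simp
    finally have "?c i = 0" using ind[of ?c] ij(1) by blast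
    then show False by simp
  qed
  show "cfun.independent (f ` I)"
  proof (rule cfun.independent_if_scalars_zero)
    fix c x assume "(\<Sum>x\<in>f ` I. cfun_scale (c x) x) = 0" "x \<in> f ` I"
    then show "c x = 0"
      using ind[of "c \<circ> f"] inj by (auto simp: sum.reindex)
  qed (use assms in auto)
qed

lemma cfun_subspace_eq:
  assumes U: "cfun.subspace U" "U \<subseteq> V" and V: "V \<subseteq> cfun.span A" "finite A"
    and dim: "cfun.dim V \<le> cfun.dim U"
  shows "U = V"
proof (rule ccontr)
  assume "U \<noteq> V"
  then obtain x where x: "x \<in> V" "x \<notin> U" using U by blast
  obtain B where B: "B \<subseteq> U" "cfun.independent B" "U \<subseteq> cfun.span B" "card B = cfun.dim U"
    using cfun.basis_exists by blast
  have "cfun.span B = U"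
    using B U by (metis cfun.span_minimal subset_antisym)
  then have ind: "cfun.independent (insert x B)"
    using x B by (simp add: cfun.independent_insertI)
  obtain B' where B': "B' \<subseteq> V" "cfun.independent B'" "V \<subseteq> cfun.span B'" "card B' = cfun.dim V"
    using cfun.basis_exists by blast
  have "finite B'" using cfun.independent_span_bound[OF V(2) B'(2)] B'(1) V(1) by blast
  moreover have "insert x B \<subseteq> cfun.span B'" using x B B' U by blast
  ultimately have "finite (insert x B)" "card (insert x B) \<le> card B'"
    using cfun.independent_span_bound[OF _ ind] by simp_all
  moreover have "x \<notin> B" using x B by blast
  ultimately show False using B B' dim by simp
qed

text \<open>A basis of the kernel is extended to one of \<open>V\<close>, and the added vectors have
  independent images. The space of all functions may be infinite-dimensional, so finiteness is
  supplied by a spanning set \<open>A\<close>.\<close>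

lemma cfun_rank_nullity:
  assumes L: "cfun_linear L" and V: "cfun.subspace V" "V \<subseteq> cfun.span A" "finite A"
  shows "cfun.dim V = cfun.dim (L ` V) + cfun.dim {v \<in> V. L v = 0}"
proof -
  interpret L: Vector_Spaces.linear cfun_scale cfun_scale L by (rule L)
  let ?K = "{v \<in> V. L v = 0}"
  obtain B0 where B0: "B0 \<subseteq> ?K" "cfun.independent B0" "?K \<subseteq> cfun.span B0" "card B0 = cfun.dim ?K"
    using cfun.basis_exists by blast
  obtain B where B: "B0 \<subseteq> B" "B \<subseteq> V" "cfun.independent B" "V \<subseteq> cfun.span B"
    using cfun.maximal_independent_subset_extend[of B0 V] B0 by blast
  have finB: "finite B" using cfun.independent_span_bound[OF V(3) B(3)] B(2) V(2) by blast
  have fin: "finite (B - B0)" "finite B0" using finB B(1) finite_subset by auto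
  have span: "cfun.span B = V" using B V by (metis cfun.span_minimal subset_antisym)
  let ?s = "\<lambda>c. \<Sum>b\<in>B - B0. cfun_scale (c b) b"
  have Ls: "L (?s c) = (\<Sum>b\<in>B - B0. cfun_scale (c b) (L b))" for c
    by (simp add: L.sum L.scale)
  have ker: "\<forall>b\<in>B - B0. c b = 0" if "(\<Sum>b\<in>B - B0. cfun_scale (c b) (L b)) = 0" for c
  proof -
    have "?s c \<in> V" unfolding span[symmetric]
      by (intro cfun.span_sum cfun.span_scale cfun.span_base) blast
    with that have "?s c \<in> cfun.span B0" using B0(3) Ls by auto
    then obtain e where e: "?s c = (\<Sum>b\<in>B0. cfun_scale (e b) b)"
      using cfun.span_finite[OF fin(2)] by auto
    let ?d = "\<lambda>b. if b \<in> B0 then - e b else c b"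
    have "(\<Sum>b\<in>B. cfun_scale (?d b) b)
        = (\<Sum>b\<in>B - B0. cfun_scale (?d b) b) + (\<Sum>b\<in>B0. cfun_scale (?d b) b)"
      using finB B(1) by (rule sum.subset_diff[rotated])
    also have "(\<Sum>b\<in>B0. cfun_scale (?d b) b) = - (\<Sum>b\<in>B0. cfun_scale (e b) b)"
      by (simp add: sum_negf)
    also have "(\<Sum>b\<in>B - B0. cfun_scale (?d b) b) = ?s c" by (intro sum.cong) auto
    finally have "(\<Sum>b\<in>B. cfun_scale (?d b) b) = 0" unfolding e by (simp only: right_minus)
    then have "\<forall>b\<in>B. ?d b = 0" using cfun.independentD[OF B(3) finB order.refl, of ?d] by blast
    then show ?thesis by (metis DiffD1 DiffD2)
  qed
  have "L ` V = cfun.span (L ` (B - B0))"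
  proof
    show "cfun.span (L ` (B - B0)) \<subseteq> L ` V"
      using B(2) L.subspace_image[OF V(1)] by (intro cfun.span_minimal) auto
    have "L ` B \<subseteq> insert 0 (L ` (B - B0))"
      using B0(1) by auto
    from cfun.span_mono[OF this] have "L ` cfun.span B \<subseteq> cfun.span (L ` (B - B0))"
      by (simp add: L.span_image)
    then show "L ` V \<subseteq> cfun.span (L ` (B - B0))" unfolding span .
  qed
  then have "cfun.dim (L ` V) = card (L ` (B - B0))"
    using cfun_independent_family(2)[OF fin(1), of L, OF ker] by (simp add: cfun.dim_eq_card_independent)
  also have "\<dots> = card (B - B0)"
    using cfun_independent_family(1)[OF fin(1), of L, OF ker] by (rule card_image)
  finally have "cfun.dim (L ` V) = card B - card B0"
    using B(1) fin by (simp add: card_Diff_subset)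
  moreover have "card B0 \<le> card B" using B(1) finB card_mono by blast
  moreover have "cfun.dim V = card B"
    using span B(3) by (metis cfun.dim_span_eq_card_independent)
  ultimately show ?thesis using B0(4) by simp
qed

lemma cfun_dim_zero: "cfun.dim {0} = 0"
  by (rule cfun.dim_unique[of "{}"]) (auto simp: cfun.span_empty cfun.independent_empty)

text \<open>An injective endomorphism of the functions supported on \<open>B\<close> is onto by
  rank-nullity, which gives a right inverse \<open>n\<close>. It is also a left inverse because
  \<open>m\<close> kills the columns of \<open>n m - 1\<close>.\<close>

lemma matrix_inverse_finite:
  fixes m :: "'b \<Rightarrow> 'b \<Rightarrow> complex"
  assumes fin: "finite B"
    and inj: "\<And>c. (\<And>b. b \<in> B \<Longrightarrow> (\<Sum>b'\<in>B. m b b' * c b') = 0) \<Longrightarrow> \<forall>b\<in>B. c b = 0"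
  obtains n where
    "\<And>b b''. b \<in> B \<Longrightarrow> b'' \<in> B \<Longrightarrow> (\<Sum>b'\<in>B. m b b' * n b' b'') = (if b = b'' then 1 else 0)"
    "\<And>b b''. b \<in> B \<Longrightarrow> b'' \<in> B \<Longrightarrow> (\<Sum>b'\<in>B. n b b' * m b' b'') = (if b = b'' then 1 else 0)"
proof -
  define V :: "('b \<Rightarrow> complex) set" where "V = {x. \<forall>b. b \<notin> B \<longrightarrow> x b = 0}"
  define L where "L x = (\<lambda>b. if b \<in> B then \<Sum>b'\<in>B. m b b' * x b' else 0)" for x :: "'b \<Rightarrow> complex"
  define e :: "'b \<Rightarrow> 'b \<Rightarrow> complex" where "e b = (\<lambda>b'. if b = b' then 1 else 0)" for b
  have L: "cfun_linear L"
    by (rule cfun_linearI)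
       (auto simp: L_def fun_eq_iff cfun_scale_def distrib_left sum.distrib sum_distrib_left mult.left_commute)
  have V: "cfun.subspace V"
    by (auto simp: V_def cfun.subspace_def cfun_scale_def)
  have "x \<in> cfun.span (e ` B)" if "x \<in> V" for x
  proof -
    have "x = (\<Sum>b\<in>B. cfun_scale (x b) (e b))"
    proof
      fix b
      have "(\<Sum>b'\<in>B. cfun_scale (x b') (e b')) b = (\<Sum>b'\<in>B. if b' = b then x b' else 0)"
        unfolding sum_fun_apply by (intro sum.cong) (auto simp: cfun_scale_def e_def)
      then show "x b = (\<Sum>b'\<in>B. cfun_scale (x b') (e b')) b"
        using that fin by (auto simp: V_def)
    qed
    moreover have "\<dots> \<in> cfun.span (e ` B)"
      by (intro cfun.span_sum cfun.span_scale cfun.span_base) blast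
    ultimately show ?thesis by simp
  qed
  then have span: "V \<subseteq> cfun.span (e ` B)" by blast
  have ker: "{x \<in> V. L x = 0} = {0}"
  proof (intro equalityI subsetI)
    fix x assume x: "x \<in> {x \<in> V. L x = 0}"
    then have "L x b = 0" for b by simp
    then have "(\<Sum>b'\<in>B. m b b' * x b') = 0" if "b \<in> B" for b
      using that unfolding L_def by meson
    from inj[OF this] x show "x \<in> {0}" by (auto simp: V_def fun_eq_iff)
  qed (auto simp: V_def L_def fun_eq_iff)
  have "L ` V = V"
  proof (rule cfun_subspace_eq[OF _ _ span])
    interpret L: Vector_Spaces.linear cfun_scale cfun_scale L by (rule L)
    show "cfun.subspace (L ` V)" by (rule L.subspace_image[OF V])
    show "L ` V \<subseteq> V" by (auto simp: L_def V_def)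
    show "cfun.dim V \<le> cfun.dim (L ` V)"
      using cfun_rank_nullity[OF L V span] fin by (simp add: ker cfun_dim_zero)
  qed (use fin in simp)
  moreover have "e b \<in> V" if "b \<in> B" for b using that by (auto simp: e_def V_def)
  ultimately have "\<forall>b\<in>B. \<exists>x. L x = e b" by (metis imageE)
  then obtain n' where n': "\<And>b. b \<in> B \<Longrightarrow> L (n' b) = e b" by metis
  define n where "n b b' = n' b' b" for b b'
  have mn: "(\<Sum>b'\<in>B. m b b' * n b' b'') = (if b = b'' then 1 else 0)" if "b \<in> B" "b'' \<in> B" for b b''
    using fun_cong[OF n'[OF that(2)], of b] that by (auto simp: L_def e_def n_def)
  have nm: "(\<Sum>b'\<in>B. n b b' * m b' b'') = (if b = b'' then 1 else 0)" if b: "b \<in> B" "b'' \<in> B" for b b''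
  proof -
    let ?c = "\<lambda>b. (\<Sum>b'\<in>B. n b b' * m b' b'') - (if b = b'' then 1 else 0)"
    have "\<forall>b\<in>B. ?c b = 0"
    proof (rule inj)
      fix b assume b': "b \<in> B"
      have "(\<Sum>x\<in>B. m b x * (\<Sum>b'\<in>B. n x b' * m b' b''))
          = (\<Sum>b'\<in>B. (\<Sum>x\<in>B. m b x * n x b') * m b' b'')"
        unfolding sum_distrib_left sum_distrib_right by (subst sum.swap) (simp add: mult.assoc)
      also have "\<dots> = (\<Sum>b'\<in>B. if b = b' then m b' b'' else 0)"
        using b' by (intro sum.cong) (auto simp: mn)
      also have "\<dots> = m b b''" using b' fin by simp
      finally have 1: "(\<Sum>x\<in>B. m b x * (\<Sum>b'\<in>B. n x b' * m b' b'')) = m b b''" .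
      have "(\<Sum>x\<in>B. m b x * (if x = b'' then 1 else 0)) = (\<Sum>x\<in>B. if x = b'' then m b x else 0)"
        by (intro sum.cong) auto
      also have "\<dots> = m b b''" using b fin by simp
      finally show "(\<Sum>x\<in>B. m b x * ?c x) = 0"
        by (simp add: right_diff_distrib sum_subtractf 1)
    qed
    with b show ?thesis by simp
  qed
  show thesis by (rule that[OF mn nm])
qed

definition inverse_on :: "'b set \<Rightarrow> ('b \<Rightarrow> 'b \<Rightarrow> complex) \<Rightarrow> ('b \<Rightarrow> 'b \<Rightarrow> complex) \<Rightarrow> bool" where
  "inverse_on B m n \<longleftrightarrow>
     (\<forall>b\<in>B. \<forall>b''\<in>B. (\<Sum>b'\<in>B. m b b' * n b' b'') = (if b = b'' then 1 else 0)) \<and>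
     (\<forall>b\<in>B. \<forall>b''\<in>B. (\<Sum>b'\<in>B. n b b' * m b' b'') = (if b = b'' then 1 else 0))"

text \<open>Let \<eta> be the total deviation of \<open>m\<close> from the identity. The error
  \<open>S\<close> of a column of the inverse satisfies \<open>S \<le> \<eta> * S + \<eta>\<close>,
  hence \<open>S \<le> 2 * \<eta>\<close> once \<eta> is below 1/2. The general filter admits
  \<open>nhds 0\<close>, which includes the point 0 itself.\<close>

lemma inverse_near_identity:
  fixes m :: "'t \<Rightarrow> 'b \<Rightarrow> 'b \<Rightarrow> complex"
  assumes fin: "finite B"
    and lim: "\<And>b b'. b \<in> B \<Longrightarrow> b' \<in> B \<Longrightarrow> ((\<lambda>t. m t b b') \<longlongrightarrow> (if b = b' then 1 else 0)) \<F>"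
  obtains n where
    "\<And>b b'. b \<in> B \<Longrightarrow> b' \<in> B \<Longrightarrow> ((\<lambda>t. n t b b') \<longlongrightarrow> (if b = b' then 1 else 0)) \<F>"
    "\<forall>\<^sub>F t in \<F>. inverse_on B (m t) (n t)"
proof -
  define \<delta> :: "'b \<Rightarrow> 'b \<Rightarrow> complex" where "\<delta> b b' = (if b = b' then 1 else 0)" for b b'
  define \<eta> where "\<eta> t = (\<Sum>b\<in>B. \<Sum>b'\<in>B. norm (\<delta> b b' - m t b b'))" for t
  have "((\<lambda>t. norm (\<delta> b b' - m t b b')) \<longlongrightarrow> norm (\<delta> b b' - \<delta> b b')) \<F>" if "b \<in> B" "b' \<in> B" for b b'
    using lim[OF that] by (intro tendsto_intros) (simp add: \<delta>_def)
  then have "(\<eta> \<longlongrightarrow> (\<Sum>b\<in>B. \<Sum>b'\<in>B. norm (\<delta> b b' - \<delta> b b'))) \<F>"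
    unfolding \<eta>_def by (intro tendsto_sum)
  then have \<eta>0: "(\<eta> \<longlongrightarrow> 0) \<F>" by simp
  have bound: "(\<Sum>b\<in>B. norm (c b - (\<Sum>b'\<in>B. m t b b' * c b'))) \<le> \<eta> t * (\<Sum>b\<in>B. norm (c b))" for t c
  proof -
    have "norm (c b - (\<Sum>b'\<in>B. m t b b' * c b')) \<le> (\<Sum>b'\<in>B. norm (\<delta> b b' - m t b b')) * (\<Sum>b\<in>B. norm (c b))"
      if b: "b \<in> B" for b
    proof -
      have "(\<Sum>b'\<in>B. \<delta> b b' * c b') = (\<Sum>b'\<in>B. if b = b' then c b' else 0)"
        by (intro sum.cong) (auto simp: \<delta>_def)
      then have "c b = (\<Sum>b'\<in>B. \<delta> b b' * c b')" using b fin by simp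
      then have "c b - (\<Sum>b'\<in>B. m t b b' * c b') = (\<Sum>b'\<in>B. (\<delta> b b' - m t b b') * c b')"
        by (simp add: left_diff_distrib sum_subtractf)
      also have "norm \<dots> \<le> (\<Sum>b'\<in>B. norm (\<delta> b b' - m t b b') * norm (c b'))"
        by (rule sum_norm_le) (simp add: norm_mult)
      also have "\<dots> \<le> (\<Sum>b'\<in>B. norm (\<delta> b b' - m t b b') * (\<Sum>b\<in>B. norm (c b)))"
        using fin by (intro sum_mono mult_left_mono member_le_sum) auto
      finally show ?thesis by (simp add: sum_distrib_right)
    qed
    then show ?thesis unfolding \<eta>_def by (subst sum_distrib_right) (rule sum_mono)
  qed
  \<comment> \<open>A kernel vector would have norm at most half of itself, so the matrix is
    injective.\<close>
  have ex: "\<exists>n. inverse_on B (m t) n" if \<eta>: "\<eta> t < 1/2" for t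
  proof -
    have inj: "\<forall>b\<in>B. c b = 0" if c: "\<And>b. b \<in> B \<Longrightarrow> (\<Sum>b'\<in>B. m t b b' * c b') = 0" for c
    proof -
      have "(\<Sum>b\<in>B. norm (c b)) \<le> \<eta> t * (\<Sum>b\<in>B. norm (c b))"
        using bound[of c t] by (simp add: c)
      also have "\<dots> \<le> 1/2 * (\<Sum>b\<in>B. norm (c b))"
        using \<eta> by (intro mult_right_mono sum_nonneg) auto
      finally have "(\<Sum>b\<in>B. norm (c b)) \<le> 0" by simp
      moreover have "norm (c b) \<le> (\<Sum>b\<in>B. norm (c b))" if "b \<in> B" for b
        using that fin by (intro member_le_sum) auto
      ultimately show ?thesis by (metis norm_le_zero_iff order_trans)
    qed
    obtain n where
      "\<And>b b''. b \<in> B \<Longrightarrow> b'' \<in> B \<Longrightarrow> (\<Sum>b'\<in>B. m t b b' * n b' b'') = (if b = b'' then 1 else 0)"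
      "\<And>b b''. b \<in> B \<Longrightarrow> b'' \<in> B \<Longrightarrow> (\<Sum>b'\<in>B. n b b' * m t b' b'') = (if b = b'' then 1 else 0)"
      using matrix_inverse_finite[of B "m t", OF fin inj] by blast
    then show ?thesis by (intro exI[of _ n]) (simp add: inverse_on_def)
  qed
  \<comment> \<open>Where \<eta> is not small, \<open>n t\<close> is an arbitrary value about which
    nothing is claimed.\<close>
  define n where "n t = (SOME n. inverse_on B (m t) n)" for t
  have n: "inverse_on B (m t) (n t)" if "\<eta> t < 1/2" for t
    using someI_ex[OF ex[OF that]] unfolding n_def .
  have small: "\<forall>\<^sub>F t in \<F>. \<eta> t < 1/2" using order_tendstoD(2)[OF \<eta>0, of "1/2"] by simp
  have est: "norm (n t b b'' - \<delta> b b'') \<le> 2 * \<eta> t" if t: "\<eta> t < 1/2" and b: "b \<in> B" "b'' \<in> B" for t b b''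
  proof -
    define S where "S = (\<Sum>b\<in>B. norm (n t b b'' - \<delta> b b''))"
    have S0: "0 \<le> S" unfolding S_def by (rule sum_nonneg) simp
    have "(\<Sum>b\<in>B. norm (\<delta> b b'')) = (\<Sum>b\<in>B. if b = b'' then 1 else 0)"
      by (intro sum.cong) (auto simp: \<delta>_def)
    then have d1: "(\<Sum>b\<in>B. norm (\<delta> b b'')) = 1" using b fin by simp
    have "S = (\<Sum>b\<in>B. norm (n t b b'' - (\<Sum>b'\<in>B. m t b b' * n t b' b'')))"
      unfolding S_def using n[OF t, unfolded inverse_on_def] b by (intro sum.cong) (auto simp: \<delta>_def)
    also have "\<dots> \<le> \<eta> t * (\<Sum>b\<in>B. norm (n t b b''))" by (rule bound)
    also have "(\<Sum>b\<in>B. norm (n t b b'')) \<le> (\<Sum>b\<in>B. norm (n t b b'' - \<delta> b b'') + norm (\<delta> b b''))"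
      by (intro sum_mono) (metis diff_add_cancel norm_triangle_ineq)
    then have "\<eta> t * (\<Sum>b\<in>B. norm (n t b b'')) \<le> \<eta> t * (S + 1)"
      by (intro mult_left_mono) (auto simp: S_def sum.distrib d1 \<eta>_def sum_nonneg)
    finally have "S \<le> \<eta> t * S + \<eta> t" by (simp add: distrib_left)
    moreover have "\<eta> t * S \<le> 1/2 * S" using t S0 by (intro mult_right_mono) auto
    ultimately have "S \<le> 2 * \<eta> t" by simp
    moreover have "norm (n t b b'' - \<delta> b b'') \<le> S"
      unfolding S_def using fin b by (intro member_le_sum) auto
    ultimately show ?thesis by simp
  qed
  have "((\<lambda>t. n t b b') \<longlongrightarrow> (if b = b' then 1 else 0)) \<F>" if b: "b \<in> B" "b' \<in> B" for b b'
  proof -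
    have "((\<lambda>t. n t b b' - \<delta> b b') \<longlongrightarrow> 0) \<F>"
    proof (rule Lim_null_comparison)
      show "\<forall>\<^sub>F t in \<F>. norm (n t b b' - \<delta> b b') \<le> 2 * \<eta> t"
        using small by eventually_elim (rule est[OF _ b])
      show "((\<lambda>t. 2 * \<eta> t) \<longlongrightarrow> 0) \<F>" using tendsto_mult_left[OF \<eta>0, of 2] by simp
    qed
    then show ?thesis by (simp add: LIM_zero_iff \<delta>_def)
  qed
  moreover have "\<forall>\<^sub>F t in \<F>. inverse_on B (m t) (n t)" using small by eventually_elim (rule n)
  ultimately show thesis by (rule that)
qed

subsection \<open>Dimensions of spaces of forms\<close>

lemma choose_two_real: "2 * real (m + 2 choose 2) = (real m + 2) * (real m + 1)"
proof -
  have "2 * (m + 2 choose 2) = (m + 2) * (m + 1)"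
  proof (induction m)
    case (Suc m)
    have "Suc m + 2 choose 2 = (m + 2 choose 2) + (m + 2)" by (simp add: numeral_2_eq_2)
    with Suc show ?case by simp
  qed (simp add: numeral_2_eq_2)
  then have "real (2 * (m + 2 choose 2)) = real ((m + 2) * (m + 1))" by (simp only:)
  then show ?thesis by (simp add: algebra_simps)
qed

lemma forms_finite_span: "\<exists>A. finite A \<and> forms m = cfun.span A"
proof -
  have "{a :: 'a \<Rightarrow> nat. sum a UNIV = m} \<subseteq> (UNIV \<rightarrow>\<^sub>E {..m})"
    using member_le_sum[of _ "UNIV :: 'a set"] by (auto simp: PiE_def)
  then have "finite {a :: 'a \<Rightarrow> nat. sum a UNIV = m}"
    by (rule finite_subset) (auto intro: finite_PiE)
  then have "finite {(\<lambda>x :: complex^'a. \<Prod>i\<in>UNIV. (x $ i) ^ a i) | a. sum a UNIV = m}"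
    by simp
  then show ?thesis unfolding forms_def by blast
qed

lemma card_pairs_le: "card {(j, k). j + k \<le> m} = (m + 2 choose 2)"
proof -
  have "{(j, k). j + k \<le> m} = Sigma {..m} (\<lambda>j. {..m - j})" by auto
  then have "card {(j, k). j + k \<le> m} = (\<Sum>j\<le>m. Suc (m - j))" by simp
  also have "\<dots> = (m + 2 choose 2)"
  proof (induction m)
    case (Suc m)
    then show ?case
      by (subst sum.atMost_Suc_shift) (simp add: numeral_2_eq_2)
  qed (simp add: numeral_2_eq_2)
  finally show ?thesis .
qed

lemma prod_3: "prod f (UNIV :: 3 set) = f 1 * f 2 * f 3"
  for f :: "3 \<Rightarrow> 'a :: comm_monoid_mult"
  unfolding UNIV_3 by (simp add: mult.assoc)

lemma dim_ternary_forms: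
  "cfun.dim (forms m :: (complex^3 \<Rightarrow> complex) set) = (m + 2 choose 2)"
proof -
  define I where "I = {(j, k). j + k \<le> m}"
  define M :: "nat \<times> nat \<Rightarrow> complex^3 \<Rightarrow> complex"
    where "M = (\<lambda>(j, k) v. (v $ 1) ^ (m - j - k) * (v $ 2) ^ j * (v $ 3) ^ k)"
  have fin: "finite I"
    by (rule finite_subset[of _ "{..m} \<times> {..m}"]) (auto simp: I_def)
  have sub: "{(\<lambda>x :: complex^3. \<Prod>i\<in>UNIV. (x $ i) ^ a i) | a. sum a UNIV = m} = M ` I"
  proof (intro equalityI subsetI)
    fix F assume "F \<in> {(\<lambda>x :: complex^3. \<Prod>i\<in>UNIV. (x $ i) ^ a i) | a. sum a UNIV = m}"
    then obtain a :: "3 \<Rightarrow> nat" where a: "sum a UNIV = m" "F = (\<lambda>x. \<Prod>i\<in>UNIV. (x $ i) ^ a i)" by blast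
    from a(1) have m: "m = a 1 + a 2 + a 3" by (simp add: sum_3)
    have "F = M (a 2, a 3)" unfolding a(2) M_def m by (simp add: prod_3)
    moreover have "(a 2, a 3) \<in> I" by (simp add: I_def m)
    ultimately show "F \<in> M ` I" by blast
  next
    fix F assume "F \<in> M ` I"
    then obtain j k where jk: "F = M (j, k)" "j + k \<le> m" by (auto simp: I_def)
    define a :: "3 \<Rightarrow> nat" where "a i = (if i = 1 then m - j - k else if i = 2 then j else k)" for i
    have "sum a UNIV = m" "F = (\<lambda>x. \<Prod>i\<in>UNIV. (x $ i) ^ a i)"
      using jk(2) by (simp_all add: sum_3 prod_3 jk(1) M_def a_def)
    then show "F \<in> {(\<lambda>x :: complex^3. \<Prod>i\<in>UNIV. (x $ i) ^ a i) | a. sum a UNIV = m}" by blast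
  qed
  have ind: "\<forall>i\<in>I. c i = 0" if c: "(\<Sum>i\<in>I. cfun_scale (c i) (M i)) = 0" for c
  proof
    \<comment> \<open>Kronecker substitution: the monomials become distinct powers of \<open>t\<close>.\<close>
    define N where "N = (\<lambda>(j, k). Suc m * j + k)"
    define p where "p = (\<Sum>i\<in>I. monom (c i) (N i))"
    have "poly p t = 0" for t
    proof -
      have "0 = (\<Sum>i\<in>I. cfun_scale (c i) (M i)) (vector [1, t ^ Suc m, t])" by (simp add: c)
      also have "\<dots> = (\<Sum>i\<in>I. poly (monom (c i) (N i)) t)"
        unfolding sum_fun_apply
        by (intro sum.cong) (auto simp: cfun_scale_def M_def N_def poly_monom power_add power_mult
              simp del: power_Suc mult_Suc)
      finally show ?thesis by (simp add: p_def poly_sum)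
    qed
    then have p0: "p = 0" using poly_all_0_iff_0 by blast
    have injN: "inj_on N I"
    proof (rule inj_onI)
      fix a b assume ab: "a \<in> I" "b \<in> I" "N a = N b"
      obtain j k j' k' where eq: "a = (j, k)" "b = (j', k')" by fastforce
      have *: "(Suc m * x + y) div Suc m = x" "(Suc m * x + y) mod Suc m = y" if "y \<le> m" for x y
        using that by (simp_all only: div_mult_self4[OF nat.distinct(2)] mod_mult_self4 div_less mod_less less_Suc_eq_le add_0_right)
      have "k \<le> m" "k' \<le> m" using ab eq by (auto simp: I_def)
      then show "a = b" using *[of k j] *[of k' j'] ab(3) eq by (simp add: N_def)
    qed
    fix i assume i: "i \<in> I"
    have "0 = coeff p (N i)" by (simp add: p0)
    also have "\<dots> = (\<Sum>i'\<in>I. if i' = i then c i' else 0)"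
      unfolding p_def coeff_sum using injN i by (intro sum.cong) (auto simp: inj_on_def)
    finally show "c i = 0" using i fin by simp
  qed
  show ?thesis
    unfolding forms_def sub
    using cfun_independent_family[of I M, OF fin ind] card_pairs_le[of m]
    by (simp add: cfun.dim_eq_card_independent card_image flip: I_def)
qed

subsection \<open>Binary forms\<close>

text \<open>Forms in the first two variables, kept as functions on three-space so that they multiply
  ternary forms without conversion.\<close>

definition bforms :: "nat \<Rightarrow> (complex^3 \<Rightarrow> complex) set" where
  "bforms m = {F \<in> forms m. \<forall>v w. v $ 1 = w $ 1 \<longrightarrow> v $ 2 = w $ 2 \<longrightarrow> F v = F w}"

lemma bforms_forms: "F \<in> bforms m \<Longrightarrow> F \<in> forms m"
  by (simp add: bforms_def)

lemma bforms_eq: "F \<in> bforms m \<Longrightarrow> v $ 1 = w $ 1 \<Longrightarrow> v $ 2 = w $ 2 \<Longrightarrow> F v = F w"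
  unfolding bforms_def by blast

lemma bformsI:
  assumes "F \<in> forms m" "\<And>v w. v $ 1 = w $ 1 \<Longrightarrow> v $ 2 = w $ 2 \<Longrightarrow> F v = F w"
  shows "F \<in> bforms m"
  unfolding bforms_def using assms by blast

lemma bforms_const: "(\<lambda>_. c) \<in> bforms 0"
  by (rule bformsI) auto

lemma bforms_coord: "i \<in> {1, 2} \<Longrightarrow> (\<lambda>v. v $ i) \<in> bforms (Suc 0)"
  by (rule bformsI) auto

lemma bforms_scale: "F \<in> bforms m \<Longrightarrow> (\<lambda>v. c * F v) \<in> bforms m"
  by (rule bformsI, simp add: forms_scale bforms_forms, metis bforms_eq)

lemma bforms_diff: "F \<in> bforms m \<Longrightarrow> G \<in> bforms m \<Longrightarrow> (\<lambda>v. F v - G v) \<in> bforms m"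
  by (rule bformsI, simp add: forms_diff bforms_forms, metis bforms_eq)

lemma bforms_mult: "F \<in> bforms a \<Longrightarrow> G \<in> bforms b \<Longrightarrow> (\<lambda>v. F v * G v) \<in> bforms (a + b)"
  by (rule bformsI, simp add: forms_mult bforms_forms, metis bforms_eq)

lemma bforms_coord_power: "(\<lambda>v. (v $ 1) ^ e) \<in> bforms e"
  using forms_power[OF forms_coord[of 1], of e] by (intro bformsI) auto

text \<open>The homogenisation of \<open>p\<close> to degree \<open>m\<close>, with the first
  coordinate as homogenising variable. Coefficients beyond \<open>m\<close> are cut off, hence the
  degree bounds in the lemmas.\<close>

definition bform_of_poly :: "nat \<Rightarrow> complex poly \<Rightarrow> complex^3 \<Rightarrow> complex" where
  "bform_of_poly m p v = (\<Sum>j\<le>m. coeff p j * ((v $ 1) ^ (m - j) * (v $ 2) ^ j))"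

lemma bform_of_poly_bforms: "bform_of_poly m p \<in> bforms m"
proof -
  have "(\<lambda>v::complex^3. (v $ 1) ^ (m - j) * (v $ 2) ^ j) \<in> forms m" if "j \<le> m" for j
  proof -
    have "(\<lambda>v::complex^3. (v $ 1) ^ (m - j) * (v $ 2) ^ j) \<in> forms ((m - j) * Suc 0 + j * Suc 0)"
      by (intro forms_mult forms_power forms_coord)
    with that show ?thesis by simp
  qed
  then have "bform_of_poly m p \<in> forms m"
    unfolding bform_of_poly_def[abs_def] by (intro forms_sum forms_scale) simp
  then show ?thesis by (rule bformsI) (simp add: bform_of_poly_def)
qed

lemma bform_of_poly_pCons:
  "bform_of_poly (Suc m) (pCons 0 p) v = v $ 2 * bform_of_poly m p v"
  unfolding bform_of_poly_def
  by (subst sum.atMost_Suc_shift) (simp add: sum_distrib_left mult_ac)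

lemma bform_of_poly_Suc:
  assumes "degree p \<le> m"
  shows "bform_of_poly (Suc m) p v = v $ 1 * bform_of_poly m p v"
proof -
  have "coeff p (Suc m) = 0" using assms by (intro coeff_eq_0) simp
  moreover have "(\<Sum>j\<le>m. coeff p j * ((v $ 1) ^ (Suc m - j) * (v $ 2) ^ j))
      = v $ 1 * (\<Sum>j\<le>m. coeff p j * ((v $ 1) ^ (m - j) * (v $ 2) ^ j))"
    unfolding sum_distrib_left by (intro sum.cong) (auto simp: Suc_diff_le)
  ultimately show ?thesis unfolding bform_of_poly_def by simp
qed

lemma bform_of_poly_add: "bform_of_poly m (p + q) v = bform_of_poly m p v + bform_of_poly m q v"
  unfolding bform_of_poly_def by (simp add: distrib_right sum.distrib)

lemma bform_of_poly_smult: "bform_of_poly m (smult c p) v = c * bform_of_poly m p v"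
  unfolding bform_of_poly_def by (simp add: sum_distrib_left mult.assoc)

lemma forms_bform_of_poly:
  "F \<in> forms m \<Longrightarrow> \<exists>p. degree p \<le> m \<and> (\<forall>v. v $ 3 = 0 \<longrightarrow> F v = bform_of_poly m p v)"
proof (induction rule: forms_induct)
  case (const c)
  show ?case by (rule exI[of _ "[:c:]"]) (simp add: bform_of_poly_def)
next
  case (mult_coord m F i)
  then obtain p where p: "degree p \<le> m" "\<forall>v. v $ 3 = 0 \<longrightarrow> F v = bform_of_poly m p v" by blast
  consider "i = 1" | "i = 2" | "i = 3" using exhaust_3 by blast
  then show ?case
  proof cases
    case 1
    then show ?thesis using p by (intro exI[of _ p]) (simp add: bform_of_poly_Suc)
  next
    case 2
    have "degree (pCons 0 p) \<le> Suc m" using p(1) degree_pCons_le[of 0 p] by linarith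
    then show ?thesis using 2 p(2) by (intro exI[of _ "pCons 0 p"]) (simp add: bform_of_poly_pCons)
  next
    case 3
    then show ?thesis by (intro exI[of _ 0]) (simp add: bform_of_poly_def)
  qed
next
  case (add m F G)
  then obtain p q where "degree p \<le> m" "\<forall>v. v $ 3 = 0 \<longrightarrow> F v = bform_of_poly m p v"
    "degree q \<le> m" "\<forall>v. v $ 3 = 0 \<longrightarrow> G v = bform_of_poly m q v" by metis
  then show ?case by (intro exI[of _ "p + q"]) (simp add: bform_of_poly_add degree_add_le)
next
  case (scale m F c)
  then obtain p where "degree p \<le> m" "\<forall>v. v $ 3 = 0 \<longrightarrow> F v = bform_of_poly m p v" by metis
  then show ?case
    by (intro exI[of _ "smult c p"]) (simp add: bform_of_poly_smult order.trans[OF degree_smult_le])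
qed

text \<open>A linear factor is a zero on the projective line. A root \<open>a\<close> of the
  dehomogenised polynomial gives \<open>v $ 2 - a * v $ 1\<close>; if the degree drops, the zero is
  at infinity and the factor is \<open>v $ 1\<close>.\<close>

lemma bforms_factor:
  assumes "F \<in> bforms (Suc m)"
  obtains l G where "l \<in> bforms 1" "G \<in> bforms m" "\<And>v. F v = l v * G v"
proof -
  obtain p where p: "degree p \<le> Suc m" "\<And>v. v $ 3 = 0 \<Longrightarrow> F v = bform_of_poly (Suc m) p v"
    using forms_bform_of_poly[OF bforms_forms[OF assms]] by blast
  have Fp: "F v = bform_of_poly (Suc m) p v" for v
  proof -
    let ?w = "vector [v $ 1, v $ 2, 0] :: complex^3"
    have "F v = F ?w" by (rule bforms_eq[OF assms]) auto
    also have "\<dots> = bform_of_poly (Suc m) p ?w" by (rule p) simp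
    also have "\<dots> = bform_of_poly (Suc m) p v" by (simp add: bform_of_poly_def)
    finally show ?thesis .
  qed
  show thesis
  proof (cases "degree p \<le> m")
    case True
    show thesis
      by (rule that[of "\<lambda>v. v $ 1" "bform_of_poly m p"])
         (simp_all add: bforms_coord bform_of_poly_bforms Fp bform_of_poly_Suc[OF True])
  next
    case False
    then have "degree p = Suc m" using p(1) by simp
    then obtain a where "poly p a = 0"
      using fundamental_theorem_of_algebra[of p] constant_degree[of p] by auto
    then obtain q where q: "p = [:- a, 1:] * q" by (auto simp: poly_eq_0_iff_dvd dvd_def)
    then have "q \<noteq> 0" using \<open>degree p = Suc m\<close> by auto
    then have "degree p = Suc (degree q)" unfolding q by (subst degree_mult_eq) auto
    then have dq: "degree q \<le> m" using \<open>degree p = Suc m\<close> by simp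
    have pq: "p = pCons 0 q + smult (- a) q" by (simp add: q)
    have "(\<lambda>v::complex^3. v $ 2 - a * v $ 1) \<in> bforms (Suc 0)"
      by (intro bforms_diff bforms_scale bforms_coord) auto
    moreover have "F v = (v $ 2 - a * v $ 1) * bform_of_poly m q v" for v
      unfolding Fp pq bform_of_poly_add bform_of_poly_smult
      by (simp add: bform_of_poly_pCons bform_of_poly_Suc[OF dq] algebra_simps)
    ultimately show thesis
      using that[of "\<lambda>v. v $ 2 - a * v $ 1" "bform_of_poly m q"] bform_of_poly_bforms by simp
  qed
qed

subsection \<open>Ternary forms as polynomials in the last variable\<close>

text \<open>\<open>k\<close> counts coefficients, so the degree in the third variable is below
  \<open>k\<close>; the top coefficient may vanish. The bound \<open>k \<le> Suc m\<close> keeps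
  \<open>m - j\<close> from truncating.\<close>

definition zexpansion :: "nat \<Rightarrow> nat \<Rightarrow> (nat \<Rightarrow> complex^3 \<Rightarrow> complex) \<Rightarrow> (complex^3 \<Rightarrow> complex) \<Rightarrow> bool" where
  "zexpansion k m a F \<longleftrightarrow> k \<le> Suc m \<and> (\<forall>j<k. a j \<in> bforms (m - j)) \<and>
     (\<forall>v. F v = (\<Sum>j<k. a j v * (v $ 3) ^ j))"

text \<open>Split off the value at \<open>v $ 3 = 0\<close>, which is a binary form, divide the rest
  by \<open>v $ 3\<close> and repeat.\<close>

lemma zexpansion_exists: "F \<in> forms m \<Longrightarrow> \<exists>a. zexpansion (Suc m) m a F"
proof (induction m arbitrary: F)
  case 0
  then have "F = (\<lambda>_. F 0)" by (intro ext) (rule forms_0_const)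
  then obtain c where "F = (\<lambda>_. c)" by blast
  then show ?case by (intro exI[of _ "\<lambda>_ _. c"]) (simp add: zexpansion_def bforms_const)
next
  case (Suc m)
  obtain G where G: "G \<in> forms m" "\<And>v. F v = F (v - v $ 3 *s axis 3 1) + v $ 3 * G v"
    using forms_hyperplane_decomp[OF Suc.prems, of "\<lambda>v. v $ 3" "axis 3 1"] by auto
  obtain a where a: "zexpansion (Suc m) m a G" using Suc.IH[OF G(1)] by blast
  define b where "b = case_nat (\<lambda>v. F (v - v $ 3 *s axis 3 1)) a"
  have "(\<lambda>v::complex^3. F (v - v $ 3 *s axis 3 1)) \<in> forms (Suc m)"
  proof (rule forms_compose_linear[OF Suc.prems])
    fix i :: 3
    have "(\<lambda>v::complex^3. v $ i - (axis 3 1 $ i) * v $ 3) \<in> forms (Suc 0)"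
      by (intro forms_diff forms_scale forms_coord)
    then show "(\<lambda>v::complex^3. (v - v $ 3 *s axis 3 1) $ i) \<in> forms 1"
      by (simp add: mult.commute)
  qed
  moreover have "v - v $ 3 *s axis 3 1 = w - w $ 3 *s axis 3 1"
    if "v $ 1 = w $ 1" "v $ 2 = w $ 2" for v w :: "complex^3"
    using that by (simp add: vec_eq_iff forall_3 axis_def)
  ultimately have "(\<lambda>v. F (v - v $ 3 *s axis 3 1)) \<in> bforms (Suc m)"
    by (rule bformsI[OF _ arg_cong])
  then have "\<forall>j<Suc (Suc m). b j \<in> bforms (Suc m - j)"
    using a by (auto simp: b_def zexpansion_def split: nat.split)
  moreover have "F v = (\<Sum>j<Suc (Suc m). b j v * (v $ 3) ^ j)" for v
  proof -
    have "F v = F (v - v $ 3 *s axis 3 1) + v $ 3 * (\<Sum>j<Suc m. a j v * (v $ 3) ^ j)"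
      using G(2)[of v] a unfolding zexpansion_def by metis
    also have "\<dots> = (\<Sum>j<Suc (Suc m). b j v * (v $ 3) ^ j)"
      by (subst sum.lessThan_Suc_shift) (simp add: b_def sum_distrib_left mult_ac del: sum.lessThan_Suc)
    finally show ?thesis .
  qed
  ultimately have "zexpansion (Suc (Suc m)) (Suc m) b F" by (simp add: zexpansion_def)
  then show ?case by blast
qed

text \<open>With the first two coordinates fixed, the sum is a polynomial in the third one that
  vanishes everywhere.\<close>

lemma zexpansion_unique:
  assumes c: "\<And>j v w. j < N \<Longrightarrow> v $ 1 = w $ 1 \<Longrightarrow> v $ 2 = w $ 2 \<Longrightarrow> c j v = c j w"
    and z: "\<And>v :: complex^3. (\<Sum>j<N. c j v * (v $ 3) ^ j) = 0" and j: "j < N"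
  shows "c j v = (0 :: complex)"
proof -
  define p where "p = (\<Sum>i<N. monom (c i v) i)"
  have "poly p t = 0" for t
  proof -
    let ?w = "vector [v $ 1, v $ 2, t] :: complex^3"
    have "poly p t = (\<Sum>i<N. c i v * t ^ i)" by (simp add: p_def poly_sum poly_monom)
    also have "\<dots> = (\<Sum>i<N. c i ?w * (?w $ 3) ^ i)"
      using c[of _ v ?w] by (intro sum.cong) auto
    finally show ?thesis by (simp only: z)
  qed
  then have "p = 0" using poly_all_0_iff_0 by blast
  then have "0 = coeff p j" by simp
  also have "\<dots> = (\<Sum>i<N. if i = j then c i v else 0)"
    unfolding p_def coeff_sum by (intro sum.cong) auto
  finally show ?thesis using j by simp
qed

lemma sum_lessThan_add: "(\<Sum>j<s + N. h j) = (\<Sum>j<s. h j) + (\<Sum>i<N. h (s + i))"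
  for h :: "nat \<Rightarrow> 'a :: comm_monoid_add"
  by (induction N) (auto simp: add.assoc)

lemma linear_form_unit:
  assumes "l \<in> forms 1" "l v \<noteq> 0"
  obtains w where "l w = (1 :: complex)"
  using that[of "(1 / l v) *s v"] forms_1_scale[OF assms(1), of "1 / l v" v] assms(2) by simp

lemma forms_hyperplane_compose:
  assumes "F \<in> forms m" "l \<in> forms 1"
  shows "(\<lambda>v. F (v - l v *s w)) \<in> forms m"
proof (rule forms_compose_linear[OF assms(1)])
  fix i
  have "(\<lambda>v. v $ i - w $ i * l v) \<in> forms 1" using assms(2) by auto
  then show "(\<lambda>v. (v - l v *s w) $ i) \<in> forms 1" by (simp add: mult.commute)
qed

subsection \<open>Homogeneous prime ideals without binary forms are principal\<close>

text \<open>The last condition excludes ideals that are too large to be principal: the ideal of a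
  point of the plane contains a nonzero linear form in the first two variables. It also makes the
  degree in the third variable a measure of size for which pseudo-division works.\<close>

locale prime_form_ideal =
  fixes I :: "nat \<Rightarrow> (complex^3 \<Rightarrow> complex) set"
  assumes I_forms: "F \<in> I m \<Longrightarrow> F \<in> forms m"
    and I_diff: "F \<in> I m \<Longrightarrow> G \<in> I m \<Longrightarrow> (\<lambda>v. F v - G v) \<in> I m"
    and I_mult: "F \<in> I m \<Longrightarrow> G \<in> forms k \<Longrightarrow> (\<lambda>v. G v * F v) \<in> I (k + m)"
    and I_prime: "F \<in> forms a \<Longrightarrow> G \<in> forms b \<Longrightarrow> (\<lambda>v. F v * G v) \<in> I (a + b) \<Longrightarrow> F \<in> I a \<or> G \<in> I b"
    and I_bforms: "F \<in> I m \<Longrightarrow> F \<in> bforms m \<Longrightarrow> F v = 0"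
begin

text \<open>Gauss's lemma in disguise: \<open>f\<close> has minimal degree in the last variable and, among these,
  minimal total degree. Pseudo-division by \<open>f\<close> shows that it divides a multiple \<open>c g\<close> of any
  given \<open>g\<close> in the ideal, with \<open>c\<close> a binary form. The linear factors of \<open>c\<close> do not divide \<open>f\<close>
  by minimality, so that they can be cancelled one by one.\<close>

lemma principal:
  assumes F: "F \<in> I m" "F u \<noteq> 0"
  obtains e f where "f \<in> I e" "\<exists>v. f v \<noteq> 0"
    "\<And>m g. g \<in> I m \<Longrightarrow> (\<forall>v. g v = 0) \<or> (\<exists>r. m = e + r \<and> (\<exists>q\<in>forms r. \<forall>v. g v = f v * q v))"
proof -
  let ?P = "\<lambda>n m. \<exists>F a. F \<in> I m \<and> (\<exists>v. F v \<noteq> 0) \<and> zexpansion (Suc n) m a F"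
  define n where "n = (LEAST n. \<exists>m. ?P n m)"
  have "?P m m" using F zexpansion_exists[OF I_forms[OF F(1)]] by blast
  then have ex: "\<exists>m. ?P n m" unfolding n_def by (intro LeastI[of "\<lambda>n. \<exists>m. ?P n m"]) blast
  have n_min: "n \<le> k" if "?P k m" for k m
    unfolding n_def by (rule Least_le) (use that in blast)
  define e where "e = (LEAST e. ?P n e)"
  have "?P n e" using ex unfolding e_def by (intro LeastI_ex[of "?P n"]) blast
  then obtain f b u0 where f: "f \<in> I e" "f u0 \<noteq> 0" and zf: "zexpansion (Suc n) e b f" by blast
  have e_min: "e \<le> k" if "?P n k" for k
    unfolding e_def by (rule Least_le) (use that in blast)
  have ff: "f \<in> forms e" by (rule I_forms[OF f(1)])
  have ne: "n \<le> e" using zf by (simp add: zexpansion_def)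
  have small: "g v = 0" if g: "g \<in> I m" "zexpansion k m a g" "k \<le> n" for g m k a v
  proof (rule ccontr)
    assume "g v \<noteq> 0"
    have "k \<noteq> 0"
    proof
      assume "k = 0"
      with g(2) have "g v = 0" by (simp add: zexpansion_def)
      with \<open>g v \<noteq> 0\<close> show False ..
    qed
    then obtain k' where "k = Suc k'" by (cases k) auto
    then have "?P k' m" using g(1,2) \<open>g v \<noteq> 0\<close> by blast
    then have "n \<le> k'" by (rule n_min)
    then show False using g(3) \<open>k = Suc k'\<close> by simp
  qed
  have bj: "b j \<in> bforms (e - j)" if "j \<le> n" for j
    using zf that by (auto simp: zexpansion_def)
  have fb: "f v = (\<Sum>j<Suc n. b j v * (v $ 3) ^ j)" for v
    using zf by (auto simp: zexpansion_def)
  have bn: "\<exists>v. b n v \<noteq> 0"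
  proof (rule ccontr)
    assume "\<not> ?thesis"
    then have "zexpansion n e b f" using zf by (auto simp: zexpansion_def)
    from small[OF f(1) this] f(2) show False by simp
  qed
  \<comment> \<open>For the zero form any nonzero binary multiplier will do; its degree is
    \<open>e\<close> only to balance the degrees with \<open>r = m\<close>.\<close>
  have triv: "\<exists>l r c q. c \<in> bforms l \<and> (\<exists>v. c v \<noteq> 0) \<and> q \<in> forms r \<and> l + m = r + e \<and>
      (\<forall>v. c v * g v = f v * q v)" if "\<And>v. g v = 0" for g :: "complex^3 \<Rightarrow> complex" and m
    by (rule exI[of _ e], rule exI[of _ m], rule exI[of _ "\<lambda>v. (v $ 1) ^ e"], rule exI[of _ "\<lambda>_. 0"])
       (intro conjI exI[of _ "axis 1 1"], simp_all add: that bforms_coord_power)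
  have pseudo: "\<exists>l r c q. c \<in> bforms l \<and> (\<exists>v. c v \<noteq> 0) \<and> q \<in> forms r \<and> l + m = r + e \<and>
      (\<forall>v. c v * g v = f v * q v)" if "g \<in> I m" "zexpansion k m a g" for g m k a
    using that
  proof (induction k arbitrary: g m a)
    case (0 g m a)
    show ?case by (rule triv, rule small[OF 0]) simp
  next
    case (Suc k g m a)
    show ?case
    proof (cases "Suc k \<le> n")
      case True
      show ?thesis by (rule triv, rule small[OF Suc.prems True])
    next
      case False
      define s where "s = k - n"
      have k: "k = s + n" using False by (simp add: s_def)
      have km: "k \<le> m" and aj: "\<And>j. j \<le> k \<Longrightarrow> a j \<in> bforms (m - j)"
        and ga: "\<And>v. g v = (\<Sum>j<Suc k. a j v * (v $ 3) ^ j)"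
        using Suc.prems(2) by (auto simp: zexpansion_def)
      let ?az = "\<lambda>v. a k v * (v $ 3) ^ s"
      have "?az \<in> forms ((m - k) + s * Suc 0)"
        by (intro forms_mult forms_power forms_coord bforms_forms[OF aj]) simp
      then have az: "?az \<in> forms (m - n)" using km k by simp
      \<comment> \<open>One step of pseudo-division: multiplying \<open>f\<close> by
        \<open>v $ 3 ^ s\<close> aligns the leading terms, and the coefficients of
        \<open>v $ 3 ^ k\<close> cancel.\<close>
      define g1 where "g1 v = b n v * g v - ?az v * f v" for v
      have "(\<lambda>v. b n v * g v) \<in> I (e - n + m)"
        by (intro I_mult Suc.prems bforms_forms[OF bj]) simp
      moreover have "(\<lambda>v. ?az v * f v) \<in> I (m - n + e)"
        by (intro I_mult f az)
      moreover have deg: "m - n + e = e - n + m" using ne km k by simp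
      ultimately have g1: "g1 \<in> I (e - n + m)"
        unfolding g1_def[abs_def] using I_diff by simp
      define d where "d j v = b n v * a j v - (if s \<le> j then a k v * b (j - s) v else 0)" for j v
      have dj: "d j \<in> bforms (e - n + m - j)" if "j \<le> k" for j
      proof -
        have "(\<lambda>v. b n v * a j v) \<in> bforms ((e - n) + (m - j))"
          using that by (intro bforms_mult bj aj) auto
        then have 1: "(\<lambda>v. b n v * a j v) \<in> bforms (e - n + m - j)" using that km by simp
        show ?thesis
        proof (cases "s \<le> j")
          case True
          have "(\<lambda>v. a k v * b (j - s) v) \<in> bforms ((m - k) + (e - (j - s)))"
            using that k by (intro bforms_mult bj aj) auto
          moreover have "(m - k) + (e - (j - s)) = e - n + m - j"
            using that k km ne True by simp
          ultimately have "(\<lambda>v. a k v * b (j - s) v) \<in> bforms (e - n + m - j)" by simp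
          from bforms_diff[OF 1 this] show ?thesis using True by (simp add: d_def[abs_def])
        next
          case False
          with 1 show ?thesis by (simp add: d_def[abs_def])
        qed
      qed
      have dk: "d k v = 0" for v using k by (simp add: d_def)
      have g1d: "g1 v = (\<Sum>j<k. d j v * (v $ 3) ^ j)" for v
      proof -
        let ?z = "v $ 3"
        have "?az v * f v = (\<Sum>i<Suc n. a k v * b i v * ?z ^ (s + i))"
          unfolding fb sum_distrib_left by (intro sum.cong) (auto simp: power_add)
        also have "\<dots> = (\<Sum>j<s + Suc n. (if s \<le> j then a k v * b (j - s) v else 0) * ?z ^ j)"
          unfolding sum_lessThan_add[of _ s "Suc n"] by simp
        also have "s + Suc n = Suc k" using k by simp
        finally have "g1 v = (\<Sum>j<Suc k. d j v * ?z ^ j)"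
          unfolding g1_def ga d_def left_diff_distrib sum_subtractf sum_distrib_left
          by (simp only: mult.assoc)
        then show ?thesis by (simp add: dk)
      qed
      have "zexpansion k (e - n + m) d g1"
        using dj g1d km by (auto simp: zexpansion_def)
      from Suc.IH[OF g1 this] obtain l r c q where IH: "c \<in> bforms l" "\<exists>v. c v \<noteq> 0" "q \<in> forms r"
        "l + (e - n + m) = r + e" "\<And>v. c v * g1 v = f v * q v" by blast
      have r: "r = l + (m - n)" using IH(4) ne km k by simp
      let ?c = "\<lambda>v. c v * b n v" and ?q = "\<lambda>v. q v + c v * ?az v"
      have "?c \<in> bforms (l + (e - n))" by (intro bforms_mult IH bj) simp
      moreover have "\<exists>v. ?c v \<noteq> 0"
        using forms_no_zero_divisors[OF bforms_forms[OF IH(1)] bforms_forms[OF bj[of n]]] IH(2) bn by blast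
      moreover have "?q \<in> forms r"
      proof (rule forms_add[OF IH(3)])
        show "(\<lambda>v. c v * ?az v) \<in> forms r"
          unfolding r by (intro forms_mult[OF bforms_forms[OF IH(1)] az])
      qed
      moreover have "l + (e - n) + m = r + e" using IH(4) by simp
      moreover have "?c v * g v = f v * ?q v" for v
        using IH(5)[of v] by (simp add: g1_def algebra_simps)
      ultimately show ?thesis by blast
    qed
  qed
  have peel: "(\<forall>v. g v = 0) \<or> (\<exists>r. m = e + r \<and> (\<exists>q\<in>forms r. \<forall>v. g v = f v * q v))"
    if "g \<in> I m" "c \<in> bforms l" "\<exists>v. c v \<noteq> 0" "q \<in> forms r" "l + m = r + e"
      "\<And>v. c v * g v = f v * q v" for g m c l q r
    using that
  proof (induction l arbitrary: c q r)
    case 0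
    have c: "c v = c 0" for v by (rule forms_0_const[OF bforms_forms[OF 0(2)]])
    have c0: "c 0 \<noteq> 0" using 0(3) c by metis
    have q': "(\<lambda>v. (1 / c 0) * q v) \<in> forms r" by (rule forms_scale[OF 0(4)])
    have "g v = f v * ((1 / c 0) * q v)" for v
      using 0(6)[of v] c[of v] c0 by (simp add: field_simps)
    then have "\<exists>q\<in>forms r. \<forall>v. g v = f v * q v" by (intro bexI[OF _ q'] allI)
    then show ?case using 0(5) by (intro disjI2 exI[of _ r]) simp
  next
    case (Suc l)
    obtain h c' where hc: "h \<in> bforms 1" "c' \<in> bforms l" "\<And>v. c v = h v * c' v"
      using bforms_factor[OF Suc.prems(2)] by metis
    have hf: "h \<in> forms 1" by (rule bforms_forms[OF hc(1)])
    have c'f: "c' \<in> forms l" by (rule bforms_forms[OF hc(2)])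
    have gf: "g \<in> forms m" by (rule I_forms[OF Suc.prems(1)])
    obtain v0 where v0: "c v0 \<noteq> 0" using Suc.prems(3) by blast
    then have hv0: "h v0 \<noteq> 0" "c' v0 \<noteq> 0" by (auto simp: hc)
    obtain w where w: "h w = 1" using linear_form_unit[OF hf hv0(1)] by blast
    define P where "P v = v - h v *s w" for v
    have hP: "h (P v) = 0" for v
      unfolding P_def using forms_1_diff[OF hf] forms_1_scale[OF hf] w by simp
    have zero: "f (P v) * q (P v) = 0" for v
      using Suc.prems(6)[of "P v"] by (simp add: hc hP)
    have divide: "\<exists>k' G'. k = Suc k' \<and> G' \<in> forms k' \<and> (\<forall>v. G v = h v * G' v)"
      if G: "G \<in> forms k" "\<And>v. G (P v) = 0" "\<exists>v. G v \<noteq> 0" for G k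
    proof -
      obtain G' where G': "G' \<in> forms (k - 1)" "\<And>v. G v = G (P v) + h v * G' v"
        using forms_hyperplane_decomp[OF G(1) hf, of w] unfolding P_def by blast
      have "k \<noteq> 0"
      proof
        assume "k = 0"
        then have "G v = G (P v)" for v using forms_0_const G(1) by metis
        with G show False by auto
      qed
      then show ?thesis using G' G(2) by (intro exI[of _ "k - 1"] exI[of _ G']) auto
    qed
    \<comment> \<open>\<open>P\<close> projects onto the line \<open>h = 0\<close>, where
      \<open>f q\<close> vanishes; there one of the factors must vanish, hence be divisible by
      \<open>h\<close>.\<close>
    have "(\<forall>v. f (P v) = 0) \<or> (\<forall>v. q (P v) = 0)"
      using forms_no_zero_divisors[OF forms_hyperplane_compose[OF ff hf, of w]
          forms_hyperplane_compose[OF Suc.prems(4) hf, of w]] zero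
      unfolding P_def by blast
    then show ?case
    proof
      assume "\<forall>v. f (P v) = 0"
      then obtain e' f' where f': "e = Suc e'" "f' \<in> forms e'" "\<And>v. f v = h v * f' v"
        using divide[OF ff] f(2) by blast
      \<comment> \<open>A nonzero binary form is not in the ideal, so primality puts
        \<open>f'\<close> there. It has smaller total degree than \<open>f\<close>, against the
        choice of \<open>e\<close>, provided that its degree in the third variable is no
        larger.\<close>
      have "(\<lambda>v. h v * f' v) \<in> I (1 + e')" using f(1) f'(1,3) by (simp flip: f'(3))
      from I_prime[OF hf f'(2) this] have f'I: "f' \<in> I e'"
        using I_bforms[of h 1 v0] hc(1) hv0 by blast
      obtain a where a: "zexpansion (Suc e') e' a f'" using zexpansion_exists[OF f'(2)] by blast
      then have aj: "\<And>j. j \<le> e' \<Longrightarrow> a j \<in> bforms (e' - j)"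
        and fa: "\<And>v. f' v = (\<Sum>j<Suc e'. a j v * (v $ 3) ^ j)"
        by (auto simp: zexpansion_def)
      have haj: "(\<lambda>v. h v * a j v) \<in> bforms (e - j)" if "j \<le> e'" for j
        using bforms_mult[OF hc(1) aj[OF that]] that f'(1) by (simp add: Suc_diff_le)
      have fha: "f v = (\<Sum>j<e. (h v * a j v) * (v $ 3) ^ j)" for v
        unfolding f'(3) fa f'(1) sum_distrib_left by (simp only: mult.assoc)
      show ?case
      proof (cases "Suc n \<le> e")
        \<comment> \<open>This means \<open>n = e\<close>. Then \<open>h f'\<close> has only
          \<open>e\<close> coefficients in the third variable, which already contradicts the
          minimality of \<open>n\<close>.\<close>
        case False
        have "zexpansion e e (\<lambda>j v. h v * a j v) f"
          using haj fha f'(1) by (auto simp: zexpansion_def)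
        then have "f u0 = 0" using small[OF f(1)] ne False by force
        with f(2) show ?thesis by simp
      next
        case True
        \<comment> \<open>Comparing coefficients in \<open>f = h f'\<close> shows
          \<open>h a j = 0\<close> beyond \<open>n\<close>, so \<open>f'\<close> inherits the bound
          on the degree in the third variable.\<close>
        have a0: "a j v = 0" if "n < j" "j < e" for j v
        proof -
          let ?d = "\<lambda>j v. h v * a j v - (if j < Suc n then b j v else 0)"
          have "?d j v = 0" for v
          proof (rule zexpansion_unique[OF _ _ that(2)])
            fix i and x y :: "complex^3" assume i: "i < e" "x $ 1 = y $ 1" "x $ 2 = y $ 2"
            have "b i x = b i y" if "i < Suc n" using bforms_eq[OF bj i(2,3)] that by simp
            moreover have "h x * a i x = h y * a i y"
              using bforms_eq[OF haj i(2,3)] i(1) f'(1) by simp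
            ultimately show "?d i x = ?d i y" by auto
          next
            fix x :: "complex^3"
            have "f x = (\<Sum>j<e. (if j < Suc n then b j x else 0) * (x $ 3) ^ j)"
              unfolding fb using True
              by (intro sum.mono_neutral_cong_left) auto
            with fha[of x] show "(\<Sum>j<e. ?d j x * (x $ 3) ^ j) = 0"
              by (simp add: left_diff_distrib sum_subtractf)
          qed
          then have "h v * a j v = 0" for v using that(1) by auto
          moreover have "a j \<in> forms (e' - j)" using bforms_forms[OF aj] that(2) f'(1) by simp
          ultimately show ?thesis
            using forms_no_zero_divisors[OF hf] hv0(1) by blast
        qed
        have "f' v = (\<Sum>j<Suc n. a j v * (v $ 3) ^ j)" for v
          unfolding fa using True f'(1) a0
          by (intro sum.mono_neutral_right) auto
        then have "zexpansion (Suc n) e' a f'"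
          using True f'(1) aj by (auto simp: zexpansion_def)
        moreover have "f' u0 \<noteq> 0" using f(2) f'(3) by auto
        ultimately have "e \<le> e'" using f'I by (intro e_min) blast
        then show ?thesis using f'(1) by simp
      qed
    next
      assume qP: "\<forall>v. q (P v) = 0"
      show ?case
      proof (cases "\<forall>v. q v = 0")
        case True
        then have "c v * g v = 0" for v using Suc.prems(6) by simp
        then show ?thesis
          using forms_no_zero_divisors[OF bforms_forms[OF Suc.prems(2)] gf] v0 by blast
      next
        case False
        then obtain r' q' where q': "r = Suc r'" "q' \<in> forms r'" "\<And>v. q v = h v * q' v"
          using divide[OF Suc.prems(4)] qP by blast
        have deg: "l + m = r' + e" using Suc.prems(5) q'(1) by simp
        have "(\<lambda>v. f v * q' v) \<in> forms (l + m)"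
          using forms_mult[OF ff q'(2)] by (simp add: deg add.commute)
        then have "(\<lambda>v. c' v * g v - f v * q' v) \<in> forms (l + m)"
          by (intro forms_diff forms_mult[OF c'f gf])
        moreover have "h v * (c' v * g v - f v * q' v) = 0" for v
          using Suc.prems(6)[of v] by (simp add: hc q' algebra_simps)
        ultimately have "c' v * g v - f v * q' v = 0" for v
          using forms_no_zero_divisors[OF hf] hv0(1) by blast
        then have "c' v * g v = f v * q' v" for v by simp
        from Suc.IH[OF Suc.prems(1) hc(2) _ q'(2) deg this] hv0(2) show ?thesis by blast
      qed
    qed
  qed
  show thesis
  proof (rule that[OF f(1)])
    show "\<exists>v. f v \<noteq> 0" using f(2) by blast
    fix m g assume g: "g \<in> I m"
    obtain a where "zexpansion (Suc m) m a g" using zexpansion_exists[OF I_forms[OF g]] by blast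
    from pseudo[OF g this] obtain l r c q where *: "c \<in> bforms l" "\<exists>v. c v \<noteq> 0" "q \<in> forms r"
      "l + m = r + e" "\<And>v. c v * g v = f v * q v" by blast
    show "(\<forall>v. g v = 0) \<or> (\<exists>r. m = e + r \<and> (\<exists>q\<in>forms r. \<forall>v. g v = f v * q v))"
      by (rule peel[OF g *])
  qed
qed

end

subsection \<open>The cone over a projective set\<close>

lemma vec_span_singleton: "vec.span {v} = range (\<lambda>k. k *s v)"
  by (rule vec.span_singleton)

lemma vec_span_scale: "c \<noteq> 0 \<Longrightarrow> vec.span {c *s v} = vec.span {v}"
  for v :: "complex^'n"
  unfolding vec_span_singleton
  by (auto simp: image_iff) (metis (no_types) divide_inverse mult.assoc mult.commute mult.right_neutral right_inverse)

definition affine_cone :: "(complex^'n) set set \<Rightarrow> (complex^'n) set" where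
  "affine_cone X = \<Union>X - {0}"

lemma pspace_rep:
  assumes "p \<in> pspace" "v \<in> p" "v \<noteq> 0"
  shows "p = vec.span {v}"
proof -
  obtain w where w: "p = vec.span {w}" using assms(1) by (auto simp: pspace_def)
  then obtain k where "v = k *s w" using assms(2) by (auto simp: vec_span_singleton)
  then show ?thesis using w assms(3) vec_span_scale[of k w] by auto
qed

lemma vanishes_on_iff: "vanishes_on F X \<longleftrightarrow> (\<forall>v\<in>affine_cone X. F v = 0)"
  by (auto simp: vanishes_on_def affine_cone_def)

lemma vanishes_on_span:
  assumes "F \<in> forms m" "F v = 0"
  shows "vanishes_on F {vec.span {v}}"
  using assms by (auto simp: vanishes_on_def vec_span_singleton forms_homogeneous)

lemma zclosed_zero_set:
  assumes "F \<in> forms m"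
  shows "zclosed {p \<in> pspace. vanishes_on F {p}}"
  unfolding zclosed_def using assms by (intro exI[of _ "{F}"]) auto

lemma restrict_to_eq_iff: "restrict_to X F = restrict_to X G \<longleftrightarrow> (\<forall>v\<in>affine_cone X. F v = G v)"
  by (auto simp: restrict_to_def affine_cone_def fun_eq_iff)

lemma restrict_to_eq_0_iff: "restrict_to X F = 0 \<longleftrightarrow> (\<forall>v\<in>affine_cone X. F v = 0)"
  by (auto simp: restrict_to_def affine_cone_def fun_eq_iff)

lemma restrict_to_linear: "cfun_linear (restrict_to X)"
  by (rule cfun_linearI) (auto simp: restrict_to_def cfun_scale_def fun_eq_iff)

lemma restrict_to_eq_mult: "restrict_to X F = (\<lambda>v. (if v \<in> affine_cone X then 1 else 0) * F v)"
  by (auto simp: restrict_to_def affine_cone_def)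

section \<open>The homogeneous ideal of the curve and the ideals of its plane images\<close>

locale space_curve =
  fixes C :: "(complex^4) set set" and d :: nat and c :: int
  assumes closed: "zclosed C" and irreducible: "zirreducible C" and nondeg: "nondegenerate C"
    and hilbert: "\<forall>\<^sub>F m in sequentially. int (cfun.dim (restrict_to C ` forms m)) = int d * int m + c"
begin

lemma C_pspace: "C \<subseteq> pspace"
  using closed by (auto simp: zclosed_def)

lemma span_in_C: "v \<in> affine_cone C \<Longrightarrow> vec.span {v} \<in> C"
  using pspace_rep C_pspace by (auto simp: affine_cone_def)

lemma cone_rep:
  assumes "p \<in> C" obtains v where "v \<in> affine_cone C" "p = vec.span {v}" "v \<noteq> 0"
proof -
  obtain v where "v \<noteq> 0" "p = vec.span {v}" using assms C_pspace by (auto simp: pspace_def)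
  then show thesis using assms by (intro that[of v]) (auto simp: affine_cone_def intro: vec.span_base)
qed

lemma cone_nonempty: "affine_cone C \<noteq> {}"
proof -
  obtain p where "p \<in> C" using irreducible by (auto simp: zirreducible_def)
  then show ?thesis using cone_rep by blast
qed

text \<open>The zero sets of \<open>F\<close> and \<open>G\<close> cover \<open>C\<close>, and
  irreducibility places \<open>C\<close> inside one of them: the homogeneous ideal of
  \<open>C\<close> is prime.\<close>

lemma vanish_prime:
  assumes F: "F \<in> forms a" and G: "G \<in> forms b" and FG: "\<And>v. v \<in> affine_cone C \<Longrightarrow> F v * G v = 0"
  shows "(\<forall>v\<in>affine_cone C. F v = 0) \<or> (\<forall>v\<in>affine_cone C. G v = 0)"
proof -
  let ?Z = "\<lambda>F. {p \<in> pspace. vanishes_on F {p}}"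
  have "p \<in> ?Z F \<union> ?Z G" if p: "p \<in> C" for p
  proof -
    obtain v where v: "v \<in> affine_cone C" "p = vec.span {v}" using cone_rep[OF p] by blast
    then have "F v = 0 \<or> G v = 0" using FG[of v] by auto
    then have "vanishes_on F {p} \<or> vanishes_on G {p}"
      unfolding v(2) using vanishes_on_span F G by blast
    then show ?thesis using p C_pspace by auto
  qed
  then have "C \<subseteq> ?Z F \<union> ?Z G" by blast
  then have "C \<subseteq> ?Z F \<or> C \<subseteq> ?Z G"
    using irreducible zclosed_zero_set[OF F] zclosed_zero_set[OF G] by (auto simp: zirreducible_def)
  then show ?thesis by (auto simp: vanishes_on_def affine_cone_def)
qed

lemma vanish_linear:
  assumes "L \<in> forms 1" "\<And>v. v \<in> affine_cone C \<Longrightarrow> L v = 0"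
  shows "L v = 0"
  using nondeg assms by (auto simp: nondegenerate_def vanishes_on_iff fun_eq_iff)

definition plane_ideal :: "complex^4^3 \<Rightarrow> nat \<Rightarrow> (complex^3 \<Rightarrow> complex) set" where
  "plane_ideal \<Xi> m = {F \<in> forms m. \<forall>v\<in>affine_cone C. F (\<Xi> *v v) = 0}"

text \<open>The degree \<open>m\<close> part of the coordinate ring of the plane image, realised by
  functions on the cone over \<open>C\<close>. Its comparison with the coordinate ring of
  \<open>C\<close> is then a plain inclusion.\<close>

definition plane_ring :: "complex^4^3 \<Rightarrow> nat \<Rightarrow> (complex^4 \<Rightarrow> complex) set" where
  "plane_ring \<Xi> m = (\<lambda>F. restrict_to C (\<lambda>v. F (\<Xi> *v v))) ` forms m"

text \<open>Asking for an \<open>r\<close> with \<open>m = e + r\<close>, rather than using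
  \<open>m - e\<close>, encodes that the ideal is zero below degree \<open>e\<close>.\<close>

definition generates :: "complex^4^3 \<Rightarrow> nat \<Rightarrow> (complex^3 \<Rightarrow> complex) \<Rightarrow> bool" where
  "generates \<Xi> e f \<longleftrightarrow> (\<forall>m. \<forall>g\<in>plane_ideal \<Xi> m.
     (\<forall>v. g v = 0) \<or> (\<exists>r. m = e + r \<and> (\<exists>q\<in>forms r. \<forall>v. g v = f v * q v)))"

lemma generatesD:
  assumes "generates \<Xi> e f" "g \<in> plane_ideal \<Xi> m"
  shows "(\<forall>v. g v = 0) \<or> (\<exists>r. m = e + r \<and> (\<exists>q\<in>forms r. \<forall>v. g v = f v * q v))"
  using assms unfolding generates_def by (elim allE) (erule bspec)

lemma pullback_forms: "F \<in> forms m \<Longrightarrow> (\<lambda>v. F (\<Xi> *v v)) \<in> forms m"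
  for \<Xi> :: "complex^'n^'k"
  by (rule forms_compose_linear) simp_all

text \<open>A binary form in the ideal splits into linear factors, one of which pulls back to a
  linear form vanishing on \<open>C\<close> unless the form is a constant. Nondegeneracy and
  surjectivity of \<Xi> then make that factor zero.\<close>

lemma prime_form_ideal_plane_ideal:
  assumes surj: "\<And>x. \<exists>v. \<Xi> *v v = x"
  shows "prime_form_ideal (plane_ideal \<Xi>)"
proof
  fix F :: "complex^3 \<Rightarrow> complex" and G a b
  assume F: "F \<in> forms a" and G: "G \<in> forms b" and FG: "(\<lambda>v. F v * G v) \<in> plane_ideal \<Xi> (a + b)"
  have "F (\<Xi> *v v) * G (\<Xi> *v v) = 0" if "v \<in> affine_cone C" for v
    using FG that by (simp add: plane_ideal_def)
  from vanish_prime[OF pullback_forms[OF F] pullback_forms[OF G] this]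
  show "F \<in> plane_ideal \<Xi> a \<or> G \<in> plane_ideal \<Xi> b" using F G by (auto simp: plane_ideal_def)
next
  fix F m v
  assume "F \<in> plane_ideal \<Xi> m" "F \<in> bforms m"
  then show "F v = 0"
  proof (induction m arbitrary: F v)
    case 0
    obtain w where "w \<in> affine_cone C" using cone_nonempty by blast
    then have "F (\<Xi> *v w) = 0" using 0 by (simp add: plane_ideal_def)
    then show ?case using forms_0_const[OF bforms_forms[OF 0(2)]] by metis
  next
    case (Suc m)
    obtain l G where lG: "l \<in> bforms 1" "G \<in> bforms m" "\<And>v. F v = l v * G v"
      using bforms_factor[OF Suc.prems(2)] by metis
    have lf: "l \<in> forms 1" and Gf: "G \<in> forms m" using lG bforms_forms by blast+
    have "l (\<Xi> *v v) * G (\<Xi> *v v) = 0" if "v \<in> affine_cone C" for v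
      using Suc.prems(1) that lG(3) by (simp add: plane_ideal_def)
    then consider "\<forall>v\<in>affine_cone C. l (\<Xi> *v v) = 0" | "\<forall>v\<in>affine_cone C. G (\<Xi> *v v) = 0"
      using vanish_prime[OF pullback_forms[OF lf] pullback_forms[OF Gf]] by blast
    then show ?case
    proof cases
      case 1
      then have "l (\<Xi> *v v) = 0" for v
        using vanish_linear[of "\<lambda>v. l (\<Xi> *v v)", OF pullback_forms[OF lf]] by blast
      then have "l v = 0" by (metis surj)
      then show ?thesis by (simp add: lG(3))
    next
      case 2
      then have "G \<in> plane_ideal \<Xi> m" using Gf by (simp add: plane_ideal_def)
      from Suc.IH[OF this lG(2)] show ?thesis by (simp add: lG(3))
    qed
  qed
qed (auto simp: plane_ideal_def)

lemma sections_finite: "\<exists>A. finite A \<and> restrict_to C ` forms m \<subseteq> cfun.span A"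
proof -
  obtain A :: "(complex^4 \<Rightarrow> complex) set" where A: "finite A" "forms m = cfun.span A"
    using forms_finite_span by blast
  interpret r: Vector_Spaces.linear cfun_scale cfun_scale "restrict_to C" by (rule restrict_to_linear)
  have "restrict_to C ` forms m = cfun.span (restrict_to C ` A)"
    unfolding A(2) by (rule r.span_image[symmetric])
  with A(1) show ?thesis by blast
qed

lemma plane_ring_subset: "plane_ring \<Xi> m \<subseteq> restrict_to C ` forms m"
  unfolding plane_ring_def using pullback_forms by blast

lemma pullback_linear: "cfun_linear (\<lambda>F. restrict_to C (\<lambda>v. F (L v)))"
  by (rule cfun_linearI) (auto simp: restrict_to_def cfun_scale_def fun_eq_iff)

lemma dim_plane_ring:
  "cfun.dim (plane_ring \<Xi> m) + cfun.dim (plane_ideal \<Xi> m) = (m + 2 choose 2)"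
proof -
  obtain A :: "(complex^3 \<Rightarrow> complex) set" where A: "finite A" "forms m = cfun.span A"
    using forms_finite_span by blast
  have "plane_ideal \<Xi> m = {F \<in> forms m. restrict_to C (\<lambda>v. F (\<Xi> *v v)) = 0}"
    by (auto simp: plane_ideal_def restrict_to_eq_0_iff)
  with cfun_rank_nullity[OF pullback_linear forms_subspace _ A(1), of m "\<lambda>v. \<Xi> *v v"] A(2)
  have "cfun.dim (forms m :: (complex^3 \<Rightarrow> complex) set) = cfun.dim (plane_ring \<Xi> m) + cfun.dim (plane_ideal \<Xi> m)"
    by (simp only: plane_ring_def order.refl)
  then show ?thesis by (simp add: dim_ternary_forms)
qed

section \<open>Comparison of Hilbert functions\<close>

lemma hilbert_obtain:
  obtains M where "\<And>m. M \<le> m \<Longrightarrow>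
    real (cfun.dim (restrict_to C ` forms m)) = real d * real m + real_of_int c"
proof -
  obtain M where M: "\<And>m. M \<le> m \<Longrightarrow> int (cfun.dim (restrict_to C ` forms m)) = int d * int m + c"
    using hilbert by (auto simp: eventually_sequentially)
  have "real (cfun.dim (restrict_to C ` forms m)) = real d * real m + real_of_int c" if "M \<le> m" for m
  proof -
    have "real_of_int (int (cfun.dim (restrict_to C ` forms m))) = real_of_int (int d * int m + c)"
      using M[OF that] by (simp only:)
    then show ?thesis by simp
  qed
  then show thesis by (rule that)
qed

lemma plane_ring_dim_le: "cfun.dim (plane_ring \<Xi> m) \<le> cfun.dim (restrict_to C ` forms m)"
  using cfun_dim_mono[OF plane_ring_subset] sections_finite by blast

text \<open>Otherwise the plane ring would grow quadratically with the degree, while it sits inside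
  the coordinate ring of \<open>C\<close>, which grows linearly.\<close>

lemma plane_ideal_nonzero: "\<exists>m F v. F \<in> plane_ideal \<Xi> m \<and> F v \<noteq> 0"
proof (rule ccontr)
  assume none: "\<not> ?thesis"
  obtain M where M: "\<And>m. M \<le> m \<Longrightarrow>
    real (cfun.dim (restrict_to C ` forms m)) = real d * real m + real_of_int c"
    using hilbert_obtain by blast
  define m where "m = M + 2 * d + 2 * nat \<bar>c\<bar> + 1"
  have "plane_ideal \<Xi> m = {0}"
    using none by (auto simp: plane_ideal_def fun_eq_iff zero_fun_def)
  then have "(m + 2 choose 2) = cfun.dim (plane_ring \<Xi> m)"
    using dim_plane_ring[of \<Xi> m] by (simp add: cfun_dim_zero)
  then have "real (m + 2 choose 2) \<le> real d * real m + real_of_int c"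
    using plane_ring_dim_le[of \<Xi> m] M[of m] by (simp add: m_def)
  then have "(real m + 2) * (real m + 1) \<le> 2 * real d * real m + 2 * real_of_int c"
    using choose_two_real[of m] by simp
  moreover have m: "real m \<ge> 2 * real d + 1" "real m \<ge> 2 * real_of_int c"
    by (simp_all add: m_def)
  then have "(2 * real d + 1) * real m \<le> real m * real m" by (intro mult_right_mono) auto
  ultimately show False using m by (simp add: algebra_simps)
qed

lemma plane_ideal_principal:
  assumes surj: "\<And>x. \<exists>v. \<Xi> *v v = x"
  obtains e f where "f \<in> plane_ideal \<Xi> e" "\<exists>v. f v \<noteq> 0"
    "generates \<Xi> e f"
proof -
  interpret prime_form_ideal "plane_ideal \<Xi>" by (rule prime_form_ideal_plane_ideal[OF surj])
  obtain m F v where "F \<in> plane_ideal \<Xi> m" "F v \<noteq> 0" using plane_ideal_nonzero by blast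
  then obtain e f where f: "f \<in> plane_ideal \<Xi> e" "\<exists>v. f v \<noteq> 0"
    and pr: "\<And>m g. g \<in> plane_ideal \<Xi> m \<Longrightarrow>
       (\<forall>v. g v = 0) \<or> (\<exists>r. m = e + r \<and> (\<exists>q\<in>forms r. \<forall>v. g v = f v * q v))"
    by (rule principal) (rule that)
  have "generates \<Xi> e f" unfolding generates_def by (intro allI ballI) (rule pr)
  then show thesis by (rule that[OF f])
qed

text \<open>Multiplication by \<open>f\<close> is a bijection from the forms of degree
  \<open>r\<close>; injectivity is the absence of zero divisors.\<close>

lemma dim_plane_ideal:
  assumes f: "f \<in> plane_ideal \<Xi> e" "\<exists>v. f v \<noteq> 0"
    and pr: "generates \<Xi> e f"
  shows "cfun.dim (plane_ideal \<Xi> (e + r)) = (r + 2 choose 2)"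
proof -
  let ?L = "\<lambda>q v. f v * q v"
  obtain A :: "(complex^3 \<Rightarrow> complex) set" where A: "finite A" "forms r = cfun.span A"
    using forms_finite_span by blast
  have ff: "f \<in> forms e" using f by (simp add: plane_ideal_def)
  have lin: "cfun_linear ?L"
    by (rule cfun_linearI) (auto simp: cfun_scale_def fun_eq_iff distrib_left)
  have "?L ` forms r = plane_ideal \<Xi> (e + r)"
  proof (intro equalityI subsetI)
    fix g assume "g \<in> ?L ` forms r"
    then show "g \<in> plane_ideal \<Xi> (e + r)" using f(1) ff by (auto simp: plane_ideal_def)
  next
    fix g assume g: "g \<in> plane_ideal \<Xi> (e + r)"
    show "g \<in> ?L ` forms r"
    proof (cases "\<forall>v. g v = 0")
      case True
      then show ?thesis by (intro image_eqI[of _ _ "\<lambda>_. 0"]) auto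
    next
      case False
      then obtain q where "q \<in> forms r" "\<forall>v. g v = f v * q v" using generatesD[OF pr g] by auto
      then show ?thesis by (intro image_eqI[of _ _ q]) auto
    qed
  qed
  moreover have "{q \<in> forms r. ?L q = 0} = {0}"
  proof (intro equalityI subsetI)
    fix q assume q: "q \<in> {q \<in> forms r. ?L q = 0}"
    then have "f v * q v = 0" for v by (auto simp: fun_eq_iff)
    then have "(\<forall>v. f v = 0) \<or> (\<forall>v. q v = 0)"
      by (rule forms_no_zero_divisors[OF ff, of q r, rotated]) (use q in simp)
    then have "q v = 0" for v using f(2) by metis
    then show "q \<in> {0}" by (auto simp: fun_eq_iff)
  qed (auto simp: zero_fun_def)
  ultimately have "cfun.dim (forms r :: (complex^3 \<Rightarrow> complex) set) = cfun.dim (plane_ideal \<Xi> (e + r))"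
    using cfun_rank_nullity[OF lin forms_subspace _ A(1), of r] A(2)
    by (simp only: cfun_dim_zero order.refl add_0_right)
  then show ?thesis by (simp add: dim_ternary_forms)
qed

text \<open>The Hilbert polynomial of a plane curve of degree \<open>e\<close>, doubled to avoid
  fractions and written in \<open>r\<close>. Its slope is \<open>e\<close>.\<close>

lemma dim_plane_ring_principal:
  assumes f: "f \<in> plane_ideal \<Xi> e" "\<exists>v. f v \<noteq> 0"
    and pr: "generates \<Xi> e f"
  shows "2 * real (cfun.dim (plane_ring \<Xi> (e + r))) = real e * (real e + 2 * real r + 3)"
proof -
  have "2 * real (cfun.dim (plane_ring \<Xi> (e + r))) + 2 * real (r + 2 choose 2) = 2 * real (e + r + 2 choose 2)"
    using dim_plane_ring[of \<Xi> "e + r"] dim_plane_ideal[OF f pr, of r] by (simp flip: of_nat_add)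
  then show ?thesis unfolding choose_two_real by (simp add: algebra_simps)
qed

text \<open>The inclusion into the coordinate ring of \<open>C\<close> compares the slopes
  \<open>e\<close> and \<open>d\<close>. Birationality is not assumed, so the bound is also
  available for the vertices near \<open>q\<close>.\<close>

lemma plane_degree_le:
  assumes f: "f \<in> plane_ideal \<Xi> e" "\<exists>v. f v \<noteq> 0"
    and pr: "generates \<Xi> e f"
  shows "e \<le> d"
proof (rule ccontr)
  assume "\<not> e \<le> d"
  then have de: "real d + 1 \<le> real e" by simp
  obtain M where M: "\<And>m. M \<le> m \<Longrightarrow>
    real (cfun.dim (restrict_to C ` forms m)) = real d * real m + real_of_int c"
    using hilbert_obtain by blast
  \<comment> \<open>If \<open>e\<close> exceeded \<open>d\<close>, the inequality of dimensions
    would force \<open>r \<le> d * e + c\<close>; this \<open>r\<close> is beyond that bound and in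
    the range of the Hilbert polynomial.\<close>
  define r where "r = M + d * e + nat \<bar>c\<bar> + 1"
  have "real e * (real e + 2 * real r + 3) \<le> 2 * (real d * real (e + r) + real_of_int c)"
    using dim_plane_ring_principal[OF f pr, of r] plane_ring_dim_le[of \<Xi> "e + r"] M[of "e + r"]
    by (simp add: r_def)
  moreover have "(real d + 1) * (2 * real r) \<le> real e * (2 * real r)"
    using de by (intro mult_right_mono) auto
  moreover have "0 \<le> real e * real e + 3 * real e" by simp
  moreover have "real r \<ge> real d * real e + real_of_int c + 1" by (simp add: r_def)
  ultimately show False by (simp add: algebra_simps)
qed

text \<open>The form \<open>H\<close> plays the role of an element of the conductor.\<close>

lemma plane_degree_ge:
  assumes f: "f \<in> plane_ideal \<Xi> e" "\<exists>v. f v \<noteq> 0"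
    and pr: "generates \<Xi> e f"
    and H: "H \<in> forms K" "\<exists>v\<in>affine_cone C. H (\<Xi> *v v) \<noteq> 0"
    and conductor: "\<And>m F. F \<in> forms m \<Longrightarrow> \<exists>G\<in>forms (m + K). \<forall>v\<in>affine_cone C. H (\<Xi> *v v) * F v = G (\<Xi> *v v)"
  shows "d \<le> e"
proof (rule ccontr)
  assume "\<not> d \<le> e"
  then have de: "real e + 1 \<le> real d" by simp
  \<comment> \<open>Multiplication by \<open>H\<close> is injective because the coordinate ring of
    \<open>C\<close> is a domain, and it lands in the plane ring \<open>K\<close> degrees higher. A
    fixed shift leaves the slope unchanged.\<close>
  have le: "cfun.dim (restrict_to C ` forms m) \<le> cfun.dim (plane_ring \<Xi> (m + K))" for m
  proof -
    let ?L = "\<lambda>F v. H (\<Xi> *v v) * F v"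
    let ?S = "restrict_to C ` forms m"
    interpret r: Vector_Spaces.linear cfun_scale cfun_scale "restrict_to C" by (rule restrict_to_linear)
    have lin: "cfun_linear ?L"
      by (rule cfun_linearI) (auto simp: cfun_scale_def fun_eq_iff distrib_left)
    have sub: "cfun.subspace ?S" by (rule r.subspace_image[OF forms_subspace])
    obtain A where A: "finite A" "?S \<subseteq> cfun.span A" using sections_finite by blast
    have "{s \<in> ?S. ?L s = 0} = {0}"
    proof (intro equalityI subsetI)
      fix s assume "s \<in> {s \<in> ?S. ?L s = 0}"
      then obtain F where F: "F \<in> forms m" "s = restrict_to C F" and s: "?L s = 0" by blast
      have "H (\<Xi> *v v) * F v = 0" if "v \<in> affine_cone C" for v
        using fun_cong[OF s, of v] that by (simp add: F restrict_to_eq_mult)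
      from vanish_prime[OF pullback_forms[OF H(1)] F(1) this] H(2)
      show "s \<in> {0}" by (auto simp: F restrict_to_eq_0_iff)
    next
      fix s :: "complex^4 \<Rightarrow> complex" assume "s \<in> {0}"
      moreover have "restrict_to C (\<lambda>_. 0) = 0" by (simp add: restrict_to_eq_0_iff)
      then have "0 \<in> ?S" by (metis forms_zero imageI)
      ultimately show "s \<in> {s \<in> ?S. ?L s = 0}" by (auto simp: fun_eq_iff)
    qed
    with cfun_rank_nullity[OF lin sub A(2,1)] have "cfun.dim ?S = cfun.dim (?L ` ?S)"
      by (simp add: cfun_dim_zero)
    also have "\<dots> \<le> cfun.dim (plane_ring \<Xi> (m + K))"
    proof -
      obtain A' where A': "finite A'" "restrict_to C ` forms (m + K) \<subseteq> cfun.span A'"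
        using sections_finite by blast
      have "?L ` ?S \<subseteq> plane_ring \<Xi> (m + K)"
      proof
        fix s assume "s \<in> ?L ` ?S"
        then obtain F where F: "F \<in> forms m" "s = ?L (restrict_to C F)" by blast
        obtain G where G: "G \<in> forms (m + K)" "\<forall>v\<in>affine_cone C. H (\<Xi> *v v) * F v = G (\<Xi> *v v)"
          using conductor[OF F(1)] by blast
        have "s = restrict_to C (\<lambda>v. G (\<Xi> *v v))"
          using G(2) by (auto simp: F restrict_to_eq_mult fun_eq_iff)
        with G(1) show "s \<in> plane_ring \<Xi> (m + K)" by (auto simp: plane_ring_def)
      qed
      with A' plane_ring_subset show ?thesis by (intro cfun_dim_mono) blast+
    qed
    finally show ?thesis .
  qed
  obtain M where M: "\<And>m. M \<le> m \<Longrightarrow>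
    real (cfun.dim (restrict_to C ` forms m)) = real d * real m + real_of_int c"
    using hilbert_obtain by blast
  \<comment> \<open>\<open>B\<close> dominates the terms that do not grow with \<open>r\<close>,
    while a slope gap of at least 1 contributes \<open>2 * r\<close>. Adding \<open>K\<close> to
    \<open>r\<close> keeps the subtraction in \<open>m\<close> from truncating.\<close>
  define B where "B = e * e + 3 * e + 2 * nat \<bar>c\<bar> + 2 * (e + 1) * K"
  define r where "r = M + K + B + 1"
  define m where "m = e + r - K"
  have mK: "m + K = e + r" and Mm: "M \<le> m" by (simp_all add: m_def r_def)
  have rm: "real m = real e + real r - real K" using mK by linarith
  have "2 * (real d * real m + real_of_int c) \<le> real e * (real e + 2 * real r + 3)"
    using le[of m] M[OF Mm] dim_plane_ring_principal[OF f pr, of r] unfolding mK by simp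
  moreover have "(real e + 1) * real m \<le> real d * real m"
    using de by (intro mult_right_mono) auto
  ultimately have "2 * ((real e + 1) * real m) + 2 * real_of_int c \<le> real e * (real e + 2 * real r + 3)"
    by simp
  then have "2 * real r \<le> real e * real e + 3 * real e - 2 * real_of_int c + 2 * (real e + 1) * real K
      - 2 * (real e + 1) * real e"
    unfolding rm by (simp add: algebra_simps)
  moreover have "0 \<le> (real e + 1) * real e" by simp
  moreover have "real r \<ge> real e * real e + 3 * real e + 2 * real (nat \<bar>c\<bar>) + 2 * (real e + 1) * real K + 1"
    by (simp add: r_def B_def algebra_simps)
  moreover have "- real_of_int c \<le> real (nat \<bar>c\<bar>)" by simp
  moreover have "0 \<le> real e * real e + 3 * real e + 2 * (real e + 1) * real K" by simp
  ultimately show False by linarith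
qed

end

subsection \<open>Linear coordinates\<close>

lemma forms_1_matrix:
  assumes "\<And>i. (\<lambda>v. L v $ i) \<in> forms 1"
  shows "\<exists>M :: complex^'n^'m. \<forall>v. M *v v = L v"
proof -
  have "\<exists>a. \<forall>v. L v $ i = (\<Sum>j\<in>UNIV. a j * v $ j)" for i
    using forms_1_sum[OF assms[of i]] by metis
  then obtain a where a: "\<And>i v. L v $ i = (\<Sum>j\<in>UNIV. a i j * v $ j)" by metis
  show ?thesis
    by (rule exI[of _ "\<chi> i j. a i j"]) (simp add: vec_eq_iff matrix_vector_mult_def a)
qed

lemma matrix_vector_scale: "M *v (c *s v) = c *s (M *v v)"
  for M :: "complex^'n^'m"
  by (simp add: vector_scalar_commute)

lemma image_span_singleton: "(\<lambda>v. M *v v) ` vec.span {v} = vec.span {M *v v}"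
  for M :: "complex^'n^'m"
  unfolding vec_span_singleton image_image matrix_vector_scale ..

text \<open>Four-space is the sum of the range of \<open>A\<close> and the line of \<open>u\<close>:
  \<open>A\<close> is a section of \<Xi>, and \<open>W\<close> reads off the component along
  \<open>u\<close>.\<close>

lemma projection_splitting:
  fixes \<Xi> :: "complex^4^3"
  assumes ker: "{v. \<Xi> *v v = 0} = vec.span {u}" and u: "u \<noteq> 0"
  obtains A :: "complex^3^4" and W where "\<And>x. \<Xi> *v (A *v x) = x" "W \<in> forms 1"
    "\<And>v. v = A *v (\<Xi> *v v) + W v *s u"
proof -
  have \<Xi>u: "\<Xi> *v u = 0" using ker vec.span_base[of u "{u}"] by auto
  obtain i where i: "u $ i \<noteq> 0" using u by (auto simp: vec_eq_iff)
  \<comment> \<open>The three coordinates of \<Xi> are completed by one that is nonzero at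
    \<open>u\<close>. This square system has trivial kernel, so it is invertible and \<Xi> is
    onto.\<close>
  define L :: "complex^4 \<Rightarrow> complex^4" where
    "L v = (\<chi> r. if r = 1 then (\<Xi> *v v) $ 1 else if r = 2 then (\<Xi> *v v) $ 2
      else if r = 3 then (\<Xi> *v v) $ 3 else v $ i)" for v
  have L: "L v $ 1 = (\<Xi> *v v) $ 1" "L v $ 2 = (\<Xi> *v v) $ 2" "L v $ 3 = (\<Xi> *v v) $ 3" "L v $ 4 = v $ i" for v
    by (simp_all add: L_def)
  have "(\<lambda>v. L v $ j) \<in> forms 1" for j
    using exhaust_4[of j] by (elim disjE) (simp_all add: L)
  from forms_1_matrix[OF this] obtain M :: "complex^4^4" where M: "\<And>v. M *v v = L v" by blast
  have "v = 0" if "M *v v = 0" for v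
  proof -
    have L0: "L v $ j = 0" for j using that by (simp add: M)
    have "\<Xi> *v v = 0" using L0[of 1] L0[of 2] L0[of 3] by (simp add: L vec_eq_iff forall_3)
    then obtain k where k: "v = k *s u" using ker by (auto simp: vec_span_singleton)
    then show "v = 0" using L0[of 4] i by (simp add: L)
  qed
  then have "\<exists>B. B ** M = mat 1" by (simp add: matrix_left_invertible_ker)
  then have "\<exists>B. M ** B = mat 1" using matrix_left_right_inverse by blast
  then have surjM: "surj ((*v) M)" by (simp add: matrix_right_invertible_surjective)
  have "\<exists>v. \<Xi> *v v = x" for x
  proof -
    define y :: "complex^4" where "y = (\<chi> r. if r = 1 then x $ 1 else if r = 2 then x $ 2
      else if r = 3 then x $ 3 else 0)"
    obtain v where "M *v v = y" using surjM by (metis surjD)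
    then have "L v $ r = y $ r" for r by (simp add: M)
    from this[of 1] this[of 2] this[of 3] have "\<Xi> *v v = x"
      unfolding L by (simp add: y_def vec_eq_iff forall_3)
    then show ?thesis by blast
  qed
  then have "surj ((*v) \<Xi>)" by (metis surjI)
  then obtain A where A: "\<Xi> ** A = mat 1" using matrix_right_invertible_surjective by blast
  have \<Xi>A: "\<Xi> *v (A *v x) = x" for x by (simp add: A matrix_vector_mul_assoc)
  define W where "W v = (1 / u $ i) * (v $ i - (A *v (\<Xi> *v v)) $ i)" for v
  have "(\<lambda>v. (A *v (\<Xi> *v v)) $ i) \<in> forms (Suc 0)"
    by (simp add: matrix_vector_mul_assoc)
  then have W: "W \<in> forms 1" unfolding W_def[abs_def] by (intro forms_scale forms_diff) simp_all
  have "v = A *v (\<Xi> *v v) + W v *s u" for v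
  proof -
    have "\<Xi> *v (v - A *v (\<Xi> *v v)) = 0" by (simp add: matrix_vector_mult_diff_distrib \<Xi>A)
    then obtain k where k: "v - A *v (\<Xi> *v v) = k *s u" using ker by (auto simp: vec_span_singleton)
    then have "v $ i - (A *v (\<Xi> *v v)) $ i = k * u $ i"
      by (metis vector_minus_component vector_smult_component)
    then have "W v = k" using i by (simp add: W_def)
    then show ?thesis using k by (metis add_diff_cancel_left' diff_add_cancel add.commute)
  qed
  with \<Xi>A W show thesis by (rule that)
qed

text \<open>Serves to move a point off the plane image curve to (0:0:1).\<close>

lemma move_axis:
  fixes w :: "complex^3"
  assumes "w \<noteq> 0"
  obtains P Q :: "complex^3^3" where "\<And>v. P *v (Q *v v) = v" "\<And>v. Q *v (P *v v) = v" "P *v axis 3 1 = w"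
proof -
  define e :: "complex^3" where "e = axis 3 1"
  have e3: "e $ 3 = 1" "\<And>i. i \<noteq> 3 \<Longrightarrow> e $ i = 0" by (auto simp: e_def axis_def)
  \<comment> \<open>The value 1 at \<open>e\<close> sends \<open>e\<close> to \<open>w\<close>; the
    nonzero value at \<open>w\<close> makes the reflection below invertible.\<close>
  obtain l where l: "l \<in> forms 1" "l e = 1" "l w \<noteq> 0"
  proof (cases "w $ 3 = 0")
    case True
    obtain i where "w $ i \<noteq> 0" using assms by (auto simp: vec_eq_iff)
    with True have i: "i \<noteq> 3" "w $ i \<noteq> 0" by auto
    have "(\<lambda>v::complex^3. v $ 3 + v $ i) \<in> forms 1" by auto
    then show thesis by (rule that) (use True i e3 in auto)
  next
    case False
    then show thesis by (intro that[of "\<lambda>v. v $ 3"]) (use e3 in auto)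
  qed
  text \<open>A complex reflection that maps \<open>e\<close> to \<open>w\<close>.\<close>
  define L where "L v = v - l v *s (e - w)" for v
  define R where "R v = v + (l v / l w) *s (e - w)" for v
  have "(\<lambda>v. v $ i - (e - w) $ i * l v) \<in> forms 1" for i using l(1) by auto
  then have "(\<lambda>v. L v $ i) \<in> forms 1" for i by (simp add: L_def algebra_simps)
  from forms_1_matrix[OF this] obtain P :: "complex^3^3" where P: "\<And>v. P *v v = L v" by blast
  have "R v $ i = v $ i + ((e - w) $ i / l w) * l v" for i v
    by (simp add: R_def diff_divide_distrib algebra_simps)
  moreover have "(\<lambda>v. v $ i + ((e - w) $ i / l w) * l v) \<in> forms 1" for i
    unfolding One_nat_def by (rule forms_add[OF forms_coord forms_scale[OF l(1)[unfolded One_nat_def]]])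
  ultimately have "(\<lambda>v. R v $ i) \<in> forms 1" for i by (simp only:)
  from forms_1_matrix[OF this] obtain Q :: "complex^3^3" where Q: "\<And>v. Q *v v = R v" by blast
  have lL: "l (L v) = l v * l w" for v
    unfolding L_def forms_1_diff[OF l(1)] forms_1_scale[OF l(1)] l(2) by (simp add: algebra_simps)
  have lR: "l (R v) = l v / l w" for v
    unfolding R_def forms_1_add[OF l(1)] forms_1_scale[OF l(1)] forms_1_diff[OF l(1)] l(2)
    using l(3) by (simp add: field_simps)
  show thesis
  proof (rule that)
    fix v
    show "P *v (Q *v v) = v" unfolding P Q L_def lR by (simp add: R_def)
    show "Q *v (P *v v) = v" unfolding P Q R_def lL using l(3) by (simp add: L_def)
  next
    show "P *v axis 3 1 = w" unfolding P e_def[symmetric] L_def by (simp add: l(2))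
  qed
qed

subsection \<open>Projections of the curve\<close>

lemma zclosed_separate:
  assumes Z: "zclosed Z" and v: "v \<noteq> 0" "vec.span {v} \<notin> Z"
  obtains m F where "F \<in> forms m" "F v \<noteq> 0" "\<And>w. w \<noteq> 0 \<Longrightarrow> F w \<noteq> 0 \<Longrightarrow> vec.span {w} \<notin> Z"
proof -
  obtain E where E: "E \<subseteq> (\<Union>k. forms k)" "Z = {p \<in> pspace. \<forall>F\<in>E. vanishes_on F {p}}"
    using Z by (auto simp: zclosed_def)
  have "vec.span {v} \<in> pspace" using v by (auto simp: pspace_def)
  then obtain F where F: "F \<in> E" "\<not> vanishes_on F {vec.span {v}}" using v E(2) by auto
  then obtain m where m: "F \<in> forms m" using E(1) by auto
  have "F v \<noteq> 0" using F(2) vanishes_on_span[OF m] by blast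
  moreover have "vec.span {w} \<notin> Z" if "w \<noteq> 0" "F w \<noteq> 0" for w
  proof
    assume "vec.span {w} \<in> Z"
    then have "vanishes_on F {vec.span {w}}" using E(2) F(1) by auto
    then show False using that by (auto simp: vanishes_on_def intro: vec.span_base)
  qed
  ultimately show thesis using that m by blast
qed

context space_curve
begin

text \<open>The rational inverse is locally a tuple \<open>G\<close> of plane forms with
  \<open>v\<close> proportional to \<open>G (\<Xi> *v v)\<close>. Clearing the unknown scalar
  expresses each coordinate on \<open>C\<close> as a plane form over one common denominator
  \<open>h\<close>.\<close>

lemma birational_projection_inverse:
  assumes q: "q \<in> pspace" "q \<notin> C" and bir: "birational_projection C q"
  obtains \<Xi> :: "complex^4^3" and k h where "{v. \<Xi> *v v = 0} = q" "h \<in> forms k"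
    "\<exists>v\<in>affine_cone C. h (\<Xi> *v v) \<noteq> 0"
    "\<And>i. \<exists>H\<in>forms (Suc k). \<forall>v\<in>affine_cone C. v $ i * h (\<Xi> *v v) = H (\<Xi> *v v)"
proof -
  have Cq: "C - {q} = C" using q by blast
  obtain \<Xi> :: "complex^4^3" where ker: "{v. \<Xi> *v v = 0} = q"
    and b: "birational_onto_image C (\<lambda>p. (\<lambda>v. \<Xi> *v v) ` p)"
    using bir unfolding birational_projection_def Cq by blast
  define f where "f p = (\<lambda>v. \<Xi> *v v) ` p" for p
  have fspan: "f (vec.span {v}) = vec.span {\<Xi> *v v}" for v
    by (simp add: f_def image_span_singleton)
  obtain X0 Y0 g where X0: "zopen_in C X0" "X0 \<noteq> {}" and fX: "f ` X0 = Y0"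
    and g: "regular_map Y0 g" and gf: "\<And>x. x \<in> X0 \<Longrightarrow> g (f x) = x"
  proof -
    have "birational_onto_image C f" using b unfolding f_def[abs_def] .
    then obtain X0 Y0 g where "zopen_in C X0 \<and> X0 \<noteq> {} \<and> zopen_in (zclosure (f ` C)) Y0 \<and>
        f ` X0 = Y0 \<and> regular_map X0 f \<and> regular_map Y0 g \<and> (\<forall>x\<in>X0. g (f x) = x)"
      unfolding birational_onto_image_def by (elim exE)
    then show thesis by (intro that[of X0 Y0 g]) simp_all
  qed
  have nz: "\<Xi> *v v \<noteq> 0" if "v \<in> affine_cone C" for v
  proof
    assume "\<Xi> *v v = 0"
    then have "v \<in> q" using ker by blast
    then have "q = vec.span {v}" using pspace_rep[OF q(1)] that by (auto simp: affine_cone_def)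
    then show False using span_in_C[OF that] q(2) by simp
  qed
  obtain Z0 where Z0: "zclosed Z0" "X0 = C - Z0" using X0(1) by (auto simp: zopen_in_def)
  obtain x0 where x0: "x0 \<in> X0" using X0(2) by blast
  then obtain v0 where v0: "v0 \<in> affine_cone C" "x0 = vec.span {v0}" "v0 \<noteq> 0"
    using cone_rep[of x0] Z0(2) by blast
  have "vec.span {v0} \<notin> Z0" using x0 v0(2) Z0(2) by blast
  \<comment> \<open>\<open>F0\<close>, and \<open>F1\<close> further down, cut out basic open
    neighbourhoods on which the inverse is given by \<open>G\<close>. Multiplying by them turns
    statements about open sets into identities of forms on all of \<open>C\<close>.\<close>
  then obtain a F0 where F0: "F0 \<in> forms a" "F0 v0 \<noteq> 0" "\<And>w. w \<noteq> 0 \<Longrightarrow> F0 w \<noteq> 0 \<Longrightarrow> vec.span {w} \<notin> Z0"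
    by (rule zclosed_separate[OF Z0(1) v0(3)]) (rule that)
  have "f x0 \<in> Y0" using x0 fX by blast
  then obtain N k and G :: "complex^3 \<Rightarrow> complex^4" where N: "zopen_in Y0 N" "f x0 \<in> N"
    and G: "\<And>i. (\<lambda>v. G v $ i) \<in> forms k"
    and gG: "\<And>z v. z \<in> N \<Longrightarrow> v \<in> z - {0} \<Longrightarrow> G v \<noteq> 0 \<and> g z = vec.span {G v}"
  proof -
    from bspec[OF g[unfolded regular_map_def] \<open>f x0 \<in> Y0\<close>]
    obtain N k and G :: "complex^3 \<Rightarrow> complex^4" where "zopen_in Y0 N \<and> f x0 \<in> N \<and>
        (\<forall>i. (\<lambda>v. G v $ i) \<in> forms k) \<and>
        (\<forall>z\<in>N. \<forall>v\<in>z - {0}. G v \<noteq> 0 \<and> g z = vec.span {G v})"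
      by (elim exE)
    then show thesis by (intro that[of N G k]) simp_all
  qed
  obtain Z1 where Z1: "zclosed Z1" "N = Y0 - Z1" using N(1) by (auto simp: zopen_in_def)
  have "vec.span {\<Xi> *v v0} \<notin> Z1" using N(2) v0(2) Z1(2) fspan[of v0] by simp
  then obtain b F1 where F1: "F1 \<in> forms b" "F1 (\<Xi> *v v0) \<noteq> 0"
      "\<And>w. w \<noteq> 0 \<Longrightarrow> F1 w \<noteq> 0 \<Longrightarrow> vec.span {w} \<notin> Z1"
    by (rule zclosed_separate[OF Z1(1) nz[OF v0(1)]]) (rule that)
  have parallel: "\<exists>t. v = t *s G (\<Xi> *v v)"
    if v: "v \<in> affine_cone C" "F0 v \<noteq> 0" "F1 (\<Xi> *v v) \<noteq> 0" for v
  proof -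
    have v0: "v \<noteq> 0" using v(1) by (simp add: affine_cone_def)
    have x: "vec.span {v} \<in> X0" using F0(3)[OF v0 v(2)] span_in_C[OF v(1)] Z0(2) by blast
    then have "vec.span {\<Xi> *v v} \<in> Y0" using fX fspan[of v] by (metis imageI)
    then have "vec.span {\<Xi> *v v} \<in> N" using F1(3)[OF nz[OF v(1)] v(3)] Z1(2) by blast
    moreover have "\<Xi> *v v \<in> vec.span {\<Xi> *v v} - {0}" using nz[OF v(1)] by (auto intro: vec.span_base)
    ultimately have "g (vec.span {\<Xi> *v v}) = vec.span {G (\<Xi> *v v)}" using gG by blast
    moreover have "g (vec.span {\<Xi> *v v}) = vec.span {v}" using gf[OF x] fspan[of v] by simp
    ultimately have "v \<in> vec.span {G (\<Xi> *v v)}" using vec.span_base[of v "{v}"] by auto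
    then show ?thesis by (auto simp: vec_span_singleton)
  qed
  obtain j where j: "(\<Xi> *v v0) $ j \<noteq> 0" using nz[OF v0(1)] by (auto simp: vec_eq_iff)
  \<comment> \<open>Applying \<Xi> to \<open>v = t *s G (\<Xi> *v v)\<close> and comparing
    coordinate \<open>j\<close> eliminates \<open>t\<close>.\<close>
  define h where "h x = (\<Xi> *v G x) $ j" for x
  have h: "h \<in> forms k"
    unfolding h_def[abs_def] matrix_vector_mult_def using G by (auto intro!: forms_sum)
  have rel: "v $ i * h (\<Xi> *v v) = G (\<Xi> *v v) $ i * (\<Xi> *v v) $ j" if v: "v \<in> affine_cone C" for v i
  proof -
    let ?D = "\<lambda>v. v $ i * h (\<Xi> *v v) - G (\<Xi> *v v) $ i * (\<Xi> *v v) $ j"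
    have "(\<lambda>v. G (\<Xi> *v v) $ i) \<in> forms k" using pullback_forms[OF G] .
    then have "(\<lambda>v. G (\<Xi> *v v) $ i * (\<Xi> *v v) $ j) \<in> forms (k + Suc 0)"
      by (intro forms_mult forms_matrix_coord)
    then have D: "?D \<in> forms (Suc k)"
      by (intro forms_diff forms_mult_coord pullback_forms[OF h]) simp
    have FF: "(\<lambda>v. F0 v * F1 (\<Xi> *v v)) \<in> forms (a + b)"
      by (intro forms_mult F0 pullback_forms F1)
    have "F0 v * F1 (\<Xi> *v v) * ?D v = 0" if v: "v \<in> affine_cone C" for v
    proof (cases "F0 v = 0 \<or> F1 (\<Xi> *v v) = 0")
      case False
      then obtain t where t: "v = t *s G (\<Xi> *v v)" using parallel[OF v] by blast
      then have "\<Xi> *v v = t *s (\<Xi> *v G (\<Xi> *v v))" by (metis matrix_vector_scale)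
      then have "(\<Xi> *v v) $ j = t * h (\<Xi> *v v)" unfolding h_def by (metis vector_smult_component)
      moreover have "v $ i = t * G (\<Xi> *v v) $ i" using t by (metis vector_smult_component)
      ultimately show ?thesis by simp
    qed auto
    \<comment> \<open>The identity holds where \<open>F0\<close> and \<open>F1\<close> are nonzero.
      Their product is nonzero at \<open>v0\<close>, so primality extends the identity to
      \<open>C\<close>.\<close>
    from vanish_prime[OF FF D this] have "\<forall>v\<in>affine_cone C. ?D v = 0"
      using v0(1) F0(2) F1(2) by auto
    then show ?thesis using v by auto
  qed
  have "h (\<Xi> *v v0) \<noteq> 0"
  proof -
    obtain t where "v0 = t *s G (\<Xi> *v v0)" using parallel[OF v0(1) F0(2) F1(2)] by blast
    then have "\<Xi> *v v0 = t *s (\<Xi> *v G (\<Xi> *v v0))" by (metis matrix_vector_scale)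
    then have "(\<Xi> *v v0) $ j = t * h (\<Xi> *v v0)" unfolding h_def by (metis vector_smult_component)
    then show ?thesis using j by auto
  qed
  show thesis
  proof (rule that[OF ker h])
    show "\<exists>v\<in>affine_cone C. h (\<Xi> *v v) \<noteq> 0" using \<open>h (\<Xi> *v v0) \<noteq> 0\<close> v0(1) by blast
    fix i
    have "(\<lambda>x. G x $ i * x $ j) \<in> forms (Suc k)"
      using forms_mult[OF G forms_coord[of j]] by simp
    then show "\<exists>H\<in>forms (Suc k). \<forall>v\<in>affine_cone C. v $ i * h (\<Xi> *v v) = H (\<Xi> *v v)"
      by (rule bexI[rotated]) (simp add: rel)
  qed
qed

end

section \<open>Projection in split coordinates and a uniform denominator\<close>

locale plane_projection = space_curve +
  fixes \<Xi> :: "complex^4^3" and A :: "complex^3^4" and u :: "complex^4" and W :: "complex^4 \<Rightarrow> complex"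
  assumes \<Xi>A: "\<Xi> *v (A *v x) = x" and \<Xi>u: "\<Xi> *v u = 0" and u: "u \<noteq> 0" and uC: "vec.span {u} \<notin> C"
    and W: "W \<in> forms 1" and splitting: "v = A *v (\<Xi> *v v) + W v *s u"
begin

text \<open>Agreement is asked for on the cone over \<open>C\<close> only, which allows work with
  representatives instead of their restrictions.\<close>

definition on_plane_ring :: "nat \<Rightarrow> (complex^4 \<Rightarrow> complex) \<Rightarrow> bool" where
  "on_plane_ring m F \<longleftrightarrow> (\<exists>G\<in>forms m. \<forall>v\<in>affine_cone C. F v = G (\<Xi> *v v))"

lemma on_plane_ring_add: "on_plane_ring m F \<Longrightarrow> on_plane_ring m G \<Longrightarrow> on_plane_ring m (\<lambda>v. F v + G v)"
  unfolding on_plane_ring_def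
proof (elim bexE)
  fix F' G' assume "F' \<in> forms m" "G' \<in> forms m" "\<forall>v\<in>affine_cone C. F v = F' (\<Xi> *v v)"
    "\<forall>v\<in>affine_cone C. G v = G' (\<Xi> *v v)"
  then show "\<exists>H\<in>forms m. \<forall>v\<in>affine_cone C. F v + G v = H (\<Xi> *v v)"
    by (intro bexI[of _ "\<lambda>v. F' v + G' v"]) auto
qed

lemma on_plane_ring_mult:
  "on_plane_ring a F \<Longrightarrow> on_plane_ring b G \<Longrightarrow> on_plane_ring (a + b) (\<lambda>v. F v * G v)"
  unfolding on_plane_ring_def
proof (elim bexE)
  fix F' G' assume "F' \<in> forms a" "G' \<in> forms b" "\<forall>v\<in>affine_cone C. F v = F' (\<Xi> *v v)"
    "\<forall>v\<in>affine_cone C. G v = G' (\<Xi> *v v)"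
  then show "\<exists>H\<in>forms (a + b). \<forall>v\<in>affine_cone C. F v * G v = H (\<Xi> *v v)"
    by (intro bexI[of _ "\<lambda>v. F' v * G' v"]) auto
qed

lemma on_plane_ring_scale: "on_plane_ring m F \<Longrightarrow> on_plane_ring m (\<lambda>v. t * F v)"
  unfolding on_plane_ring_def
proof (elim bexE)
  fix F' assume "F' \<in> forms m" "\<forall>v\<in>affine_cone C. F v = F' (\<Xi> *v v)"
  then show "\<exists>H\<in>forms m. \<forall>v\<in>affine_cone C. t * F v = H (\<Xi> *v v)"
    by (intro bexI[of _ "\<lambda>v. t * F' v"]) auto
qed

lemma on_plane_ring_pullback: "F \<in> forms m \<Longrightarrow> on_plane_ring m (\<lambda>v. F (\<Xi> *v v))"
  unfolding on_plane_ring_def by blast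

lemma on_plane_ring_cong:
  "on_plane_ring m F \<Longrightarrow> (\<And>v. v \<in> affine_cone C \<Longrightarrow> F v = G v) \<Longrightarrow> on_plane_ring m G"
  unfolding on_plane_ring_def by simp

lemma on_plane_ring_sum:
  "finite I \<Longrightarrow> (\<And>i. i \<in> I \<Longrightarrow> on_plane_ring m (F i)) \<Longrightarrow> on_plane_ring m (\<lambda>v. \<Sum>i\<in>I. F i v)"
proof (induction I rule: finite_induct)
  case empty
  then show ?case using on_plane_ring_pullback[of "\<lambda>_. 0" m] by simp
qed (simp add: on_plane_ring_add)

text \<open>The coordinates of \<open>\<Xi> *v v\<close> generate the ideal of the line through
  \<open>u\<close>, and \<open>W v *s u\<close> is the component of \<open>v\<close> on that line;
  so \<open>F\<close> is determined modulo this ideal by its value there.\<close>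

lemma vertex_decomp:
  assumes "F \<in> forms m"
  shows "\<exists>G. (\<forall>i. G i \<in> forms (m - 1)) \<and>
    (\<forall>v. F v = (\<Sum>i\<in>UNIV. (\<Xi> *v v) $ i * G i v) + F (W v *s u))"
  using assms
proof (induction rule: forms_induct)
  case (const c)
  show ?case by (rule exI[of _ "\<lambda>_ _. 0"]) simp
next
  case (mult_coord m F j)
  then obtain G where G: "\<And>i. G i \<in> forms (m - 1)"
    "\<And>v. F v = (\<Sum>i\<in>UNIV. (\<Xi> *v v) $ i * G i v) + F (W v *s u)" by blast
  have split_j: "v $ j = (\<Sum>i\<in>UNIV. A $ j $ i * (\<Xi> *v v) $ i) + W v * u $ j" for v
  proof -
    have "v $ j = (A *v (\<Xi> *v v) + W v *s u) $ j" using splitting[of v] by simp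
    then show ?thesis by (simp add: matrix_vector_mult_def[of A])
  qed
  \<comment> \<open>For \<open>m = 0\<close> the truncated degree puts \<open>G i\<close> in
    \<open>forms 0\<close>, and the second term would have degree 1. It is dropped, as a constant
    \<open>F\<close> already equals \<open>F (W v *s u)\<close>.\<close>
  define H where "H i v = A $ j $ i * F v + (if m = 0 then 0 else u $ j * (W v * G i v))" for i v
  have "H i \<in> forms m" for i
  proof (cases m)
    case 0
    then show ?thesis using mult_coord(1) by (auto simp: H_def[abs_def])
  next
    case (Suc k)
    have "(\<lambda>v. W v * G i v) \<in> forms m" using forms_mult[OF W G(1)[of i]] Suc by simp
    then show ?thesis using mult_coord(1) Suc by (auto simp: H_def[abs_def])
  qed
  moreover have "v $ j * F v = (\<Sum>i\<in>UNIV. (\<Xi> *v v) $ i * H i v) + (W v *s u) $ j * F (W v *s u)" for v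
  proof (cases m)
    case 0
    then have "F v = F (W v *s u)" using mult_coord(1) forms_0_const by metis
    then show ?thesis
      by (subst split_j) (simp add: H_def 0 algebra_simps sum_distrib_left sum_distrib_right)
  next
    case (Suc k)
    have "(\<Sum>i\<in>UNIV. (\<Xi> *v v) $ i * H i v)
        = (\<Sum>i\<in>UNIV. A $ j $ i * (\<Xi> *v v) $ i) * F v + W v * u $ j * (\<Sum>i\<in>UNIV. (\<Xi> *v v) $ i * G i v)"
      unfolding H_def using Suc
      by (simp add: distrib_left sum.distrib sum_distrib_left sum_distrib_right mult_ac)
    moreover have "v $ j * F v = (\<Sum>i\<in>UNIV. A $ j $ i * (\<Xi> *v v) $ i) * F v + W v * u $ j * F v"
      unfolding split_j[of v] by (rule distrib_right)
    moreover have "W v * u $ j * F v = W v * u $ j * ((\<Sum>i\<in>UNIV. (\<Xi> *v v) $ i * G i v) + F (W v *s u))"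
      by (rule arg_cong[OF G(2)])
    ultimately show ?thesis by (simp add: algebra_simps)
  qed
  ultimately show ?case by auto
next
  case (add m F1 F2)
  from add(3) obtain G1 where G1: "(\<forall>i. G1 i \<in> forms (m - 1)) \<and>
    (\<forall>v. F1 v = (\<Sum>i\<in>UNIV. (\<Xi> *v v) $ i * G1 i v) + F1 (W v *s u))" by (elim exE)
  from add(4) obtain G2 where G2: "(\<forall>i. G2 i \<in> forms (m - 1)) \<and>
    (\<forall>v. F2 v = (\<Sum>i\<in>UNIV. (\<Xi> *v v) $ i * G2 i v) + F2 (W v *s u))" by (elim exE)
  show ?case
  proof (intro exI[of _ "\<lambda>i v. G1 i v + G2 i v"] conjI allI)
    fix i show "(\<lambda>v. G1 i v + G2 i v) \<in> forms (m - 1)" using G1 G2 by (intro forms_add) simp_all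
  next
    fix v
    show "F1 v + F2 v = (\<Sum>i\<in>UNIV. (\<Xi> *v v) $ i * (G1 i v + G2 i v)) + (F1 (W v *s u) + F2 (W v *s u))"
      using spec[OF conjunct2[OF G1], of v] spec[OF conjunct2[OF G2], of v]
      by (simp only: distrib_left sum.distrib ac_simps)
  qed
next
  case (scale m F c)
  from scale(2) obtain G where G: "(\<forall>i. G i \<in> forms (m - 1)) \<and>
    (\<forall>v. F v = (\<Sum>i\<in>UNIV. (\<Xi> *v v) $ i * G i v) + F (W v *s u))" by (elim exE)
  show ?case
  proof (intro exI[of _ "\<lambda>i v. c * G i v"] conjI allI)
    fix i show "(\<lambda>v. c * G i v) \<in> forms (m - 1)" using G by (intro forms_scale) simp
  next
    fix v
    have "c * F v = c * ((\<Sum>i\<in>UNIV. (\<Xi> *v v) $ i * G i v) + F (W v *s u))"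
      by (rule arg_cong[OF spec[OF conjunct2[OF G]]])
    then show "c * F v = (\<Sum>i\<in>UNIV. (\<Xi> *v v) $ i * (c * G i v)) + c * F (W v *s u)"
      by (simp only: distrib_left sum_distrib_left mult.left_commute)
  qed
qed

text \<open>Since the vertex of the projection does not lie on the curve, \<open>W\<close> is integral over the ring of the plane
  image, so that a fixed power of the common denominator \<open>h\<close> suffices in all degrees.\<close>

lemma conductor:
  assumes h: "h \<in> forms k" "\<And>i. on_plane_ring (Suc k) (\<lambda>v. v $ i * h (\<Xi> *v v))"
  obtains N where "\<And>m F. F \<in> forms m \<Longrightarrow> on_plane_ring (m + N * k) (\<lambda>v. h (\<Xi> *v v) ^ N * F v)"
proof -
  \<comment> \<open>\<open>E\<close> vanishes on \<open>C\<close> but not at \<open>u\<close>.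
    Decomposed at the vertex, it is an equation for \<open>W\<close> of degree \<open>N\<close> with
    the nonzero constant \<open>E u\<close> as leading coefficient.\<close>
  obtain N E where E: "E \<in> forms N" "E u \<noteq> 0" "\<And>w. w \<noteq> 0 \<Longrightarrow> E w \<noteq> 0 \<Longrightarrow> vec.span {w} \<notin> C"
    by (rule zclosed_separate[OF closed u uC]) (rule that)
  have EC: "E v = 0" if "v \<in> affine_cone C" for v
    using E(3)[of v] span_in_C[OF that] that by (auto simp: affine_cone_def)
  have N: "N \<noteq> 0"
  proof
    assume "N = 0"
    obtain w where "w \<in> affine_cone C" using cone_nonempty by blast
    then have "E w = 0" by (rule EC)
    then show False using E(1,2) forms_0_const[of E] unfolding \<open>N = 0\<close> by metis
  qed
  obtain EE where EE: "\<And>i. EE i \<in> forms (N - 1)"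
    "\<And>v. E v = (\<Sum>i\<in>UNIV. (\<Xi> *v v) $ i * EE i v) + E (W v *s u)"
    using vertex_decomp[OF E(1)] by blast
  have hp: "on_plane_ring (l * k) (\<lambda>v. h (\<Xi> *v v) ^ l)" for l
    using on_plane_ring_pullback[OF forms_power[OF h(1), of l]] .
  \<comment> \<open>One factor \<open>h\<close> for each coordinate suffices. The exponent grows
    with the degree, which is harmless up to degree \<open>N\<close>.\<close>
  have low: "on_plane_ring (m + m * k) (\<lambda>v. h (\<Xi> *v v) ^ m * F v)" if "F \<in> forms m" for m F
    using that
  proof (induction rule: forms_induct)
    case (const c)
    show ?case using on_plane_ring_pullback[of "\<lambda>_. c" 0] by simp
  next
    case (mult_coord m F i)
    have "on_plane_ring (Suc k + (m + m * k)) (\<lambda>v. (v $ i * h (\<Xi> *v v)) * (h (\<Xi> *v v) ^ m * F v))"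
      by (intro on_plane_ring_mult h mult_coord)
    then show ?case by (simp add: mult_ac add_ac)
  next
    case (add m F G)
    from on_plane_ring_add[OF add(3,4)] show ?case by (simp add: distrib_left)
  next
    case (scale m F c)
    from on_plane_ring_scale[OF scale(2), of c] show ?case by (simp add: mult_ac)
  qed
  have "on_plane_ring (m + N * k) (\<lambda>v. h (\<Xi> *v v) ^ N * F v)" if "F \<in> forms m" for m F
    using that
  proof (induction m arbitrary: F)
    case 0
    have "on_plane_ring (N * k + 0) (\<lambda>v. h (\<Xi> *v v) ^ N * (h (\<Xi> *v v) ^ 0 * F v))"
      using on_plane_ring_mult[OF hp[of N] low[OF 0]] by simp
    then show ?case by simp
  next
    case (Suc m F)
    show ?case
    proof (cases "Suc m \<le> N")
      case True
      have "on_plane_ring ((N - Suc m) * k + (Suc m + Suc m * k))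
          (\<lambda>v. h (\<Xi> *v v) ^ (N - Suc m) * (h (\<Xi> *v v) ^ Suc m * F v))"
        by (intro on_plane_ring_mult hp low Suc.prems)
      moreover have "(N - Suc m) * k + (Suc m + Suc m * k) = Suc m + N * k"
        using True by (metis add.left_commute add_mult_distrib le_add_diff_inverse2)
      moreover have "h x ^ (N - Suc m) * (h x ^ Suc m * y) = h x ^ N * y" for x y
        using True by (metis le_add_diff_inverse2 mult.assoc power_add)
      ultimately show ?thesis by (simp only:)
    next
      case False
      obtain G where G: "\<And>i. G i \<in> forms m"
        "\<And>v. F v = (\<Sum>i\<in>UNIV. (\<Xi> *v v) $ i * G i v) + F (W v *s u)"
        using vertex_decomp[OF Suc.prems] by auto
      \<comment> \<open>A multiple of \<open>W ^ (Suc m - N) * E\<close>, zero on \<open>C\<close>,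
        is subtracted to remove the term in \<open>W ^ Suc m\<close>. What remains is a combination
        of plane coordinates with coefficients of degree \<open>m\<close>, to which the induction
        hypothesis applies.\<close>
      define G' where "G' i v = G i v - (F u / E u) * (W v ^ (Suc m - N) * EE i v)" for i v
      have "(\<lambda>v. W v ^ (Suc m - N) * EE i v) \<in> forms ((Suc m - N) * 1 + (N - 1))" for i
        by (intro forms_mult forms_power W EE)
      then have "(\<lambda>v. W v ^ (Suc m - N) * EE i v) \<in> forms m" for i using False N by simp
      then have G': "G' i \<in> forms m" for i unfolding G'_def[abs_def]
        by (intro forms_diff forms_scale G(1))
      have FG: "F v = (\<Sum>i\<in>UNIV. (\<Xi> *v v) $ i * G' i v)" if "v \<in> affine_cone C" for v
      proof -
        let ?s = "\<Sum>i\<in>UNIV. (\<Xi> *v v) $ i * EE i v"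
        have "?s + W v ^ N * E u = 0"
          using EC[OF that] EE(2)[of v] forms_homogeneous[OF E(1), of "W v" u] by simp
        then have "?s = - (W v ^ N * E u)" by (simp add: eq_neg_iff_add_eq_0)
        then have "(F u / E u) * (W v ^ (Suc m - N) * ?s) = - (F u * (W v ^ (Suc m - N) * W v ^ N))"
          using E(2) by simp
        also have "W v ^ (Suc m - N) * W v ^ N = W v ^ Suc m"
          using False by (simp flip: power_add)
        finally have "(F u / E u) * (W v ^ (Suc m - N) * ?s) = - F (W v *s u)"
          using forms_homogeneous[OF Suc.prems, of "W v" u] by (simp add: mult.commute)
        moreover have "(\<Sum>i\<in>UNIV. (\<Xi> *v v) $ i * G' i v)
            = (\<Sum>i\<in>UNIV. (\<Xi> *v v) $ i * G i v) - (F u / E u) * (W v ^ (Suc m - N) * ?s)"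
          unfolding G'_def right_diff_distrib sum_subtractf sum_distrib_left by (simp add: mult_ac)
        ultimately show ?thesis using G(2)[of v] by simp
      qed
      have "on_plane_ring (1 + (m + N * k)) (\<lambda>v. (\<Xi> *v v) $ i * (h (\<Xi> *v v) ^ N * G' i v))" for i
        using on_plane_ring_pullback[OF forms_coord[of i]]
        by (intro on_plane_ring_mult Suc.IH G') simp
      then have "on_plane_ring (Suc m + N * k) (\<lambda>v. \<Sum>i\<in>UNIV. (\<Xi> *v v) $ i * (h (\<Xi> *v v) ^ N * G' i v))"
        by (intro on_plane_ring_sum) simp_all
      then show ?thesis
        by (rule on_plane_ring_cong) (simp add: FG sum_distrib_left mult_ac)
    qed
  qed
  then show thesis by (rule that)
qed

end

context space_curve
begin

text \<open>Birationality enters through the bound \<open>d \<le> e\<close>; the opposite bound is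
  general. The plane coordinates are then adjusted so that the image avoids \<open>axis 3 1\<close>,
  as the descent requires.\<close>

lemma good_projection:
  assumes q: "q \<in> pspace" "q \<notin> C" and bir: "birational_projection C q"
  obtains \<Xi> A u W f where "plane_projection C d c \<Xi> A u W" "q = vec.span {u}"
    "f \<in> plane_ideal \<Xi> d" "f (axis 3 1) \<noteq> 0"
    "generates \<Xi> d f"
proof -
  obtain u where u: "u \<noteq> 0" "q = vec.span {u}" using q(1) by (auto simp: pspace_def)
  obtain \<Xi>0 :: "complex^4^3" and k h where ker0: "{v. \<Xi>0 *v v = 0} = q" and h: "h \<in> forms k"
    "\<exists>v\<in>affine_cone C. h (\<Xi>0 *v v) \<noteq> 0"
    "\<And>i. \<exists>H\<in>forms (Suc k). \<forall>v\<in>affine_cone C. v $ i * h (\<Xi>0 *v v) = H (\<Xi>0 *v v)"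
    by (rule birational_projection_inverse[OF q bir]) (rule that)
  have ker_u: "\<Xi> *v u = 0" if "{v. \<Xi> *v v = 0} = q" for \<Xi> :: "complex^4^3"
  proof -
    have "u \<in> q" unfolding u(2) by (intro vec.span_base) simp
    then show ?thesis using that by blast
  qed
  have proj: "plane_projection C d c \<Xi> A u W"
    if "{v. \<Xi> *v v = 0} = q" "\<And>x. \<Xi> *v (A *v x) = x" "W \<in> forms 1"
      "\<And>v. v = A *v (\<Xi> *v v) + W v *s u" for \<Xi> A W
    by (intro plane_projection.intro plane_projection_axioms.intro space_curve_axioms that ker_u u)
       (use q u in simp)
  obtain A0 W0 where A0: "\<And>x. \<Xi>0 *v (A0 *v x) = x" "W0 \<in> forms 1"
    "\<And>v. v = A0 *v (\<Xi>0 *v v) + W0 v *s u"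
    by (rule projection_splitting[OF ker0[unfolded u(2)] u(1)]) (rule that)
  interpret P0: plane_projection C d c \<Xi>0 A0 u W0 by (rule proj[OF ker0 A0])
  have surj0: "\<exists>v. \<Xi>0 *v v = x" for x using A0(1) by blast
  obtain e f0 where f0: "f0 \<in> plane_ideal \<Xi>0 e" "\<exists>v. f0 v \<noteq> 0"
    and pr0: "generates \<Xi>0 e f0"
    by (rule plane_ideal_principal[OF surj0]) (rule that)
  have "P0.on_plane_ring (Suc k) (\<lambda>v. v $ i * h (\<Xi>0 *v v))" for i
    unfolding P0.on_plane_ring_def by (rule h(3))
  then obtain N where N: "\<And>m F. F \<in> forms m \<Longrightarrow> P0.on_plane_ring (m + N * k) (\<lambda>v. h (\<Xi>0 *v v) ^ N * F v)"
    by (rule P0.conductor[OF h(1)]) (rule that)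
  have "d \<le> e"
  proof (rule plane_degree_ge[OF f0 pr0 forms_power[OF h(1)]])
    show "\<exists>v\<in>affine_cone C. h (\<Xi>0 *v v) ^ N \<noteq> 0" using h(2) by auto
    fix m and F :: "complex^4 \<Rightarrow> complex" assume "F \<in> forms m"
    from N[OF this] show "\<exists>G\<in>forms (m + N * k). \<forall>v\<in>affine_cone C. h (\<Xi>0 *v v) ^ N * F v = G (\<Xi>0 *v v)"
      unfolding P0.on_plane_ring_def .
  qed
  with plane_degree_le[OF f0 pr0] have e: "e = d" by simp
  have f0f: "f0 \<in> forms d" using f0(1) by (simp add: plane_ideal_def e)
  obtain w where w: "f0 w \<noteq> 0" using f0(2) by blast
  \<comment> \<open>A form is nonzero at the origin only in degree 0, where it would be a nonzero
    constant vanishing on the image.\<close>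
  have "w \<noteq> 0"
  proof
    assume "w = 0"
    obtain v where v: "v \<in> affine_cone C" using cone_nonempty by blast
    have "d = 0" using forms_at_0[OF f0f] w \<open>w = 0\<close> by auto
    then have "f0 (\<Xi>0 *v v) = f0 w" using f0f forms_0_const by metis
    then show False using f0(1) v w by (simp add: plane_ideal_def)
  qed
  then obtain P Q :: "complex^3^3" where PQ: "\<And>v. P *v (Q *v v) = v" "\<And>v. Q *v (P *v v) = v"
    "P *v axis 3 1 = w"
    by (rule move_axis) (rule that)
  \<comment> \<open>Composing with \<open>Q\<close> keeps the kernel \<open>q\<close> and turns the
    equation into \<open>f0\<close> composed with \<open>P\<close>, whose value at
    \<open>axis 3 1\<close> is \<open>f0 w\<close>.\<close>
  define \<Xi> where "\<Xi> = Q ** \<Xi>0"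
  have \<Xi>: "\<Xi> *v v = Q *v (\<Xi>0 *v v)" for v by (simp add: \<Xi>_def matrix_vector_mul_assoc)
  have "\<Xi> *v v = 0 \<longleftrightarrow> \<Xi>0 *v v = 0" for v
    unfolding \<Xi> by (metis PQ(1) matrix_vector_mult_0_right)
  then have ker: "{v. \<Xi> *v v = 0} = q" using ker0 by simp
  obtain A W where A: "\<And>x. \<Xi> *v (A *v x) = x" "W \<in> forms 1" "\<And>v. v = A *v (\<Xi> *v v) + W v *s u"
    by (rule projection_splitting[OF ker[unfolded u(2)] u(1)]) (rule that)
  show thesis
  proof (rule that[OF proj[OF ker A] u(2)])
    show "(\<lambda>x. f0 (P *v x)) \<in> plane_ideal \<Xi> d"
      using f0(1) pullback_forms[OF f0f] by (simp add: plane_ideal_def \<Xi> PQ e)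
    show "f0 (P *v axis 3 1) \<noteq> 0" using w by (simp add: PQ)
    show "generates \<Xi> d (\<lambda>x. f0 (P *v x))" unfolding generates_def
    proof (intro allI ballI)
      fix m g assume g: "g \<in> plane_ideal \<Xi> m"
      then have gf: "g \<in> forms m" by (simp add: plane_ideal_def)
      have "(\<lambda>x. g (Q *v x)) \<in> plane_ideal \<Xi>0 m"
        using g pullback_forms[OF gf] by (simp add: plane_ideal_def \<Xi>)
      from generatesD[OF pr0 this] show "(\<forall>v. g v = 0) \<or> (\<exists>r. m = d + r \<and> (\<exists>q\<in>forms r. \<forall>v. g v = f0 (P *v v) * q v))"
      proof
        assume "\<forall>v. g (Q *v v) = 0"
        then show ?thesis by (metis PQ(2))
      next
        assume "\<exists>r. m = e + r \<and> (\<exists>q\<in>forms r. \<forall>v. g (Q *v v) = f0 v * q v)"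
        then obtain r q where r: "m = d + r" "q \<in> forms r" "\<And>v. g (Q *v v) = f0 v * q v" unfolding e by blast
        have "g v = f0 (P *v v) * q (P *v v)" for v using r(3)[of "P *v v"] by (simp add: PQ)
        with pullback_forms[OF r(2), of P] r(1) show ?thesis
          by (intro disjI2 exI[of _ r] conjI bexI[of _ "\<lambda>v. q (P *v v)"]) simp_all
      qed
    qed
  qed
qed

end

subsection \<open>Cones with vertex near the given one\<close>

lemma forms_prod:
  "(\<And>i. i < d \<Longrightarrow> L i \<in> forms 1) \<Longrightarrow> (\<lambda>x. \<Prod>i<d. L i x) \<in> forms d"
proof (induction d)
  case (Suc d)
  then have "(\<lambda>x. (\<Prod>i<d. L i x) * L d x) \<in> forms (d + 1)" by (intro forms_mult) auto
  then show ?case by simp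
qed simp

text \<open>Cones are defined through products of linear forms; since monomials are such products,
  the cones are the pullbacks of all ternary forms.\<close>

lemma forms_span_prod:
  "F \<in> forms d \<Longrightarrow> F \<in> cfun.span {(\<lambda>x. \<Prod>i<d. L i x) | L. \<forall>i<d. L i \<in> forms 1}"
proof (induction rule: forms_induct)
  case (const c)
  \<comment> \<open>In degree 0 the product is empty, so its factors may be arbitrary.\<close>
  have "(\<lambda>_. c) = cfun_scale c (\<lambda>x :: complex^'a. \<Prod>i<0. (undefined :: nat \<Rightarrow> complex^'a \<Rightarrow> complex) i x)"
    by (simp add: cfun_scale_def)
  then show ?case by (simp only:) (intro cfun.span_scale cfun.span_base, auto)
next
  case (mult_coord m F j)
  let ?S = "\<lambda>d. {(\<lambda>x. \<Prod>i<d. L i x) | L. \<forall>i<d. L i \<in> (forms 1 :: (complex^'a \<Rightarrow> complex) set)}"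
  have "cfun.span (?S m) \<subseteq> {F. (\<lambda>v. v $ j * F v) \<in> cfun.span (?S (Suc m))}"
  proof (rule cfun.span_minimal, rule subsetI)
    fix F assume "F \<in> ?S m"
    then obtain L where L: "F = (\<lambda>x. \<Prod>i<m. L i x)" "\<forall>i<m. L i \<in> forms 1" by blast
    have "(\<lambda>v. v $ j * F v) = (\<lambda>x. \<Prod>i<Suc m. (L(m := \<lambda>v. v $ j)) i x)"
      unfolding L(1) by (simp add: mult.commute)
    moreover have "\<forall>i<Suc m. (L(m := \<lambda>v. v $ j)) i \<in> forms 1" using L(2) by (auto simp: less_Suc_eq)
    ultimately show "F \<in> {F. (\<lambda>v. v $ j * F v) \<in> cfun.span (?S (Suc m))}"
      unfolding mem_Collect_eq by (intro cfun.span_base) blast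
  next
    show "cfun.subspace {F. (\<lambda>v. v $ j * F v) \<in> cfun.span (?S (Suc m))}"
      unfolding cfun.subspace_def
    proof (intro conjI ballI allI)
      show "0 \<in> {F. (\<lambda>v. v $ j * F v) \<in> cfun.span (?S (Suc m))}"
        using cfun.span_zero[of "?S (Suc m)"] by (simp add: zero_fun_def)
      fix F G assume FG: "F \<in> {F. (\<lambda>v. v $ j * F v) \<in> cfun.span (?S (Suc m))}"
        "G \<in> {F. (\<lambda>v. v $ j * F v) \<in> cfun.span (?S (Suc m))}"
      have "(\<lambda>v. v $ j * (F + G) v) = (\<lambda>v. v $ j * F v) + (\<lambda>v. v $ j * G v)"
        by (simp add: fun_eq_iff distrib_left)
      with FG show "F + G \<in> {F. (\<lambda>v. v $ j * F v) \<in> cfun.span (?S (Suc m))}"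
        unfolding mem_Collect_eq by (simp only: cfun.span_add)
    next
      fix a F assume F: "F \<in> {F. (\<lambda>v. v $ j * F v) \<in> cfun.span (?S (Suc m))}"
      have "(\<lambda>v. v $ j * (cfun_scale a F) v) = cfun_scale a (\<lambda>v. v $ j * F v)"
        by (simp add: fun_eq_iff cfun_scale_def mult.left_commute)
      with F show "cfun_scale a F \<in> {F. (\<lambda>v. v $ j * F v) \<in> cfun.span (?S (Suc m))}"
        unfolding mem_Collect_eq by (simp only: cfun.span_scale)
    qed
  qed
  then show ?case using mult_coord(2) by blast
next
  case (add m F G)
  from cfun.span_add[OF add(3,4)] show ?case by (simp add: plus_fun_def)
next
  case (scale m F c)
  have "(\<lambda>v. c * F v) = cfun_scale c F" by (simp add: cfun_scale_def)
  with cfun.span_scale[OF scale(2), of c] show ?case by (simp only:)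
qed

context plane_projection
begin

lemma surj: "\<exists>v. \<Xi> *v v = x"
  using \<Xi>A by blast

lemma Wu: "W u = 1"
proof -
  have "u = W u *s u" using splitting[of u] by (simp add: \<Xi>u)
  then have "u $ i = W u * u $ i" for i by (metis vector_smult_component)
  moreover obtain i where "u $ i \<noteq> 0" using u by (auto simp: vec_eq_iff)
  ultimately show ?thesis by (metis mult_cancel_right1)
qed

lemma WA: "W (A *v x) = 0"
proof -
  have "A *v x = A *v x + W (A *v x) *s u" using splitting[of "A *v x"] by (simp add: \<Xi>A)
  then have "W (A *v x) *s u = 0" by simp
  then show ?thesis using u by simp
qed

text \<open>The projection from \<open>u + A *v t\<close>, normalised to invert \<open>A\<close> for
  every \<open>t\<close>. The target plane stays fixed and the dependence on \<open>t\<close> is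
  affine.\<close>

definition proj_at :: "complex^3 \<Rightarrow> complex^4 \<Rightarrow> complex^3" where
  "proj_at t v = \<Xi> *v v - W v *s t"

lemma proj_at_0: "proj_at 0 v = \<Xi> *v v"
  by (simp add: proj_at_def)

lemma proj_at_coord: "(\<lambda>v. proj_at t v $ i) \<in> forms 1"
proof -
  have "(\<lambda>v. (\<Xi> *v v) $ i - t $ i * W v) \<in> forms (Suc 0)"
    using W by (intro forms_diff forms_scale forms_matrix_coord) simp
  then show ?thesis by (simp add: proj_at_def mult.commute)
qed

lemma proj_at_matrix: "\<exists>M :: complex^4^3. \<forall>v. M *v v = proj_at t v"
  by (rule forms_1_matrix[OF proj_at_coord])

lemma proj_at_vertex: "proj_at t (u + A *v t) = 0"
  by (simp add: proj_at_def forms_1_add[OF W] Wu WA matrix_vector_right_distrib \<Xi>u \<Xi>A)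

lemma proj_at_A: "proj_at t (A *v x) = x"
  by (simp add: proj_at_def WA \<Xi>A)

lemma splitting_at: "v = A *v (proj_at t v) + W v *s (u + A *v t)"
proof -
  have "A *v (proj_at t v) = A *v (\<Xi> *v v) - W v *s (A *v t)"
    by (simp add: proj_at_def matrix_vector_mult_diff_distrib matrix_vector_scale)
  then show ?thesis using splitting[of v] by (simp add: vector_add_ldistrib)
qed

text \<open>A linear form vanishing at the vertex is determined by its restriction to the range of
  \<open>A\<close>, so it is the pullback of a linear form of the plane along
  \<open>proj_at t\<close>. Products and spans follow.\<close>

lemma cone_forms_eq: "cone_forms (affine_chart u A t) k = (\<lambda>F v. F (proj_at t v)) ` forms k"
proof -
  let ?V = "linear_forms_vanishing_at (affine_chart u A t)"
  let ?w = "u + A *v t"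
  have w: "?w \<noteq> 0"
  proof
    assume "?w = 0"
    then have "W ?w = 0" using forms_at_0[OF W] by simp
    then show False by (simp add: forms_1_add[OF W] Wu WA)
  qed
  have V: "L \<in> ?V \<longleftrightarrow> L \<in> forms 1 \<and> L ?w = 0" for L
  proof -
    have "vanishes_on L {vec.span {?w}} \<longleftrightarrow> L ?w = 0" if "L \<in> forms 1"
    proof
      assume "vanishes_on L {vec.span {?w}}"
      then show "L ?w = 0" using w by (auto simp: vanishes_on_def intro: vec.span_base)
    qed (rule vanishes_on_span[OF that])
    then show ?thesis by (auto simp: linear_forms_vanishing_at_def affine_chart_def)
  qed
  have lin: "cfun_linear (\<lambda>(F :: complex^3 \<Rightarrow> complex) v. F (proj_at t v))"
    by (rule cfun_linearI) (auto simp: cfun_scale_def fun_eq_iff)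
  interpret pb: Vector_Spaces.linear cfun_scale cfun_scale "\<lambda>(F :: complex^3 \<Rightarrow> complex) v. F (proj_at t v)"
    by (rule lin)
  let ?S = "{(\<lambda>x. \<Prod>i<k. L i x) | L. \<forall>i<k. L i \<in> (forms 1 :: (complex^3 \<Rightarrow> complex) set)}"
  have span_S: "cfun.span ?S = forms k"
  proof
    show "cfun.span ?S \<subseteq> forms k"
      by (rule cfun.span_minimal[OF _ forms_subspace]) (auto intro: forms_prod)
    show "forms k \<subseteq> cfun.span ?S" using forms_span_prod by blast
  qed
  have "{(\<lambda>x. \<Prod>i<k. L i x) | L. \<forall>i<k. L i \<in> ?V} = (\<lambda>F v. F (proj_at t v)) ` ?S"
  proof (intro equalityI subsetI)
    fix F assume "F \<in> {(\<lambda>x. \<Prod>i<k. L i x) | L. \<forall>i<k. L i \<in> ?V}"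
    then obtain L where L: "F = (\<lambda>x. \<Prod>i<k. L i x)" "\<forall>i<k. L i \<in> ?V" by blast
    define L' where "L' i x = L i (A *v x)" for i x
    have "L' i \<in> forms 1" if "i < k" for i
      unfolding L'_def[abs_def] by (rule pullback_forms) (use L(2) that V in blast)
    moreover have "L i v = L' i (proj_at t v)" if "i < k" for i v
    proof -
      have Li: "L i \<in> forms 1" "L i ?w = 0" using L(2) that V by auto
      have "L i v = L i (A *v (proj_at t v) + W v *s ?w)" using splitting_at[of v t] by simp
      also have "\<dots> = L i (A *v proj_at t v) + W v * L i ?w"
        by (simp only: forms_1_add[OF Li(1), of "A *v proj_at t v"] forms_1_scale[OF Li(1)])
      also have "\<dots> = L' i (proj_at t v)" by (simp add: Li(2) L'_def)
      finally show ?thesis .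
    qed
    ultimately show "F \<in> (\<lambda>F v. F (proj_at t v)) ` ?S"
      unfolding L(1) by (intro image_eqI[of _ _ "\<lambda>x. \<Prod>i<k. L' i x"]) auto
  next
    fix F assume "F \<in> (\<lambda>F v. F (proj_at t v)) ` ?S"
    then obtain L where L: "F = (\<lambda>v. \<Prod>i<k. L i (proj_at t v))" "\<forall>i<k. L i \<in> forms 1" by auto
    have "(\<lambda>v. L i (proj_at t v)) \<in> ?V" if "i < k" for i
    proof -
      have Li: "L i \<in> forms 1" using L(2) that by blast
      then show ?thesis
        unfolding V using forms_compose_linear[OF Li proj_at_coord] proj_at_vertex forms_at_0[OF Li] by simp
    qed
    then show "F \<in> {(\<lambda>x. \<Prod>i<k. L i x) | L. \<forall>i<k. L i \<in> ?V}"
      unfolding L(1) by (intro CollectI exI[of _ "\<lambda>i v. L i (proj_at t v)"]) auto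
  qed
  then have "cone_forms (affine_chart u A t) k = cfun.span ((\<lambda>F v. F (proj_at t v)) ` ?S)"
    by (simp only: cone_forms_def)
  also have "\<dots> = (\<lambda>F v. F (proj_at t v)) ` forms k"
    unfolding pb.span_image span_S ..
  finally show ?thesis .
qed

text \<open>Presents the moving subspace as the image of one fixed space of ternary forms under a
  linear map that depends on \<open>t\<close>.\<close>

definition \<Phi> :: "complex^3 \<Rightarrow> (complex^3 \<Rightarrow> complex) \<Rightarrow> complex^4 \<Rightarrow> complex" where
  "\<Phi> t F = restrict_to C (\<lambda>v. F (proj_at t v))"

lemma cone_map_eq: "cone_map C k (affine_chart u A t) = \<Phi> t ` forms k"
  by (simp add: cone_map_def cone_forms_eq \<Phi>_def image_image)

lemma \<Phi>_linear: "cfun_linear (\<Phi> t)"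
  unfolding \<Phi>_def by (rule pullback_linear)

lemma \<Phi>_forms: "F \<in> forms k \<Longrightarrow> \<Phi> t F \<in> restrict_to C ` forms k"
  unfolding \<Phi>_def using forms_compose_linear[OF _ proj_at_coord] by blast

lemma \<Phi>_eq_0: "\<Phi> t F = 0 \<longleftrightarrow> (\<forall>v\<in>affine_cone C. F (proj_at t v) = 0)"
  by (simp add: \<Phi>_def restrict_to_eq_0_iff)

text \<open>The equation of the image may have degree \<open>e\<close> below \<open>d\<close>.
  Multiplication by a power of a coordinate raises it to degree \<open>d\<close>.\<close>

lemma relation_at:
  obtains F where "F \<in> forms d" "\<Phi> t F = 0" "\<exists>v. F v \<noteq> 0"
proof -
  obtain M :: "complex^4^3" where M: "\<And>v. M *v v = proj_at t v" using proj_at_matrix by blast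
  have "\<exists>v. M *v v = x" for x unfolding M using proj_at_A by blast
  then obtain e f where f: "f \<in> plane_ideal M e" "\<exists>v. f v \<noteq> 0"
    and pr: "generates M e f"
    by (rule plane_ideal_principal) (rule that)
  have ed: "e \<le> d" by (rule plane_degree_le[OF f pr])
  have ff: "f \<in> forms e" using f by (simp add: plane_ideal_def)
  have power: "(\<lambda>v::complex^3. (v $ 1) ^ (d - e)) \<in> forms ((d - e) * Suc 0)"
    by (intro forms_power forms_coord)
  have "(\<lambda>v. f v * (v $ 1) ^ (d - e)) \<in> forms (e + (d - e) * Suc 0)"
    by (rule forms_mult[OF ff power])
  then have F: "(\<lambda>v. f v * (v $ 1) ^ (d - e)) \<in> forms d" using ed by simp
  show thesis
  proof (rule that[OF F])
    show "\<Phi> t (\<lambda>v. f v * v $ 1 ^ (d - e)) = 0"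
      using f(1) by (simp add: \<Phi>_eq_0 plane_ideal_def M)
    show "\<exists>v. f v * v $ 1 ^ (d - e) \<noteq> 0"
    proof (rule ccontr)
      assume "\<not> ?thesis"
      then have "f v * v $ 1 ^ (d - e) = 0" for v by blast
      from forms_no_zero_divisors[OF ff power this] f(2)
      have "(axis 1 1 :: complex^3) $ 1 ^ (d - e) = 0" by metis
      then show False by simp
    qed
  qed
qed

end

subsection \<open>Directional derivatives of forms\<close>

definition dird :: "complex^'n \<Rightarrow> (complex^'n \<Rightarrow> complex) \<Rightarrow> complex^'n \<Rightarrow> complex" where
  "dird \<tau> F w = deriv (\<lambda>s. F (w + s *s \<tau>)) 0"

lemma dird_deriv:
  assumes "F \<in> forms m"
  shows "((\<lambda>s. F (w + s *s \<tau>)) has_field_derivative dird \<tau> F w) (at 0)"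
proof -
  obtain p where p: "\<And>s. F (w + s *s \<tau>) = poly p s" using forms_on_line[OF assms] by blast
  show ?thesis
    unfolding dird_def p using poly_DERIV[of p 0] by (metis DERIV_imp_deriv)
qed

lemma dird_const: "dird \<tau> (\<lambda>_. c) w = 0"
  by (simp add: dird_def)

lemma dird_add:
  assumes "F \<in> forms a" "G \<in> forms b"
  shows "dird \<tau> (\<lambda>v. F v + G v) w = dird \<tau> F w + dird \<tau> G w"
  using DERIV_add[OF dird_deriv[OF assms(1)] dird_deriv[OF assms(2)], of w \<tau> w \<tau>]
  unfolding dird_def by (rule DERIV_imp_deriv)

lemma dird_mult:
  assumes "F \<in> forms a" "G \<in> forms b"
  shows "dird \<tau> (\<lambda>v. F v * G v) w = dird \<tau> F w * G w + F w * dird \<tau> G w"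
proof -
  have "((\<lambda>s. F (w + s *s \<tau>) * G (w + s *s \<tau>)) has_field_derivative
      dird \<tau> F w * G w + dird \<tau> G w * F w) (at 0)"
    using DERIV_mult[OF dird_deriv[OF assms(1)] dird_deriv[OF assms(2)], of w \<tau> w \<tau>] by simp
  then show ?thesis unfolding dird_def[of _ "\<lambda>v. F v * G v"] by (simp add: DERIV_imp_deriv mult.commute)
qed

lemma dird_scale: "F \<in> forms a \<Longrightarrow> dird \<tau> (\<lambda>v. c * F v) w = c * dird \<tau> F w"
  using dird_mult[of "\<lambda>_. c" 0 F a \<tau> w] by (simp add: dird_const)

lemma dird_coord: "dird \<tau> (\<lambda>v. v $ i) w = \<tau> $ i"
proof -
  have "((\<lambda>s. w $ i + s * \<tau> $ i) has_field_derivative \<tau> $ i) (at 0)"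
    by (auto intro!: derivative_eq_intros)
  then show ?thesis unfolding dird_def by (simp add: DERIV_imp_deriv)
qed

lemma dird_mult_coord:
  "F \<in> forms m \<Longrightarrow> dird \<tau> (\<lambda>v. v $ i * F v) w = \<tau> $ i * F w + w $ i * dird \<tau> F w"
  by (subst dird_mult[OF forms_coord]) (simp_all only: dird_coord)

lemma dird_forms: "F \<in> forms m \<Longrightarrow> dird \<tau> F \<in> forms (m - 1)"
proof (induction rule: forms_induct)
  case (const c)
  have "dird \<tau> (\<lambda>_. c) = (\<lambda>_. 0)" by (intro ext) (rule dird_const)
  then show ?case by simp
next
  case (mult_coord m F i)
  have "(\<lambda>w. w $ i * dird \<tau> F w) \<in> forms m"
  proof (cases m)
    case 0
    then have "F \<in> forms 0" using mult_coord(1) by simp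
    then have "F = (\<lambda>_. F 0)" by (intro ext) (rule forms_0_const)
    then obtain c where "F = (\<lambda>_. c)" by blast
    then show ?thesis by (simp add: dird_const)
  next
    case (Suc k)
    then show ?thesis using forms_mult_coord[OF mult_coord(2), of i] by simp
  qed
  from forms_add[OF forms_scale[OF mult_coord(1), of "\<tau> $ i"] this]
  moreover have "dird \<tau> (\<lambda>v. v $ i * F v) = (\<lambda>w. \<tau> $ i * F w + w $ i * dird \<tau> F w)"
    by (intro ext) (rule dird_mult_coord[OF mult_coord(1)])
  ultimately show ?case by simp
next
  case (add m F G)
  have "dird \<tau> (\<lambda>v. F v + G v) = (\<lambda>w. dird \<tau> F w + dird \<tau> G w)"
    by (intro ext) (rule dird_add[OF add(1,2)])
  with forms_add[OF add(3,4)] show ?case by simp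
next
  case (scale m F c)
  have "dird \<tau> (\<lambda>v. c * F v) = (\<lambda>w. c * dird \<tau> F w)"
    by (intro ext) (rule dird_scale[OF scale(1)])
  with forms_scale[OF scale(2), of c] show ?case by simp
qed

lemma dird_add_dir: "F \<in> forms m \<Longrightarrow> dird (\<sigma> + \<tau>) F w = dird \<sigma> F w + dird \<tau> F w"
proof (induction rule: forms_induct)
  case (mult_coord m F i)
  show ?case unfolding dird_mult_coord[OF mult_coord(1)] mult_coord(2) by (simp add: algebra_simps)
next
  case (add m F G)
  show ?case unfolding dird_add[OF add(1,2)] add(3,4) by simp
next
  case (scale m F c)
  show ?case unfolding dird_scale[OF scale(1)] scale(2) by (simp add: algebra_simps)
qed (simp add: dird_const)

lemma dird_scale_dir: "F \<in> forms m \<Longrightarrow> dird (c *s \<tau>) F w = c * dird \<tau> F w"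
proof (induction rule: forms_induct)
  case (mult_coord m F i)
  show ?case unfolding dird_mult_coord[OF mult_coord(1)] mult_coord(2) by (simp add: algebra_simps)
next
  case (add m F G)
  show ?case unfolding dird_add[OF add(1,2)] add(3,4) by (simp add: algebra_simps)
next
  case (scale m F c)
  show ?case unfolding dird_scale[OF scale(1)] scale(2) by (simp add: algebra_simps)
qed (simp add: dird_const)

text \<open>Repeated integration by parts: with \<open>l \<tau> = 1\<close>, the form \<open>l\<^sup>j h\<close> is the derivative of
  \<open>l\<^bsup>j+1\<^esup> h / (j + 1)\<close> up to \<open>l\<^bsup>j+1\<^esup>\<close> times a form of smaller degree.\<close>

lemma dird_surj:
  fixes \<tau> :: "complex^'n"
  assumes \<tau>: "\<tau> \<noteq> 0" and h: "h \<in> forms m"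
  obtains F where "F \<in> forms (Suc m)" "\<And>v. dird \<tau> F v = h v"
proof -
  obtain i where i: "\<tau> $ i \<noteq> 0" using \<tau> by (auto simp: vec_eq_iff)
  define l :: "complex^'n \<Rightarrow> complex" where "l v = (1 / \<tau> $ i) * v $ i" for v
  have l: "l \<in> forms (Suc 0)" unfolding l_def[abs_def] by (intro forms_scale forms_coord)
  have dl: "dird \<tau> l v = 1" for v
    unfolding l_def[abs_def] using i by (simp only: dird_scale[OF forms_coord] dird_coord) simp
  have lp: "(\<lambda>v. l v ^ j) \<in> forms j" for j using forms_power[OF l, of j] by simp
  have dlp: "dird \<tau> (\<lambda>v. l v ^ j) v = of_nat j * l v ^ (j - 1)" for j v
  proof (induction j)
    case (Suc j)
    have "dird \<tau> (\<lambda>v. l v ^ Suc j) v = dird \<tau> l v * l v ^ j + l v * dird \<tau> (\<lambda>v. l v ^ j) v"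
      using dird_mult[OF l lp[of j]] by simp
    then show ?case unfolding Suc.IH dl by (cases j) (simp_all add: algebra_simps)
  qed (simp add: dird_const)
  have "\<exists>F\<in>forms (Suc (m + j)). \<forall>v. dird \<tau> F v = l v ^ j * h v"
    if "h \<in> forms m" for h :: "complex^'n \<Rightarrow> complex" and m j
    using that
  proof (induction m arbitrary: h j)
    case 0
    then have "h = (\<lambda>_. h 0)" by (intro ext) (rule forms_0_const)
    then obtain c where c: "h = (\<lambda>_. c)" by blast
    have "dird \<tau> (\<lambda>v. (c / of_nat (Suc j)) * l v ^ Suc j) v = l v ^ j * c" for v
      unfolding dird_scale[OF lp] dlp by (simp del: of_nat_Suc)
    moreover have "(\<lambda>v. (c / of_nat (Suc j)) * l v ^ Suc j) \<in> forms (Suc (0 + j))"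
      using forms_scale[OF lp[of "Suc j"], of "c / of_nat (Suc j)"] by (simp only: add_0)
    ultimately show ?case unfolding c by blast
  next
    case (Suc m)
    have dh: "dird \<tau> h \<in> forms m" using dird_forms[OF Suc.prems, of \<tau>] by simp
    obtain G where G: "G \<in> forms (Suc (m + Suc j))" "\<And>v. dird \<tau> G v = l v ^ Suc j * dird \<tau> h v"
      using Suc.IH[OF dh, of "Suc j"] by blast
    let ?a = "1 / of_nat (Suc j) :: complex"
    let ?H = "\<lambda>v. l v ^ Suc j * h v"
    define F where "F v = ?a * (?H v + (-1) * G v)" for v
    have H: "?H \<in> forms (Suc (m + Suc j))" using forms_mult[OF lp[of "Suc j"] Suc.prems] by (simp add: add_ac)
    have nG: "(\<lambda>v. (-1) * G v) \<in> forms (Suc (m + Suc j))" by (rule forms_scale[OF G(1)])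
    have HG: "(\<lambda>v. ?H v + (-1) * G v) \<in> forms (Suc (m + Suc j))" by (rule forms_add[OF H nG])
    have "F \<in> forms (Suc (Suc m + j))"
      unfolding F_def[abs_def] using forms_scale[OF HG, of ?a] by simp
    moreover have "dird \<tau> F v = l v ^ j * h v" for v
    proof -
      have "dird \<tau> F v = ?a * (of_nat (Suc j) * l v ^ j * h v)"
        unfolding F_def[abs_def] dird_scale[OF HG] dird_add[OF H nG] dird_scale[OF G(1)]
          dird_mult[OF lp Suc.prems] dlp G(2) by simp
      then show ?thesis by (simp del: of_nat_Suc)
    qed
    ultimately show ?case by blast
  qed
  from this[OF h, of 0] obtain F where "F \<in> forms (Suc (m + 0))" "\<forall>v. dird \<tau> F v = l v ^ 0 * h v" by blast
  then show thesis by (intro that[of F]) simp_all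
qed

subsection \<open>Global sections\<close>

lemma vanishes_on_span_iff:
  assumes "F \<in> forms m" "v \<noteq> 0"
  shows "vanishes_on F {vec.span {v}} \<longleftrightarrow> F v = 0"
proof
  assume "vanishes_on F {vec.span {v}}"
  then show "F v = 0" using assms(2) by (auto simp: vanishes_on_def intro: vec.span_base)
qed (rule vanishes_on_span[OF assms(1)])

lemma zclosed_empty: "zclosed {}"
proof -
  have "(\<lambda>_. 1) \<in> (\<Union>k. forms k)" using forms_const[of 1] by blast
  moreover have "\<not> vanishes_on (\<lambda>_. 1) {p}" if p: "p \<in> pspace" for p :: "(complex^'n) set"
  proof -
    obtain v where "v \<noteq> 0" "p = vec.span {v}" using p by (auto simp: pspace_def)
    then show ?thesis by (auto simp: vanishes_on_def intro!: bexI[of _ v] vec.span_base)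
  qed
  ultimately show ?thesis unfolding zclosed_def by (intro exI[of _ "{\<lambda>_. 1}"]) auto
qed

lemma zclosed_Un:
  assumes "zclosed X" "zclosed Y"
  shows "zclosed (X \<union> Y)"
proof -
  obtain E where E: "E \<subseteq> (\<Union>k. forms k)" "X = {p \<in> pspace. \<forall>F\<in>E. vanishes_on F {p}}"
    using assms(1) by (auto simp: zclosed_def)
  obtain E' where E': "E' \<subseteq> (\<Union>k. forms k)" "Y = {p \<in> pspace. \<forall>F\<in>E'. vanishes_on F {p}}"
    using assms(2) by (auto simp: zclosed_def)
  define P where "P = (\<lambda>(F, G) v. F v * G v) ` (E \<times> E')"
  have prod_form: "(\<lambda>v. F v * G v) \<in> (\<Union>k. forms k)" if FG: "F \<in> E" "G \<in> E'" for F G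
  proof -
    obtain a b where "F \<in> forms a" "G \<in> forms b" using FG E(1) E'(1) by blast
    then show ?thesis using forms_mult by blast
  qed
  have "p \<in> X \<union> Y \<longleftrightarrow> (\<forall>H\<in>P. vanishes_on H {p})" if p: "p \<in> pspace" for p
  proof -
    obtain v where v: "v \<noteq> 0" "p = vec.span {v}" using p by (auto simp: pspace_def)
    have iff: "vanishes_on F {p} \<longleftrightarrow> F v = 0" if F: "F \<in> (\<Union>k. forms k)" for F
    proof -
      obtain k where "F \<in> forms k" using F by blast
      from vanishes_on_span_iff[OF this v(1)] show ?thesis by (simp add: v(2))
    qed
    have X: "p \<in> X \<longleftrightarrow> (\<forall>F\<in>E. F v = 0)" using E iff p by auto
    have Y: "p \<in> Y \<longleftrightarrow> (\<forall>F\<in>E'. F v = 0)" using E' iff p by auto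
    have "(\<forall>H\<in>P. vanishes_on H {p}) \<longleftrightarrow> (\<forall>F\<in>E. \<forall>G\<in>E'. F v * G v = 0)"
      unfolding P_def using iff[OF prod_form] by auto
    then show ?thesis using X Y by auto
  qed
  moreover have "X \<union> Y \<subseteq> pspace" using E(2) E'(2) by blast
  ultimately have "X \<union> Y = {p \<in> pspace. \<forall>H\<in>P. vanishes_on H {p}}" by blast
  moreover have "P \<subseteq> (\<Union>k. forms k)" unfolding P_def using prod_form by auto
  ultimately show ?thesis unfolding zclosed_def by (intro exI[of _ P]) simp
qed

lemma zopen_in_Int: "zopen_in X N \<Longrightarrow> zopen_in X N' \<Longrightarrow> zopen_in X (N \<inter> N')"
  unfolding zopen_in_def using zclosed_Un by (metis Diff_Un)

lemma restrict_to_sections: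
  assumes "F \<in> forms k"
  shows "restrict_to X F \<in> sections X k"
  unfolding sections_def
proof (intro CollectI conjI allI impI ballI)
  fix v assume "v \<notin> \<Union>X - {0}"
  then show "restrict_to X F v = 0" by (auto simp: restrict_to_def)
next
  fix p assume p: "p \<in> X"
  have "zopen_in X X" using zclosed_empty by (auto simp: zopen_in_def)
  moreover have "F \<in> forms (k + 0)" using assms by simp
  moreover have "restrict_to X F v = F v / 1" if "z \<in> X" "v \<in> z - {0}" for z v
    using that by (auto simp: restrict_to_def)
  ultimately show "\<exists>N e. \<exists>A\<in>forms (k + e). \<exists>B\<in>forms e. zopen_in X N \<and> p \<in> N \<and>
      (\<forall>z\<in>N. \<forall>v\<in>z - {0}. B v \<noteq> 0 \<and> restrict_to X F v = A v / B v)"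
    using p by (intro exI[of _ X] exI[of _ 0] bexI[of _ F] bexI[of _ "\<lambda>_. 1"]) auto
qed

lemma sections_local:
  assumes "s \<in> sections X k" "p \<in> X"
  obtains N e A B where "A \<in> forms (k + e)" "B \<in> forms e" "zopen_in X N" "p \<in> N"
    "\<And>z v. z \<in> N \<Longrightarrow> v \<in> z - {0} \<Longrightarrow> B v \<noteq> 0 \<and> s v = A v / B v"
proof -
  have "\<forall>p\<in>X. \<exists>N e. \<exists>A\<in>forms (k + e). \<exists>B\<in>forms e. zopen_in X N \<and> p \<in> N \<and>
      (\<forall>z\<in>N. \<forall>v\<in>z - {0}. B v \<noteq> 0 \<and> s v = A v / B v)"
    using assms(1) unfolding sections_def mem_Collect_eq by (rule conjunct2)
  from bspec[OF this assms(2)] show thesis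
  proof (elim exE bexE conjE)
    fix N e A B
    assume AB: "A \<in> forms (k + e)" "B \<in> forms e" "zopen_in X N" "p \<in> N"
      and eq: "\<forall>z\<in>N. \<forall>v\<in>z - {0}. B v \<noteq> 0 \<and> s v = A v / B v"
    show thesis by (rule that[OF AB]) (rule bspec[OF bspec[OF eq]])
  qed
qed

lemma sections_outside: "s \<in> sections X k \<Longrightarrow> v \<notin> \<Union>X - {0} \<Longrightarrow> s v = 0"
  unfolding sections_def mem_Collect_eq by (elim conjE) (erule allE, erule mp)

lemma sectionsI:
  assumes "\<And>v. v \<notin> \<Union>X - {0} \<Longrightarrow> s v = 0"
    and "\<And>p. p \<in> X \<Longrightarrow> \<exists>N e. \<exists>A\<in>forms (k + e). \<exists>B\<in>forms e. zopen_in X N \<and> p \<in> N \<and>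
            (\<forall>z\<in>N. \<forall>v\<in>z - {0}. B v \<noteq> 0 \<and> s v = A v / B v)"
  shows "s \<in> sections X k"
  unfolding sections_def using assms by blast

text \<open>The Grassmannian chart needs a complement inside all global sections, not only inside
  the restrictions of forms. Local fractions are added over a common denominator on the intersection
  of their domains.\<close>

lemma sections_subspace: "cfun.subspace (sections X k)"
  unfolding cfun.subspace_def
proof (intro conjI ballI allI)
  have "restrict_to X (\<lambda>_. 0) = 0" by (simp add: restrict_to_eq_0_iff)
  then show "0 \<in> sections X k" using restrict_to_sections[OF forms_zero] by metis
next
  fix s t assume s: "s \<in> sections X k" and t: "t \<in> sections X k"
  show "s + t \<in> sections X k"
  proof (rule sectionsI)
    fix v assume v: "v \<notin> \<Union>X - {0}"
    show "(s + t) v = 0" using sections_outside[OF s v] sections_outside[OF t v] by simp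
  next
    fix p assume p: "p \<in> X"
    obtain N e A B where 1: "A \<in> forms (k + e)" "B \<in> forms e" "zopen_in X N" "p \<in> N"
      "\<And>z v. z \<in> N \<Longrightarrow> v \<in> z - {0} \<Longrightarrow> B v \<noteq> 0 \<and> s v = A v / B v"
      by (rule sections_local[OF s p]) (rule that)
    obtain N' e' A' B' where 2: "A' \<in> forms (k + e')" "B' \<in> forms e'" "zopen_in X N'" "p \<in> N'"
      "\<And>z v. z \<in> N' \<Longrightarrow> v \<in> z - {0} \<Longrightarrow> B' v \<noteq> 0 \<and> t v = A' v / B' v"
      by (rule sections_local[OF t p]) (rule that)
    let ?A = "\<lambda>v. A v * B' v + A' v * B v" and ?B = "\<lambda>v. B v * B' v"
    have "(\<lambda>v. A' v * B v) \<in> forms (k + (e + e'))"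
      using forms_mult[OF 2(1) 1(2)] by (simp add: add_ac)
    then have A: "?A \<in> forms (k + (e + e'))"
      using forms_mult[OF 1(1) 2(2)] by (intro forms_add) (simp_all add: add_ac)
    have B: "?B \<in> forms (e + e')" by (rule forms_mult[OF 1(2) 2(2)])
    have "?B v \<noteq> 0 \<and> (s + t) v = ?A v / ?B v" if "z \<in> N \<inter> N'" "v \<in> z - {0}" for z v
    proof -
      have "B v \<noteq> 0 \<and> s v = A v / B v" "B' v \<noteq> 0 \<and> t v = A' v / B' v"
        using 1(5) 2(5) that by blast+
      then show ?thesis by (simp add: field_simps)
    qed
    then show "\<exists>N e. \<exists>A\<in>forms (k + e). \<exists>B\<in>forms e. zopen_in X N \<and> p \<in> N \<and>
        (\<forall>z\<in>N. \<forall>v\<in>z - {0}. B v \<noteq> 0 \<and> (s + t) v = A v / B v)"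
      using zopen_in_Int[OF 1(3) 2(3)] 1(4) 2(4)
      by (intro exI[of _ "N \<inter> N'"] exI[of _ "e + e'"] bexI[OF _ A] bexI[OF _ B]) blast
  qed
next
  fix c s assume s: "s \<in> sections X k"
  show "cfun_scale c s \<in> sections X k"
  proof (rule sectionsI)
    fix v assume v: "v \<notin> \<Union>X - {0}"
    show "cfun_scale c s v = 0" using sections_outside[OF s v] by (simp add: cfun_scale_def)
  next
    fix p assume p: "p \<in> X"
    obtain N e A B where 1: "A \<in> forms (k + e)" "B \<in> forms e" "zopen_in X N" "p \<in> N"
      "\<And>z v. z \<in> N \<Longrightarrow> v \<in> z - {0} \<Longrightarrow> B v \<noteq> 0 \<and> s v = A v / B v"
      by (rule sections_local[OF s p]) (rule that)
    have A: "(\<lambda>v. c * A v) \<in> forms (k + e)" by (rule forms_scale[OF 1(1)])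
    have "B v \<noteq> 0 \<and> cfun_scale c s v = c * A v / B v" if "z \<in> N" "v \<in> z - {0}" for z v
      using 1(5)[OF that] by (simp add: cfun_scale_def)
    then show "\<exists>N e. \<exists>A\<in>forms (k + e). \<exists>B\<in>forms e. zopen_in X N \<and> p \<in> N \<and>
        (\<forall>z\<in>N. \<forall>v\<in>z - {0}. B v \<noteq> 0 \<and> cfun_scale c s v = A v / B v)"
      using 1(3,4) by (intro exI[of _ N] exI[of _ e] bexI[OF _ A] bexI[OF _ 1(2)]) blast
  qed
qed

subsection \<open>The derivative of the cone map along a form\<close>

text \<open>No continuity is asked for, so coordinates in an algebraic basis and point evaluations
  after a projection both qualify.\<close>

definition functional :: "(('a \<Rightarrow> complex) \<Rightarrow> complex) \<Rightarrow> bool" where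
  "functional \<beta> \<longleftrightarrow> (\<forall>f g. \<beta> (f + g) = \<beta> f + \<beta> g) \<and> (\<forall>c f. \<beta> (cfun_scale c f) = c * \<beta> f)"

lemma functional_add: "functional \<beta> \<Longrightarrow> \<beta> (f + g) = \<beta> f + \<beta> g"
  by (simp add: functional_def)

lemma functional_scale: "functional \<beta> \<Longrightarrow> \<beta> (cfun_scale c f) = c * \<beta> f"
  by (simp add: functional_def)

lemma functional_zero: "functional \<beta> \<Longrightarrow> \<beta> 0 = 0"
  using functional_add[of \<beta> 0 0] by simp

lemma functional_diff: "functional \<beta> \<Longrightarrow> \<beta> (f - g) = \<beta> f - \<beta> g"
  using functional_add[of \<beta> "f - g" g] by simp

lemma functional_sum: "functional \<beta> \<Longrightarrow> \<beta> (\<Sum>i\<in>I. f i) = (\<Sum>i\<in>I. \<beta> (f i))"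
  by (induction I rule: infinite_finite_induct) (simp_all add: functional_zero functional_add)

text \<open>Lets the factors arising from a coordinate of \<open>proj_at\<close> be absorbed into
  the functional when the derivative is computed by induction on the form.\<close>

lemma functional_mult:
  assumes "functional \<beta>" shows "functional (\<lambda>f. \<beta> (\<lambda>v. k v * f v))"
  unfolding functional_def
proof (intro conjI allI)
  fix f g c
  have "(\<lambda>v. k v * (f + g) v) = (\<lambda>v. k v * f v) + (\<lambda>v. k v * g v)" by (simp add: fun_eq_iff distrib_left)
  then show "\<beta> (\<lambda>v. k v * (f + g) v) = \<beta> (\<lambda>v. k v * f v) + \<beta> (\<lambda>v. k v * g v)"
    by (simp only: functional_add[OF assms])
  have "(\<lambda>v. k v * cfun_scale c f v) = cfun_scale c (\<lambda>v. k v * f v)"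
    by (simp add: fun_eq_iff cfun_scale_def mult.left_commute)
  then show "\<beta> (\<lambda>v. k v * cfun_scale c f v) = c * \<beta> (\<lambda>v. k v * f v)"
    by (simp only: functional_scale[OF assms])
qed

context plane_projection
begin

definition \<Phi>' :: "complex^3 \<Rightarrow> (complex^3 \<Rightarrow> complex) \<Rightarrow> complex^4 \<Rightarrow> complex" where
  "\<Phi>' \<tau> F = restrict_to C (\<lambda>v. - (W v * dird \<tau> F (\<Xi> *v v)))"

lemma \<Phi>'_forms:
  assumes F: "F \<in> forms (Suc m)" shows "\<Phi>' \<tau> F \<in> restrict_to C ` forms (Suc m)"
proof -
  have "dird \<tau> F \<in> forms m" using dird_forms[OF F, of \<tau>] by simp
  from forms_uminus[OF forms_mult[OF W pullback_forms[OF this, of \<Xi>]]]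
  show ?thesis unfolding \<Phi>'_def by (intro imageI) simp
qed

text \<open>\<open>\<Phi> t F\<close> moves in a finite-dimensional space of functions that is not specified, so that its
  derivative is taken after an arbitrary linear functional.\<close>

lemma \<Phi>_derivative:
  "F \<in> forms m \<Longrightarrow> functional \<beta> \<Longrightarrow> ((\<lambda>t. \<beta> (\<Phi> t F)) has_derivative (\<lambda>\<tau>. \<beta> (\<Phi>' \<tau> F))) (at 0)"
proof (induction arbitrary: \<beta> rule: forms_induct)
  case (const c)
  have "\<Phi>' \<tau> (\<lambda>_. c) = 0" for \<tau> by (simp add: \<Phi>'_def dird_const restrict_to_eq_0_iff)
  moreover have "\<Phi> t (\<lambda>_. c) = restrict_to C (\<lambda>_. c)" for t by (simp only: \<Phi>_def)
  ultimately show ?case by (simp only: functional_zero[OF const] has_derivative_const)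
next
  case (mult_coord m F i)
  let ?\<beta>1 = "\<lambda>f. \<beta> (\<lambda>v. (\<Xi> *v v) $ i * f v)" and ?\<beta>2 = "\<lambda>f. \<beta> (\<lambda>v. W v * f v)"
  have func: "functional ?\<beta>1" "functional ?\<beta>2" by (rule functional_mult[OF mult_coord(3)])+
  have "\<Phi> t (\<lambda>v. v $ i * F v)
      = (\<lambda>v. (\<Xi> *v v) $ i * \<Phi> t F v) - cfun_scale (t $ i) (\<lambda>v. W v * \<Phi> t F v)" for t
    by (simp add: \<Phi>_def restrict_to_eq_mult fun_eq_iff cfun_scale_def proj_at_def algebra_simps)
  then have 1: "\<beta> (\<Phi> t (\<lambda>v. v $ i * F v)) = ?\<beta>1 (\<Phi> t F) - t $ i * ?\<beta>2 (\<Phi> t F)" for t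
    by (simp only: functional_diff[OF mult_coord(3)] functional_scale[OF mult_coord(3)])
  have "\<Phi>' \<tau> (\<lambda>v. v $ i * F v)
      = (\<lambda>v. (\<Xi> *v v) $ i * \<Phi>' \<tau> F v) - cfun_scale (\<tau> $ i) (\<lambda>v. W v * \<Phi> 0 F v)" for \<tau>
    unfolding \<Phi>'_def dird_mult_coord[OF mult_coord(1)]
    by (simp add: \<Phi>_def restrict_to_eq_mult fun_eq_iff cfun_scale_def proj_at_0 algebra_simps)
  then have 2: "\<beta> (\<Phi>' \<tau> (\<lambda>v. v $ i * F v)) = ?\<beta>1 (\<Phi>' \<tau> F) - \<tau> $ i * ?\<beta>2 (\<Phi> 0 F)" for \<tau>
    by (simp only: functional_diff[OF mult_coord(3)] functional_scale[OF mult_coord(3)])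
  have coord: "((\<lambda>t :: complex^3. t $ i) has_derivative (\<lambda>\<tau>. \<tau> $ i)) (at 0)"
    by (rule bounded_linear_imp_has_derivative[OF bounded_linear_vec_nth])
  have "((\<lambda>t. ?\<beta>1 (\<Phi> t F) - t $ i * ?\<beta>2 (\<Phi> t F)) has_derivative
      (\<lambda>\<tau>. ?\<beta>1 (\<Phi>' \<tau> F) - (0 $ i * ?\<beta>2 (\<Phi>' \<tau> F) + \<tau> $ i * ?\<beta>2 (\<Phi> 0 F)))) (at 0)"
    by (rule has_derivative_diff[OF mult_coord(2)[OF func(1)] has_derivative_mult[OF coord mult_coord(2)[OF func(2)]]])
  then show ?case by (simp add: 1 2)
next
  case (add m F G)
  have "\<Phi> t (\<lambda>v. F v + G v) = \<Phi> t F + \<Phi> t G" for t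
    by (simp add: \<Phi>_def restrict_to_eq_mult fun_eq_iff distrib_left)
  moreover have "\<Phi>' \<tau> (\<lambda>v. F v + G v) = \<Phi>' \<tau> F + \<Phi>' \<tau> G" for \<tau>
    by (simp add: \<Phi>'_def restrict_to_eq_mult fun_eq_iff dird_add[OF add(1,2)] algebra_simps)
  ultimately show ?case
    using has_derivative_add[OF add(3)[OF add(5)] add(4)[OF add(5)]]
    by (simp only: functional_add[OF add(5)])
next
  case (scale m F c)
  have "\<Phi> t (\<lambda>v. c * F v) = cfun_scale c (\<Phi> t F)" for t
    by (simp add: \<Phi>_def restrict_to_eq_mult fun_eq_iff cfun_scale_def)
  moreover have "\<Phi>' \<tau> (\<lambda>v. c * F v) = cfun_scale c (\<Phi>' \<tau> F)" for \<tau>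
    by (simp add: \<Phi>'_def restrict_to_eq_mult fun_eq_iff dird_scale[OF scale(1)] cfun_scale_def)
  ultimately show ?case
    using has_derivative_mult_right[OF scale(2)[OF scale(3)], of c]
    by (simp only: functional_scale[OF scale(3)])
qed

lemma \<Phi>'_add: "F \<in> forms m \<Longrightarrow> \<Phi>' (\<sigma> + \<tau>) F = \<Phi>' \<sigma> F + \<Phi>' \<tau> F"
  by (simp add: \<Phi>'_def restrict_to_eq_mult fun_eq_iff dird_add_dir algebra_simps)

lemma \<Phi>'_scale: "F \<in> forms m \<Longrightarrow> \<Phi>' (a *s \<tau>) F = cfun_scale a (\<Phi>' \<tau> F)"
  by (simp add: \<Phi>'_def restrict_to_eq_mult fun_eq_iff dird_scale_dir cfun_scale_def)

end

section \<open>Descent of \<open>W\<close> from degree \<open>d - 1\<close> to degree 0\<close>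

locale curve_projection = plane_projection +
  fixes f :: "complex^3 \<Rightarrow> complex"
  assumes f_ideal: "f \<in> plane_ideal \<Xi> d" and f3: "f (axis 3 1) \<noteq> 0"
    and generates_f: "generates \<Xi> d f"
begin

lemma f_forms: "f \<in> forms d"
  using f_ideal by (simp add: plane_ideal_def)

lemma d_pos: "0 < d"
proof (rule ccontr)
  assume "\<not> 0 < d"
  then have "f \<in> forms 0" using f_forms by simp
  obtain v where "v \<in> affine_cone C" using cone_nonempty by blast
  then have "f (\<Xi> *v v) = 0" using f_ideal by (simp add: plane_ideal_def)
  then show False using forms_0_const[OF \<open>f \<in> forms 0\<close>] f3 by metis
qed

text \<open>The relation \<open>y g\<^sub>1 - x g\<^sub>2\<close> between the products of \<open>W\<close> with \<open>x h\<close> and \<open>y h\<close> is a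
  multiple \<open>f q\<close> of \<open>f\<close> with \<open>q\<close> of degree at most 1. Since \<open>f\<close> does not vanish at \<open>x = y = 0\<close>,
  neither \<open>q\<close> involves the third coordinate, and \<open>x\<close> can be cancelled.\<close>

lemma descend:
  assumes W': "\<And>h. h \<in> forms (Suc m) \<Longrightarrow> on_plane_ring (Suc (Suc m)) (\<lambda>v. W v * h (\<Xi> *v v))"
    and m: "Suc m < d" and h: "h \<in> forms m"
  shows "on_plane_ring (Suc m) (\<lambda>v. W v * h (\<Xi> *v v))"
proof -
  obtain g1 where g1: "g1 \<in> forms (Suc (Suc m))"
    "\<And>v. v \<in> affine_cone C \<Longrightarrow> W v * ((\<Xi> *v v) $ 1 * h (\<Xi> *v v)) = g1 (\<Xi> *v v)"
    using W'[OF forms_mult_coord[OF h, of 1]] unfolding on_plane_ring_def by blast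
  obtain g2 where g2: "g2 \<in> forms (Suc (Suc m))"
    "\<And>v. v \<in> affine_cone C \<Longrightarrow> W v * ((\<Xi> *v v) $ 2 * h (\<Xi> *v v)) = g2 (\<Xi> *v v)"
    using W'[OF forms_mult_coord[OF h, of 2]] unfolding on_plane_ring_def by blast
  define D where "D v = v $ 2 * g1 v - v $ 1 * g2 v" for v
  have D: "D \<in> forms (Suc (Suc (Suc m)))"
    unfolding D_def[abs_def] by (intro forms_diff forms_mult_coord g1 g2)
  have "D (\<Xi> *v v) = 0" if "v \<in> affine_cone C" for v
    unfolding D_def using g1(2)[OF that] g2(2)[OF that] by (simp flip: g1(2)[OF that] g2(2)[OF that])
  then have DI: "D \<in> plane_ideal \<Xi> (Suc (Suc (Suc m)))" using D by (simp add: plane_ideal_def)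
  \<comment> \<open>In both cases \<open>b * f\<close> has the degree of \<open>g1\<close>: either
    \<open>D = 0\<close> and \<open>b = 0\<close>, or the quotient is linear and
    \<open>Suc (Suc m) = d\<close>.\<close>
  have "\<exists>a b. (\<forall>v. D v = f v * (a * v $ 1 + b * v $ 2)) \<and> (\<lambda>v. b * f v) \<in> forms (Suc (Suc m))"
  proof (cases "\<forall>v. D v = 0")
    case True
    then show ?thesis by (intro exI[of _ 0]) simp
  next
    case False
    then obtain r q where r: "Suc (Suc (Suc m)) = d + r" "q \<in> forms r" "\<And>v. D v = f v * q v"
      using generatesD[OF generates_f DI] by blast
    have "D (axis 3 1) = 0" by (simp add: D_def axis_def)
    then have q3: "q (axis 3 1) = 0" using r(3) f3 by simp
    have "r \<noteq> 0"
    proof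
      assume "r = 0"
      then have "q v = 0" for v using forms_0_const[of q] r(2) q3 by metis
      then show False using False r(3) by simp
    qed
    then have r1: "r = 1" "Suc (Suc m) = d" using r(1) m by linarith+
    then obtain a where a: "\<And>v. q v = (\<Sum>i\<in>UNIV. a i * v $ i)" using forms_1_sum r(2) by metis
    have "a 3 = 0" using q3 by (simp add: a sum_3 axis_def)
    then have "D v = f v * (a 1 * v $ 1 + a 2 * v $ 2)" for v by (simp add: r(3) a sum_3)
    moreover have "(\<lambda>v. a 2 * f v) \<in> forms (Suc (Suc m))" unfolding r1 by (rule forms_scale[OF f_forms])
    ultimately show ?thesis by blast
  qed
  then obtain a b where ab: "\<And>v. D v = f v * (a * v $ 1 + b * v $ 2)"
    and bf: "(\<lambda>v. b * f v) \<in> forms (Suc (Suc m))" by blast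
  \<comment> \<open>The relation reads \<open>y (g1 - b f) = x (g2 + a f)\<close>, with x and y the
    first two coordinates. So x divides \<open>G\<close>, and \<open>G\<close> agrees with
    \<open>g1\<close> on the image because \<open>f\<close> vanishes there.\<close>
  define G where "G v = g1 v - b * f v" for v
  have G: "G \<in> forms (Suc (Suc m))" unfolding G_def[abs_def] by (rule forms_diff[OF g1(1) bf])
  have x: "(\<lambda>v::complex^3. v $ 1) \<in> forms 1" and y: "(\<lambda>v::complex^3. v $ 2) \<in> forms 1" by simp_all
  let ?P = "\<lambda>v :: complex^3. v - v $ 1 *s axis 1 1"
  have P: "?P v $ 1 = 0" "?P v $ 2 = v $ 2" for v by (simp_all add: axis_def)
  have "?P v $ 2 * G (?P v) = 0" for v
  proof -
    have "?P v $ 2 * g1 (?P v) = f (?P v) * (b * ?P v $ 2)"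
      using ab[of "?P v"] unfolding D_def P(1) by simp
    then show ?thesis unfolding G_def by (simp only: right_diff_distrib) (simp add: mult_ac)
  qed
  from forms_no_zero_divisors[OF forms_hyperplane_compose[OF y x] forms_hyperplane_compose[OF G x] this]
  have "(\<forall>v. ?P v $ 2 = 0) \<or> (\<forall>v. G (?P v) = 0)" .
  moreover have "?P (axis 2 1) $ 2 \<noteq> 0" unfolding P by simp
  ultimately have GP: "\<And>v. G (?P v) = 0" by blast
  from forms_hyperplane_decomp[OF G x, of "axis 1 1"]
  obtain k where k': "k \<in> forms (Suc (Suc m) - 1)" "\<forall>v. G v = G (?P v) + v $ 1 * k v"
    by (elim bexE)
  have k: "k \<in> forms (Suc m)" "G v = v $ 1 * k v" for v
    using k'(1) spec[OF k'(2), of v] GP[of v] by simp_all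
  have WH: "(\<lambda>v. W v * h (\<Xi> *v v)) \<in> forms (Suc m)"
    using forms_mult[OF W pullback_forms[OF h, of \<Xi>]] by simp
  have E: "(\<lambda>v. W v * h (\<Xi> *v v) - k (\<Xi> *v v)) \<in> forms (Suc m)"
    by (rule forms_diff[OF WH pullback_forms[OF k(1)]])
  have "(\<Xi> *v v) $ 1 * (W v * h (\<Xi> *v v) - k (\<Xi> *v v)) = 0" if "v \<in> affine_cone C" for v
  proof -
    have "f (\<Xi> *v v) = 0" using f_ideal that by (simp add: plane_ideal_def)
    then have "g1 (\<Xi> *v v) = (\<Xi> *v v) $ 1 * k (\<Xi> *v v)"
      using k(2)[of "\<Xi> *v v"] by (simp add: G_def)
    then show ?thesis using g1(2)[OF that] by (simp add: algebra_simps)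
  qed
  from vanish_prime[OF forms_matrix_coord E this]
  have "(\<forall>v\<in>affine_cone C. (\<Xi> *v v) $ 1 = 0) \<or>
      (\<forall>v\<in>affine_cone C. W v * h (\<Xi> *v v) - k (\<Xi> *v v) = 0)" .
  moreover have "\<not> (\<forall>v\<in>affine_cone C. (\<Xi> *v v) $ 1 = 0)"
  proof
    assume "\<forall>v\<in>affine_cone C. (\<Xi> *v v) $ 1 = 0"
    then have "(\<Xi> *v v) $ 1 = 0" for v
      using vanish_linear[of "\<lambda>v. (\<Xi> *v v) $ 1" v] by simp
    from this[of "A *v axis 1 1"] show False by (simp add: \<Xi>A)
  qed
  ultimately show ?thesis using k(1) unfolding on_plane_ring_def by auto
qed

lemma W_not_integral:
  assumes "\<And>h. h \<in> forms (d - 1) \<Longrightarrow> on_plane_ring d (\<lambda>v. W v * h (\<Xi> *v v))"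
  shows False
proof -
  have "\<forall>h\<in>forms (d - 1 - j). on_plane_ring (Suc (d - 1 - j)) (\<lambda>v. W v * h (\<Xi> *v v))"
    if "j \<le> d - 1" for j
    using that
  proof (induction j)
    case 0
    then show ?case using assms d_pos by simp
  next
    case (Suc j)
    define m where "m = d - 1 - Suc j"
    have m: "d - 1 - j = Suc m" "Suc m < d \<or> j = 0" using Suc.prems by (auto simp: m_def)
    then have "Suc m < d" using Suc.prems by (cases j) (auto simp: m_def)
    then show ?case using Suc descend[of m] unfolding m_def[symmetric] m(1) by simp
  qed
  from this[of "d - 1"] have *: "\<forall>h\<in>forms 0. on_plane_ring (Suc 0) (\<lambda>v. W v * h (\<Xi> *v v))" by simp
  have "on_plane_ring (Suc 0) (\<lambda>v. W v * 1)" by (rule bspec[OF * forms_const])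
  from this[unfolded on_plane_ring_def]
  obtain l where l: "l \<in> forms (Suc 0)" "\<forall>v\<in>affine_cone C. W v * 1 = l (\<Xi> *v v)" by (rule bexE)
  \<comment> \<open>As \<Xi> kills \<open>u\<close>, the value of \<open>E\<close> at
    \<open>u\<close> is 1, while nondegeneracy makes \<open>E\<close> zero.\<close>
  define E where "E v = W v - l (\<Xi> *v v)" for v
  have "E \<in> forms 1"
    unfolding E_def[abs_def] by (rule forms_diff[OF W]) (simp add: pullback_forms[OF l(1)])
  then have "E u = 0" by (rule vanish_linear) (use l(2) in \<open>simp add: E_def\<close>)
  then show False using Wu \<Xi>u forms_at_0[OF l(1)] by (simp add: E_def)
qed

end

subsection \<open>The differential\<close>

text \<open>Since \<open>h\<close> vanishes at 0, the factor \<open>c\<close> needs a limit but no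
  derivative. The coefficients from the inverse matrix are known only to converge.\<close>

lemma has_derivative_mult_vanishing:
  fixes h c :: "'a :: real_normed_vector \<Rightarrow> complex"
  assumes h: "(h has_derivative h') (at 0)" "h 0 = 0" and c: "(c \<longlongrightarrow> c0) (at 0)"
  shows "((\<lambda>t. c t * h t) has_derivative (\<lambda>\<tau>. c0 * h' \<tau>)) (at 0)"
proof -
  have bl: "bounded_linear h'" and lim: "((\<lambda>t. norm (h t - h' t) / norm t) \<longlongrightarrow> 0) (at 0)"
    using h by (auto simp: has_derivative_at)
  obtain K where K: "\<And>t. norm (h' t) \<le> norm t * K" using bounded_linear.bounded[OF bl] by blast
  let ?e = "\<lambda>t. norm (c t) * (norm (h t - h' t) / norm t) + norm (c t - c0) * K"
  have "((\<lambda>t. norm (c t * h t - c0 * h' t) / norm t) \<longlongrightarrow> 0) (at 0)"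
  proof (rule Lim_null_comparison)
    have "norm (norm (c t * h t - c0 * h' t) / norm t) \<le> ?e t" if "t \<noteq> 0" for t
    proof -
      have "c t * h t - c0 * h' t = c t * (h t - h' t) + (c t - c0) * h' t" by (simp add: algebra_simps)
      then have "norm (c t * h t - c0 * h' t) \<le> norm (c t) * norm (h t - h' t) + norm (c t - c0) * norm (h' t)"
        by (metis norm_mult norm_triangle_ineq)
      also have "\<dots> \<le> norm (c t) * norm (h t - h' t) + norm (c t - c0) * (norm t * K)"
        by (intro add_left_mono mult_left_mono K) simp
      finally have "norm (c t * h t - c0 * h' t) / norm t
          \<le> (norm (c t) * norm (h t - h' t) + norm (c t - c0) * (norm t * K)) / norm t"
        by (rule divide_right_mono) simp
      also have "\<dots> = ?e t" using that by (simp add: add_divide_distrib)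
      finally show ?thesis by simp
    qed
    then show "\<forall>\<^sub>F t in at 0. norm (norm (c t * h t - c0 * h' t) / norm t) \<le> ?e t"
      by (auto simp: eventually_at_filter)
    have "(?e \<longlongrightarrow> norm c0 * 0 + norm (c0 - c0) * K) (at 0)" by (intro tendsto_intros c lim)
    then show "(?e \<longlongrightarrow> 0) (at 0)" by simp
  qed
  moreover have "bounded_linear (\<lambda>\<tau>. c0 * h' \<tau>)" by (rule bounded_linear_const_mult[OF bl])
  ultimately show ?thesis using h(2) by (simp add: has_derivative_at)
qed

lemma cfun_span_family:
  assumes "finite I" "k \<in> cfun.span (f ` I)"
  shows "\<exists>a. k = (\<Sum>i\<in>I. cfun_scale (a i) (f i))"
proof -
  let ?T = "{k. \<exists>a. k = (\<Sum>i\<in>I. cfun_scale (a i) (f i))}"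
  have "cfun.span (f ` I) \<subseteq> ?T"
  proof (rule cfun.span_minimal)
    show "f ` I \<subseteq> ?T"
    proof
      fix x assume "x \<in> f ` I"
      then obtain j where j: "j \<in> I" "x = f j" by blast
      have "(\<Sum>i\<in>I. cfun_scale (if i = j then 1 else 0) (f i)) = (\<Sum>i\<in>I. if i = j then f i else 0)"
        by (intro sum.cong) (auto simp: cfun_scale_def fun_eq_iff)
      also have "\<dots> = x" using j assms(1) by simp
      finally have "x = (\<Sum>i\<in>I. cfun_scale (if i = j then 1 else 0) (f i))" ..
      then show "x \<in> ?T" unfolding mem_Collect_eq by (rule exI[of _ "\<lambda>i. if i = j then 1 else 0"])
    qed
    show "cfun.subspace ?T" unfolding cfun.subspace_def
    proof (intro conjI ballI allI)
      have "0 = (\<Sum>i\<in>I. cfun_scale 0 (f i))" by simp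
      then show "0 \<in> ?T" unfolding mem_Collect_eq by (rule exI[of _ "\<lambda>_. 0"])
    next
      fix x y assume "x \<in> ?T" "y \<in> ?T"
      then obtain a b where "x = (\<Sum>i\<in>I. cfun_scale (a i) (f i))" "y = (\<Sum>i\<in>I. cfun_scale (b i) (f i))" by blast
      then have "x + y = (\<Sum>i\<in>I. cfun_scale (a i + b i) (f i))"
        by (simp only: cfun.scale_left_distrib sum.distrib)
      then show "x + y \<in> ?T" unfolding mem_Collect_eq by (rule exI[of _ "\<lambda>i. a i + b i"])
    next
      fix c x assume "x \<in> ?T"
      then obtain a where "x = (\<Sum>i\<in>I. cfun_scale (a i) (f i))" by blast
      then have "cfun_scale c x = (\<Sum>i\<in>I. cfun_scale (c * a i) (f i))"
        by (simp only: cfun.scale_sum_right cfun.scale_scale)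
      then show "cfun_scale c x \<in> ?T" unfolding mem_Collect_eq by (rule exI[of _ "\<lambda>i. c * a i"])
    qed
  qed
  with assms(2) show ?thesis by blast
qed

lemma sum_delta_mult:
  fixes x :: "'b \<Rightarrow> complex"
  assumes "finite B" "b \<in> B"
  shows "(\<Sum>b'\<in>B. (if b = b' then 1 else 0) * x b') = x b" "(\<Sum>b'\<in>B. (if b' = b then 1 else 0) * x b') = x b"
proof -
  have "(\<Sum>b'\<in>B. (if b = b' then 1 else 0) * x b') = (\<Sum>b'\<in>B. if b' = b then x b' else 0)"
    by (intro sum.cong) auto
  then show "(\<Sum>b'\<in>B. (if b = b' then 1 else 0) * x b') = x b" using assms by simp
  have "(\<Sum>b'\<in>B. (if b' = b then 1 else 0) * x b') = (\<Sum>b'\<in>B. if b' = b then x b' else 0)"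
    by (intro sum.cong) auto
  then show "(\<Sum>b'\<in>B. (if b' = b then 1 else 0) * x b') = x b" using assms by simp
qed

context curve_projection
begin

lemma dim_cone_map: "cfun.dim (\<Phi> 0 ` forms d) = (d + 2 choose 2) - 1"
proof -
  have "\<Phi> 0 ` forms d = plane_ring \<Xi> d"
    by (simp add: plane_ring_def \<Phi>_def proj_at_0)
  moreover have "cfun.dim (plane_ideal \<Xi> (d + 0)) = (0 + 2 choose 2)"
    by (rule dim_plane_ideal[OF f_ideal]) (use f3 generates_f in blast)+
  ultimately show ?thesis using dim_plane_ring[of \<Xi> d] by (simp add: numeral_2_eq_2)
qed

text \<open>One nonzero relation of degree \<open>d\<close> exists at every vertex. Near
  \<open>t = 0\<close> this bound is attained, so the dimension is locally constant.\<close>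

lemma dim_cone_map_at: "cfun.dim (\<Phi> t ` forms d) \<le> (d + 2 choose 2) - 1"
proof -
  obtain Z :: "(complex^3 \<Rightarrow> complex) set" where Z: "finite Z" "forms d = cfun.span Z"
    using forms_finite_span by blast
  let ?N = "{F \<in> forms d. \<Phi> t F = 0}"
  obtain F where F: "F \<in> forms d" "\<Phi> t F = 0" "\<exists>v. F v \<noteq> 0" using relation_at by blast
  have "F \<noteq> 0" using F(3) by auto
  then have "cfun.dim {F} = 1" using cfun.dim_eq_card_independent[of "{F}"] by (simp add: cfun.dependent_single)
  moreover have "cfun.dim {F} \<le> cfun.dim ?N"
    using F Z by (intro cfun_dim_mono[of _ _ Z]) auto
  moreover have "cfun.dim (forms d :: (complex^3 \<Rightarrow> complex) set) = cfun.dim (\<Phi> t ` forms d) + cfun.dim ?N"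
    by (rule cfun_rank_nullity[OF \<Phi>_linear forms_subspace _ Z(1)]) (simp only: Z(2) order.refl)
  ultimately show ?thesis by (simp add: dim_ternary_forms)
qed

lemma \<Phi>_image_subspace: "cfun.subspace (\<Phi> t ` forms k)"
proof -
  interpret Vector_Spaces.linear cfun_scale cfun_scale "\<Phi> t" by (rule \<Phi>_linear)
  show ?thesis by (rule subspace_image[OF forms_subspace])
qed

lemma \<Phi>_section: "F \<in> forms k \<Longrightarrow> \<Phi> t F \<in> sections C k"
  unfolding \<Phi>_def by (rule restrict_to_sections, rule forms_compose_linear[OF _ proj_at_coord])

theorem injective_differential:
  "injective_differential_at ((d + 2 choose 2) - 1) (sections C d) (cone_map C d) (vec.span {u})"
proof -
  let ?n = "(d + 2 choose 2) - 1"
  let ?S = "sections C d"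
  define K where "K = \<Phi> 0 ` forms d"
  have chart0: "affine_chart u A 0 = vec.span {u}" by (simp add: affine_chart_def)
  have K: "cone_map C d (vec.span {u}) = K" using cone_map_eq[of d 0] by (simp add: chart0 K_def)
  have K_sub: "cfun.subspace K" unfolding K_def by (rule \<Phi>_image_subspace)
  have S_sub: "cfun.subspace ?S" by (rule sections_subspace)
  have KS: "K \<subseteq> ?S" unfolding K_def using \<Phi>_section by blast
  obtain B where B: "B \<subseteq> K" "cfun.independent B" "K \<subseteq> cfun.span B" "card B = cfun.dim K"
    using cfun.basis_exists by blast
  obtain Z where Z: "finite Z" "restrict_to C ` forms d \<subseteq> cfun.span Z" using sections_finite by blast
  have "K \<subseteq> cfun.span Z" using Z(2) \<Phi>_forms unfolding K_def by blast
  then have fin: "finite B" using cfun.independent_span_bound[OF Z(1) B(2)] B(1) by blast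
  have span_B: "cfun.span B = K" using B K_sub by (metis cfun.span_minimal subset_antisym)
  have card_B: "card B = ?n" using B(4) dim_cone_map by (simp add: K_def)
  \<comment> \<open>With the preimages fixed, the vectors \<open>\<Phi> t (g b)\<close> follow the
    subspace as the vertex moves.\<close>
  obtain g where g: "\<And>b. b \<in> B \<Longrightarrow> g b \<in> forms d" "\<And>b. b \<in> B \<Longrightarrow> \<Phi> 0 (g b) = b"
  proof -
    have "\<forall>b\<in>B. \<exists>F. F \<in> forms d \<and> \<Phi> 0 F = b" using B(1) unfolding K_def by blast
    from bchoice[OF this] show thesis using that by blast
  qed

  \<comment> \<open>\<open>B\<close> is completed to a basis of all functions so that the coordinate
    functionals \<beta> are defined everywhere, in particular on the moved vectors.\<close>
  define E where "E = cfun.extend_basis B"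
  have E: "cfun.independent E" "cfun.span E = UNIV" "B \<subseteq> E"
    unfolding E_def
    using cfun.independent_extend_basis[OF B(2)] cfun.span_extend_basis[OF B(2)]
      cfun.extend_basis_superset[OF B(2)] by blast+
  define \<beta> where "\<beta> b s = cfun.representation E s b" for b s
  have \<beta>: "functional (\<beta> b)" for b
    unfolding functional_def \<beta>_def
    using cfun.representation_add[OF E(1)] cfun.representation_scale[OF E(1)] E(2) by simp
  have \<beta>_basis: "\<beta> b b' = (if b = b' then 1 else 0)" if "b' \<in> B" for b b'
    unfolding \<beta>_def using cfun.representation_basis[OF E(1), of b'] E(3) that by auto
  have K_rep: "s = (\<Sum>b\<in>B. cfun_scale (\<beta> b s) b)" if s: "s \<in> K" for s
  proof -
    obtain a where a: "s = (\<Sum>b\<in>B. cfun_scale (a b) b)"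
      using cfun.span_finite[OF fin] s span_B by auto
    have "\<beta> b s = a b" if b: "b \<in> B" for b
    proof -
      have "\<beta> b s = (\<Sum>b'\<in>B. a b' * \<beta> b b')"
        unfolding a by (simp only: functional_sum[OF \<beta>] functional_scale[OF \<beta>])
      also have "\<dots> = (\<Sum>b'\<in>B. (if b = b' then 1 else 0) * a b')"
        by (intro sum.cong) (auto simp: \<beta>_basis)
      finally show ?thesis using sum_delta_mult(1)[OF fin b] by simp
    qed
    then show ?thesis using a by (metis (no_types, lifting) sum.cong)
  qed

  \<comment> \<open>\<pi> projects onto \<open>K\<close> and \<rho> onto the common kernel of the
    coordinates, so \<rho> represents classes modulo \<open>K\<close>.\<close>
  define \<pi> where "\<pi> s = (\<Sum>b\<in>B. cfun_scale (\<beta> b s) b)" for s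
  define \<rho> where "\<rho> s = s - \<pi> s" for s
  have \<pi>_add: "\<pi> (s + t) = \<pi> s + \<pi> t" for s t
    unfolding \<pi>_def by (simp only: functional_add[OF \<beta>] cfun.scale_left_distrib sum.distrib)
  have \<pi>_scale: "\<pi> (cfun_scale a s) = cfun_scale a (\<pi> s)" for a s
    unfolding \<pi>_def by (simp only: functional_scale[OF \<beta>] cfun.scale_sum_right cfun.scale_scale)
  have \<rho>_add: "\<rho> (s + t) = \<rho> s + \<rho> t" for s t unfolding \<rho>_def \<pi>_add by (simp add: algebra_simps)
  have \<rho>_scale: "\<rho> (cfun_scale a s) = cfun_scale a (\<rho> s)" for a s
    unfolding \<rho>_def \<pi>_scale by (simp only: cfun.scale_right_diff_distrib)
  have \<rho>y: "functional (\<lambda>s. \<rho> s y)" for y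
    unfolding functional_def \<rho>_add \<rho>_scale by (simp add: cfun_scale_def)
  have \<pi>_K: "\<pi> s \<in> K" for s
    unfolding \<pi>_def span_B[symmetric] by (intro cfun.span_sum cfun.span_scale cfun.span_base)
  have \<rho>_K: "\<rho> s = 0" if "s \<in> K" for s using K_rep[OF that] unfolding \<rho>_def \<pi>_def by simp
  have \<beta>_\<pi>: "\<beta> b (\<pi> s) = \<beta> b s" if b: "b \<in> B" for b s
  proof -
    have "\<beta> b (\<pi> s) = (\<Sum>b'\<in>B. \<beta> b' s * \<beta> b b')"
      unfolding \<pi>_def by (simp only: functional_sum[OF \<beta>] functional_scale[OF \<beta>])
    also have "\<dots> = (\<Sum>b'\<in>B. (if b = b' then 1 else 0) * \<beta> b' s)"
      by (intro sum.cong) (auto simp: \<beta>_basis)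
    finally show ?thesis using sum_delta_mult(1)[OF fin b] by simp
  qed
  have \<beta>_\<rho>: "\<beta> b (\<rho> s) = 0" if "b \<in> B" for b s
    unfolding \<rho>_def by (simp only: functional_diff[OF \<beta>] \<beta>_\<pi>[OF that] diff_self)
  have \<rho>_fixed: "\<rho> s = s" if "\<And>b. b \<in> B \<Longrightarrow> \<beta> b s = 0" for s
  proof -
    have "\<pi> s = 0" unfolding \<pi>_def using that by (intro sum.neutral) simp
    then show ?thesis by (simp add: \<rho>_def)
  qed
  have \<rho>_S: "\<rho> s \<in> ?S" if "s \<in> ?S" for s
    unfolding \<rho>_def using that \<pi>_K KS by (intro cfun.subspace_diff[OF S_sub]) auto
  define M where "M = {s \<in> ?S. \<forall>b\<in>B. \<beta> b s = 0}"
  have \<rho>_M: "\<rho> s \<in> M" if "s \<in> ?S" for s using \<rho>_S[OF that] \<beta>_\<rho> by (simp add: M_def)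
  have M_sub: "cfun.subspace M"
    unfolding M_def cfun.subspace_def
    using cfun.subspace_0[OF S_sub] cfun.subspace_add[OF S_sub] cfun.subspace_scale[OF S_sub]
    by (simp add: functional_zero[OF \<beta>] functional_add[OF \<beta>] functional_scale[OF \<beta>])
  have complement: "complement_in ?S K M"
    unfolding complement_in_def
  proof (intro conjI)
    show "cfun.subspace M" by (rule M_sub)
    show "K \<inter> M = {0}"
    proof (intro equalityI subsetI)
      fix s assume s: "s \<in> K \<inter> M"
      then have "\<rho> s = s" by (intro \<rho>_fixed) (simp add: M_def)
      with \<rho>_K s show "s \<in> {0}" by simp
    qed (use cfun.subspace_0[OF K_sub] cfun.subspace_0[OF M_sub] in simp)
    show "{k + m |k m. k \<in> K \<and> m \<in> M} = ?S"
    proof (intro equalityI subsetI)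
      fix s assume "s \<in> {k + m |k m. k \<in> K \<and> m \<in> M}"
      then show "s \<in> ?S" using KS cfun.subspace_add[OF S_sub] by (auto simp: M_def)
    next
      fix s assume s: "s \<in> ?S"
      have "s = \<pi> s + \<rho> s" by (simp add: \<rho>_def)
      then show "s \<in> {k + m |k m. k \<in> K \<and> m \<in> M}" using \<pi>_K \<rho>_M[OF s] by blast
    qed
  qed

  \<comment> \<open>The \<beta>-coordinates of the moved basis vectors; at \<open>t = 0\<close> this
    is the identity matrix.\<close>
  define m where "m t b b' = \<beta> b (\<Phi> t (g b'))" for t b b'
  have lim: "((\<lambda>t. \<beta> b (\<Phi> t F)) \<longlongrightarrow> \<beta> b (\<Phi> 0 F)) (nhds 0)" if F: "F \<in> forms d" for b F
  proof -
    have "isCont (\<lambda>t. \<beta> b (\<Phi> t F)) 0"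
      using \<Phi>_derivative[OF F \<beta>] by (rule has_derivative_continuous)
    then show ?thesis
      unfolding isCont_def tendsto_at_iff_tendsto_nhds[of "\<lambda>t. \<beta> b (\<Phi> t F)"] .
  qed
  have lim_m: "((\<lambda>t. m t b b') \<longlongrightarrow> (if b = b' then 1 else 0)) (nhds 0)" if "b \<in> B" "b' \<in> B" for b b'
    using lim[OF g(1)[OF that(2)], of b] unfolding m_def g(2)[OF that(2)] \<beta>_basis[OF that(2)] .
  obtain n where n_lim: "\<And>b b'. b \<in> B \<Longrightarrow> b' \<in> B \<Longrightarrow> ((\<lambda>t. n t b b') \<longlongrightarrow> (if b = b' then 1 else 0)) (nhds 0)"
    and n_inv: "\<forall>\<^sub>F t in nhds 0. inverse_on B (m t) (n t)"
    by (rule inverse_near_identity[of B m "nhds 0", OF fin], rule lim_m, assumption, assumption, rule that)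
  define good where "good t \<longleftrightarrow> inverse_on B (m t) (n t)" for t
  have good: "\<forall>\<^sub>F t in nhds 0. good t" using n_inv unfolding good_def .
  \<comment> \<open>For good \<open>t\<close> these are the coefficients, in the family
    \<open>\<Phi> t (g b')\<close>, of the vector in its span that has the same \<beta>-coordinates
    as \<open>s\<close>.\<close>
  define \<gamma> where "\<gamma> t s b' = (\<Sum>b\<in>B. n t b' b * \<beta> b s)" for t s b'

  \<comment> \<open>Invertibility makes the moved basis vectors independent; by the dimension bound
    they then span the whole image at \<open>t\<close>.\<close>
  have rep_at: "\<Phi> t F = (\<Sum>b'\<in>B. cfun_scale (\<gamma> t (\<Phi> t F) b') (\<Phi> t (g b')))"
    if t: "good t" and F: "F \<in> forms d" for t F
  proof -
    let ?V = "\<lambda>b'. \<Phi> t (g b')"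
    have inv: "(\<Sum>b\<in>B. n t b' b * \<beta> b (\<Sum>b''\<in>B. cfun_scale (a b'') (?V b''))) = a b'"
      if b': "b' \<in> B" for a b'
    proof -
      have "\<beta> b (\<Sum>b''\<in>B. cfun_scale (a b'') (?V b'')) = (\<Sum>b''\<in>B. a b'' * m t b b'')" for b
        unfolding m_def by (simp only: functional_sum[OF \<beta>] functional_scale[OF \<beta>])
      then have "(\<Sum>b\<in>B. n t b' b * \<beta> b (\<Sum>b''\<in>B. cfun_scale (a b'') (?V b'')))
          = (\<Sum>b\<in>B. \<Sum>b''\<in>B. (n t b' b * m t b b'') * a b'')"
        by (simp only: sum_distrib_left) (simp only: mult_ac)
      also have "\<dots> = (\<Sum>b''\<in>B. (\<Sum>b\<in>B. n t b' b * m t b b'') * a b'')"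
        unfolding sum_distrib_right by (rule sum.swap)
      also have "\<dots> = (\<Sum>b''\<in>B. (if b' = b'' then 1 else 0) * a b'')"
        using t b' unfolding good_def inverse_on_def by (intro sum.cong) auto
      finally show ?thesis using sum_delta_mult(1)[OF fin b'] by simp
    qed
    have ind: "\<forall>b\<in>B. a b = 0" if "(\<Sum>b\<in>B. cfun_scale (a b) (?V b)) = 0" for a
    proof
      fix b assume b: "b \<in> B"
      from inv[OF b, of a] show "a b = 0" unfolding that by (simp add: functional_zero[OF \<beta>])
    qed
    let ?U = "cfun.span (?V ` B)"
    have "cfun.dim ?U = ?n"
      using cfun_independent_family[of B ?V, OF fin ind] card_B
      by (simp add: cfun.dim_eq_card_independent card_image)
    moreover have "?U \<subseteq> \<Phi> t ` forms d"
      by (rule cfun.span_minimal[OF _ \<Phi>_image_subspace]) (use g(1) in blast)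
    moreover have "\<Phi> t ` forms d \<subseteq> cfun.span Z" using Z(2) \<Phi>_forms by blast
    ultimately have "?U = \<Phi> t ` forms d"
      using dim_cone_map_at[of t] by (intro cfun_subspace_eq[OF cfun.subspace_span _ _ Z(1)]) auto
    then have "\<Phi> t F \<in> ?U" using F by blast
    then obtain a where a: "\<Phi> t F = (\<Sum>b\<in>B. cfun_scale (a b) (?V b))"
      using cfun_span_family[OF fin] by blast
    have "\<gamma> t (\<Phi> t F) b' = a b'" if "b' \<in> B" for b'
      unfolding \<gamma>_def a by (rule inv[OF that])
    then show ?thesis using a by (metis (no_types, lifting) sum.cong)
  qed

  define D where "D \<tau> s = (\<Sum>b\<in>B. cfun_scale (\<beta> b s) (\<rho> (\<Phi>' \<tau> (g b))))" for \<tau> s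
  \<comment> \<open>To a basis vector \<open>b\<close> corresponds the point of the moved subspace
    with the same \<beta>-coordinates, minus \<open>b\<close>; the difference therefore lies in
    \<open>M\<close>.\<close>
  define T where "T t s = (\<Sum>b\<in>B. cfun_scale (\<beta> b s) ((\<Sum>b'\<in>B. cfun_scale (n t b' b) (\<Phi> t (g b'))) - b))" for t s
  have T_eq: "s + T t s = (\<Sum>b'\<in>B. cfun_scale (\<gamma> t s b') (\<Phi> t (g b')))" if s: "s \<in> K" for t s
  proof -
    have "T t s = (\<Sum>b\<in>B. \<Sum>b'\<in>B. cfun_scale (n t b' b * \<beta> b s) (\<Phi> t (g b'))) - (\<Sum>b\<in>B. cfun_scale (\<beta> b s) b)"
      unfolding T_def
      by (simp only: cfun.scale_right_diff_distrib sum_subtractf cfun.scale_sum_right cfun.scale_scale mult.commute)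
    also have "(\<Sum>b\<in>B. cfun_scale (\<beta> b s) b) = s" using K_rep[OF s] ..
    also have "(\<Sum>b\<in>B. \<Sum>b'\<in>B. cfun_scale (n t b' b * \<beta> b s) (\<Phi> t (g b')))
        = (\<Sum>b'\<in>B. cfun_scale (\<gamma> t s b') (\<Phi> t (g b')))"
      unfolding \<gamma>_def cfun.scale_sum_left by (rule sum.swap)
    finally have T: "T t s = (\<Sum>b'\<in>B. cfun_scale (\<gamma> t s b') (\<Phi> t (g b'))) - s" .
    show ?thesis unfolding T by (rule trans[OF add.commute diff_add_cancel])
  qed
  have \<Phi>g_S: "\<Phi> t (g b) \<in> ?S" if "b \<in> B" for t b using \<Phi>_section[OF g(1)[OF that]] .
  have T_M: "T t s \<in> M" if t: "good t" and s: "s \<in> K" for t s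
  proof -
    have "T t s = (\<Sum>b'\<in>B. cfun_scale (\<gamma> t s b') (\<Phi> t (g b'))) - s"
      using T_eq[OF s, of t] by (metis add_diff_cancel_left')
    moreover have "(\<Sum>b'\<in>B. cfun_scale (\<gamma> t s b') (\<Phi> t (g b'))) \<in> ?S"
      by (intro cfun.subspace_sum[OF S_sub] cfun.subspace_scale[OF S_sub] \<Phi>g_S)
    ultimately have "T t s \<in> ?S" using s KS by (auto intro: cfun.subspace_diff[OF S_sub])
    moreover have "\<beta> b (T t s) = 0" if b: "b \<in> B" for b
    proof -
      have "\<beta> b ((\<Sum>b'\<in>B. cfun_scale (n t b' b0) (\<Phi> t (g b'))) - b0) = 0" if b0: "b0 \<in> B" for b0
      proof -
        have "\<beta> b (\<Sum>b'\<in>B. cfun_scale (n t b' b0) (\<Phi> t (g b'))) = (\<Sum>b'\<in>B. m t b b' * n t b' b0)"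
          unfolding m_def by (simp only: functional_sum[OF \<beta>] functional_scale[OF \<beta>] mult.commute)
        also have "\<dots> = (if b = b0 then 1 else 0)" using t b b0 unfolding good_def inverse_on_def by blast
        finally show ?thesis by (simp only: functional_diff[OF \<beta>] \<beta>_basis[OF b0] diff_self)
      qed
      then show ?thesis
        unfolding T_def by (simp add: functional_sum[OF \<beta>] functional_scale[OF \<beta>])
    qed
    ultimately show ?thesis by (simp add: M_def)
  qed

  \<comment> \<open>One computation for two uses: \<open>r\<close> constant gives the derivative of
    \<open>T\<close>, and \<open>r t = \<Phi> t F\<close> gives the class of
    \<open>\<Phi>' \<tau> F\<close>. Each factor \<open>\<rho> (\<Phi> t (g b'))\<close> vanishes at
    \<open>t = 0\<close>, so only the limits of the coefficients matter.\<close>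
  have derivative: "((\<lambda>t. (\<Sum>b'\<in>B. \<gamma> t (r t) b' * \<rho> (\<Phi> t (g b')) y)) has_derivative (\<lambda>\<tau>. D \<tau> s y)) (at 0)"
    if r: "\<And>b. b \<in> B \<Longrightarrow> ((\<lambda>t. \<beta> b (r t)) \<longlongrightarrow> \<beta> b s) (nhds 0)" for r s y
  proof -
    have "((\<lambda>t. \<gamma> t (r t) b' * \<rho> (\<Phi> t (g b')) y) has_derivative (\<lambda>\<tau>. \<beta> b' s * \<rho> (\<Phi>' \<tau> (g b')) y)) (at 0)"
      if b': "b' \<in> B" for b'
    proof (rule has_derivative_mult_vanishing)
      show "((\<lambda>t. \<rho> (\<Phi> t (g b')) y) has_derivative (\<lambda>\<tau>. \<rho> (\<Phi>' \<tau> (g b')) y)) (at 0)"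
        by (rule \<Phi>_derivative[OF g(1)[OF b'] \<rho>y])
      have "\<rho> b' = 0" using \<rho>_K B(1) b' by blast
      then show "\<rho> (\<Phi> 0 (g b')) y = 0" by (simp add: g(2)[OF b'])
      have "((\<lambda>t. \<gamma> t (r t) b') \<longlongrightarrow> (\<Sum>b\<in>B. (if b' = b then 1 else 0) * \<beta> b s)) (nhds 0)"
        unfolding \<gamma>_def by (intro tendsto_sum tendsto_mult n_lim r b')
      then have "((\<lambda>t. \<gamma> t (r t) b') \<longlongrightarrow> \<beta> b' s) (nhds 0)"
        unfolding sum_delta_mult(1)[OF fin b'] .
      then show "((\<lambda>t. \<gamma> t (r t) b') \<longlongrightarrow> \<beta> b' s) (at 0)"
        by (rule tendsto_mono[rotated]) (simp add: at_within_def)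
    qed
    from has_derivative_sum[OF this]
    have "((\<lambda>t. \<Sum>b'\<in>B. \<gamma> t (r t) b' * \<rho> (\<Phi> t (g b')) y) has_derivative
        (\<lambda>\<tau>. \<Sum>b'\<in>B. \<beta> b' s * \<rho> (\<Phi>' \<tau> (g b')) y)) (at 0)" .
    moreover have "D \<tau> s y = (\<Sum>b'\<in>B. \<beta> b' s * \<rho> (\<Phi>' \<tau> (g b')) y)" for \<tau>
      unfolding D_def sum_fun_apply by (simp add: cfun_scale_def)
    ultimately show ?thesis by simp
  qed
  have \<rho>_sum: "\<rho> (\<Sum>b'\<in>B. cfun_scale (a b') (x b')) y = (\<Sum>b'\<in>B. a b' * \<rho> (x b') y)" for a x y
    by (simp only: functional_sum[OF \<rho>y] functional_scale[OF \<rho>y])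

  have T_derivative: "((\<lambda>t. T t s y) has_derivative (\<lambda>\<tau>. D \<tau> s y)) (at 0)" if s: "s \<in> K" for s y
  proof -
    have eq: "(\<Sum>b'\<in>B. \<gamma> t s b' * \<rho> (\<Phi> t (g b')) y) = T t s y" if t: "good t" for t
    proof -
      have "\<rho> (T t s) = T t s" using T_M[OF t s] by (intro \<rho>_fixed) (simp add: M_def)
      moreover have "\<rho> (s + T t s) = \<rho> (T t s)" using \<rho>_K[OF s] by (simp add: \<rho>_add)
      ultimately have "T t s y = \<rho> (\<Sum>b'\<in>B. cfun_scale (\<gamma> t s b') (\<Phi> t (g b'))) y"
        by (simp only: T_eq[OF s])
      then show ?thesis by (simp only: \<rho>_sum)
    qed
    show ?thesis
    proof (rule has_derivative_transform_eventually)
      show "((\<lambda>t. \<Sum>b'\<in>B. \<gamma> t s b' * \<rho> (\<Phi> t (g b')) y) has_derivative (\<lambda>\<tau>. D \<tau> s y)) (at 0)"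
        by (rule derivative) simp
      have "\<forall>\<^sub>F t in at 0. good t" using good by (auto simp: eventually_at_filter elim: eventually_mono)
      then show "\<forall>\<^sub>F t in at 0. (\<Sum>b'\<in>B. \<gamma> t s b' * \<rho> (\<Phi> t (g b')) y) = T t s y"
        by (rule eventually_mono) (rule eq)
      show "(\<Sum>b'\<in>B. \<gamma> 0 s b' * \<rho> (\<Phi> 0 (g b')) y) = T 0 s y"
        by (rule eq[OF eventually_nhds_x_imp_x[OF good]])
    qed simp
  qed

  text \<open>The class of \<open>\<Phi>' \<tau> F\<close> modulo \<open>K\<close> depends on \<open>\<Phi> 0 F\<close> only, although \<open>D\<close> is defined by
    means of the chosen preimages \<open>g b\<close>; this uses that the dimension of the image does not jump.\<close>

  have \<Phi>'_D: "\<rho> (\<Phi>' \<tau> F) = D \<tau> (\<Phi> 0 F)" if F: "F \<in> forms d" for \<tau> F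
  proof
    fix y
    have eq: "(\<Sum>b'\<in>B. \<gamma> t (\<Phi> t F) b' * \<rho> (\<Phi> t (g b')) y) = \<rho> (\<Phi> t F) y" if "good t" for t
      by (subst (2) rep_at[OF that F]) (simp only: \<rho>_sum)
    have "((\<lambda>t. \<rho> (\<Phi> t F) y) has_derivative (\<lambda>\<tau>. D \<tau> (\<Phi> 0 F) y)) (at 0)"
    proof (rule has_derivative_transform_eventually)
      show "((\<lambda>t. \<Sum>b'\<in>B. \<gamma> t (\<Phi> t F) b' * \<rho> (\<Phi> t (g b')) y) has_derivative (\<lambda>\<tau>. D \<tau> (\<Phi> 0 F) y)) (at 0)"
        by (rule derivative) (rule lim[OF F])
      have "\<forall>\<^sub>F t in at 0. good t" using good by (auto simp: eventually_at_filter elim: eventually_mono)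
      then show "\<forall>\<^sub>F t in at 0. (\<Sum>b'\<in>B. \<gamma> t (\<Phi> t F) b' * \<rho> (\<Phi> t (g b')) y) = \<rho> (\<Phi> t F) y"
        by (rule eventually_mono) (rule eq)
      show "(\<Sum>b'\<in>B. \<gamma> 0 (\<Phi> 0 F) b' * \<rho> (\<Phi> 0 (g b')) y) = \<rho> (\<Phi> 0 F) y"
        by (rule eq[OF eventually_nhds_x_imp_x[OF good]])
    qed simp
    from has_derivative_unique[OF \<Phi>_derivative[OF F \<rho>y] this]
    show "\<rho> (\<Phi>' \<tau> F) y = D \<tau> (\<Phi> 0 F) y" by (rule fun_cong)
  qed

  have \<Phi>'_S: "\<Phi>' \<tau> F \<in> ?S" if F: "F \<in> forms d" for \<tau> F
  proof -
    obtain d' where "d = Suc d'" using d_pos gr0_implies_Suc by blast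
    then have "\<Phi>' \<tau> F \<in> restrict_to C ` forms d" using \<Phi>'_forms[of F d' \<tau>] F by simp
    then obtain G where "G \<in> forms d" "\<Phi>' \<tau> F = restrict_to C G" by blast
    then show ?thesis by (simp only: restrict_to_sections)
  qed
  have D_M: "D \<tau> s \<in> M" for \<tau> s
    unfolding D_def
    by (intro cfun.subspace_sum[OF M_sub] cfun.subspace_scale[OF M_sub] \<rho>_M \<Phi>'_S g(1))
  have lin_sum: "cfun_linear (\<lambda>s. \<Sum>b\<in>B. cfun_scale (\<beta> b s) (x b))"
    for x :: "(complex^4 \<Rightarrow> complex) \<Rightarrow> complex^4 \<Rightarrow> complex"
    by (rule cfun_linearI)
       (simp_all only: functional_add[OF \<beta>] functional_scale[OF \<beta>] cfun.scale_left_distrib sum.distrib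
          cfun.scale_sum_right cfun.scale_scale)

  have "has_differential_in_charts ?n ?S (cone_map C d) (vec.span {u}) u A M D"
    unfolding has_differential_in_charts_def K
  proof (intro conjI allI ballI)
    show "K \<in> grassmannian ?n ?S"
      unfolding grassmannian_def using B(2) fin card_B span_B KS by (intro CollectI exI[of _ B]) simp
    have "inj (\<lambda>x. A *v x)" by (rule inj_on_inverseI[of _ "\<lambda>v. \<Xi> *v v"]) (simp add: \<Xi>A)
    moreover have "u \<notin> range (\<lambda>x. A *v x)"
    proof
      assume "u \<in> range (\<lambda>x. A *v x)"
      then obtain x where x: "u = A *v x" by blast
      then have "x = 0" using \<Xi>A[of x] \<Xi>u by simp
      then show False using x u by simp
    qed
    ultimately show "chart_centre u A (vec.span {u})" by (simp add: chart_centre_def)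
    show "complement_in ?S K M" by (rule complement)
    show "D x \<in> hom_between K M" for x
      unfolding hom_between_def using D_M lin_sum[of "\<lambda>b. \<rho> (\<Phi>' x (g b))"]
      by (auto simp: D_def[abs_def])
    show "Vector_Spaces.linear (*s) cfun_scale (\<lambda>x. D x s)" for s
    proof -
      have "D (x + y) s = D x s + D y s" for x y
        unfolding D_def sum.distrib[symmetric] cfun.scale_right_distrib[symmetric] \<rho>_add[symmetric]
        by (intro sum.cong refl) (simp only: \<Phi>'_add[OF g(1)])
      moreover have "D (a *s x) s = cfun_scale a (D x s)" for a x
      proof -
        have "D (a *s x) s = (\<Sum>b\<in>B. cfun_scale (\<beta> b s) (cfun_scale a (\<rho> (\<Phi>' x (g b)))))"
          unfolding D_def \<rho>_scale[symmetric] by (intro sum.cong refl) (simp only: \<Phi>'_scale[OF g(1)])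
        then show ?thesis
          unfolding D_def by (simp only: cfun.scale_sum_right cfun.scale_scale mult.commute)
      qed
      ultimately show ?thesis
        by (simp add: Vector_Spaces.linear_iff vec.vector_space_axioms cfun.vector_space_axioms)
    qed
    have graph: "T t \<in> hom_between K M \<and> cone_map C d (affine_chart u A t) = graph_over K (T t)"
      if t: "good t" for t
    proof
      have "cfun_linear (T t)" unfolding T_def[abs_def] by (rule lin_sum)
      then show "T t \<in> hom_between K M" unfolding hom_between_def using T_M[OF t] by auto
      show "cone_map C d (affine_chart u A t) = graph_over K (T t)"
        unfolding cone_map_eq
      proof (intro equalityI subsetI)
        fix k assume "k \<in> \<Phi> t ` forms d"
        then obtain F where F: "F \<in> forms d" "k = \<Phi> t F" by blast
        \<comment> \<open>\<gamma> sees only \<beta>-coordinates, which \<pi> preserves. Hence the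
          point of the graph over \<open>\<pi> k\<close> is \<open>k\<close>.\<close>
        have "\<gamma> t (\<pi> k) b' = \<gamma> t k b'" for b' unfolding \<gamma>_def by (simp add: \<beta>_\<pi>)
        then have "k = \<pi> k + T t (\<pi> k)"
          unfolding T_eq[OF \<pi>_K] using rep_at[OF t F(1)] unfolding F(2) by simp
        then show "k \<in> graph_over K (T t)" unfolding graph_over_def using \<pi>_K by blast
      next
        fix k assume "k \<in> graph_over K (T t)"
        then obtain s where s: "s \<in> K" "k = s + T t s" unfolding graph_over_def by blast
        show "k \<in> \<Phi> t ` forms d"
          unfolding s(2) T_eq[OF s(1)]
          by (intro cfun.subspace_sum[OF \<Phi>_image_subspace] cfun.subspace_scale[OF \<Phi>_image_subspace]
              imageI g(1))
      qed
    qed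
    show "\<exists>T. (\<forall>\<^sub>F x in nhds 0. T x \<in> hom_between K M \<and> cone_map C d (affine_chart u A x) = graph_over K (T x)) \<and>
        (\<forall>s\<in>K. \<forall>y. ((\<lambda>x. T x s y) has_derivative (\<lambda>x. D x s y)) (at 0))"
      using eventually_mono[OF good graph] T_derivative by (intro exI[of _ T] conjI ballI allI)
  qed
  moreover have "\<tau> = 0" if D0: "\<forall>s\<in>K. D \<tau> s = 0" for \<tau>
  proof (rule ccontr)
    assume \<tau>: "\<tau> \<noteq> 0"
    obtain d' where d': "d = Suc d'" using d_pos gr0_implies_Suc by blast
    \<comment> \<open>Take \<open>F\<close> with derivative \<open>h\<close> in direction \<tau>.
      The vanishing of \<open>D\<close> puts \<open>\<Phi>' \<tau> F\<close> into \<open>K\<close>,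
      so \<open>- W h\<close> is the pullback of a plane form on \<open>C\<close>.\<close>
    have "on_plane_ring d (\<lambda>v. W v * h (\<Xi> *v v))" if h: "h \<in> forms (d - 1)" for h
    proof -
      have "h \<in> forms d'" using h d' by simp
      then obtain F where F': "F \<in> forms (Suc d')" and dF: "\<And>v. dird \<tau> F v = h v"
        by (rule dird_surj[OF \<tau>]) (rule that)
      have F: "F \<in> forms d" using F' by (simp only: d')
      have "\<rho> (\<Phi>' \<tau> F) = 0" using D0 \<Phi>'_D[OF F] F by (simp add: K_def)
      then have "\<Phi>' \<tau> F = \<pi> (\<Phi>' \<tau> F)" by (simp add: \<rho>_def)
      then have "\<Phi>' \<tau> F \<in> K" using \<pi>_K by metis
      then obtain G where G: "G \<in> forms d" "\<Phi>' \<tau> F = \<Phi> 0 G" unfolding K_def by blast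
      have "- (W v * h (\<Xi> *v v)) = G (\<Xi> *v v)" if "v \<in> affine_cone C" for v
        using G(2) that unfolding \<Phi>'_def \<Phi>_def restrict_to_eq_iff proj_at_0 dF by blast
      then have "W v * h (\<Xi> *v v) = - G (\<Xi> *v v)" if "v \<in> affine_cone C" for v
        using that by (metis minus_minus)
      moreover have "(\<lambda>v. - G v) \<in> forms d" using G(1) by (rule forms_uminus)
      ultimately show ?thesis unfolding on_plane_ring_def by (intro bexI[of _ "\<lambda>v. - G v"]) simp_all
    qed
    then show False by (rule W_not_integral)
  qed
  ultimately show ?thesis
    unfolding injective_differential_at_def K by (intro exI[of _ u] exI[of _ A] exI[of _ M] exI[of _ D]) blast
qed

end

theorem theorem1p4:
  fixes C :: "(complex^4) set set" and d :: nat
  assumes "irreducible_projective_curve C"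
    and "smooth_curve C"
    and "nondegenerate C"
    and "curve_has_degree C d"
  shows "\<forall>q \<in> cone_map_domain C.
           injective_differential_at ((d + 2 choose 2) - 1) (sections C d) (cone_map C d) q"
proof
  fix q assume "q \<in> cone_map_domain C"
  then have q: "q \<in> pspace" "q \<notin> C" "birational_projection C q"
    by (auto simp: cone_map_domain_def nonbirational_points_def)
  obtain c where "\<forall>\<^sub>F m in sequentially. int (cfun.dim (restrict_to C ` forms m)) = int d * int m + c"
    using assms(4) by (auto simp: curve_has_degree_def)
  then interpret space_curve C d c
    using assms by unfold_locales (auto simp: irreducible_projective_curve_def)
  obtain \<Xi> A u W f where P: "plane_projection C d c \<Xi> A u W" and qu: "q = vec.span {u}"
    and f: "f \<in> plane_ideal \<Xi> d" "f (axis 3 1) \<noteq> 0"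
    "generates \<Xi> d f"
    by (rule good_projection[OF q]) (rule that)
  interpret P: curve_projection C d c \<Xi> A u W f
    by (intro curve_projection.intro curve_projection_axioms.intro P f)
  show "injective_differential_at ((d + 2 choose 2) - 1) (sections C d) (cone_map C d) q"
    unfolding qu by (rule P.injective_differential)
qed

end
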